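(* Let $n\ge 2k+1$ and $L\ge 1$. There is a constant $C(n,L)$ such that the following holds. Suppose that $X$ is a $k$-dimensional simplicial complex with $N$ vertices and each vertex lying in at most $L$ simplices. Then $X$ embeds with combinatorial thickness at least $1$ into the $n$-dimensional Euclidean ball of some radius $$R\le C(n,L)\,N^{\frac{1}{n-k}}(\log N)^{2k+2}.$$
   Context: Simplicial complexes are finite. An embedding means a topological embedding $I:X\to\mathbb{R}^n$ (not necessarily linear on simplices). It has combinatorial thickness at least $T$ if $\mathrm{dist}(I(\Delta_1),I(\Delta_2))\ge T$ for any two non-adjacent simplices $\Delta_1,\Delta_2$ of $X$, of any dimensions; two simplices are non-adjacent if they share no vertex. *)

theory Defs
  imports "HOL-Analysis.Analysis"
begin

text \<open>
  Finite abstract simplicial complexes, given by their sets of nonempty simplices. The vertex type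
  is fixed to be \<open>nat\<close>, which covers all finite complexes up to relabelling of vertices. With the
  geometric complexes of \<open>HOL-Analysis.Polytope\<close>, a constant that is uniform over all complexes
  could not be stated: it might depend on the ambient space, which is a type there.
\<close>

definition is_complex :: "nat set set \<Rightarrow> bool" where
  "is_complex X \<longleftrightarrow> finite X \<and> (\<forall>\<sigma>\<in>X. finite \<sigma> \<and> \<sigma> \<noteq> {}) \<and>
     (\<forall>\<sigma>\<in>X. \<forall>\<tau>. \<tau> \<subseteq> \<sigma> \<longrightarrow> \<tau> \<noteq> {} \<longrightarrow> \<tau> \<in> X)"

definition vertices :: "nat set set \<Rightarrow> nat set" where
  "vertices X = \<Union>X"

text \<open>The largest dimension of a simplex is exactly \<open>k\<close>; the complex need not be pure.\<close>

definition has_dimension :: "nat set set \<Rightarrow> nat \<Rightarrow> bool" where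
  "has_dimension X k \<longleftrightarrow> (\<exists>\<sigma>\<in>X. card \<sigma> = k + 1) \<and> (\<forall>\<sigma>\<in>X. card \<sigma> \<le> k + 1)"

text \<open>
  Closed simplices and the geometric realization in barycentric coordinates. The realization carries
  the subspace topology of the product topology on \<open>nat \<Rightarrow> real\<close>; only finitely many coordinates
  are not identically zero, so this is the usual topology.
\<close>

definition closed_simplex :: "nat set \<Rightarrow> (nat \<Rightarrow> real) set" where
  "closed_simplex \<sigma> = {x. (\<forall>v. 0 \<le> x v) \<and> (\<forall>v. v \<notin> \<sigma> \<longrightarrow> x v = 0) \<and> (\<Sum>v\<in>\<sigma>. x v) = 1}"

definition realization :: "nat set set \<Rightarrow> (nat \<Rightarrow> real) set" where
  "realization X = (\<Union>\<sigma>\<in>X. closed_simplex \<sigma>)"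

definition complex_embedding :: "nat set set \<Rightarrow> ((nat \<Rightarrow> real) \<Rightarrow> real ^ 'n) \<Rightarrow> bool" where
  "complex_embedding X I \<longleftrightarrow> embedding_map (top_of_set (realization X)) euclidean I"

definition non_adjacent :: "nat set \<Rightarrow> nat set \<Rightarrow> bool" where
  "non_adjacent \<sigma> \<tau> \<longleftrightarrow> \<sigma> \<inter> \<tau> = {}"

definition combinatorial_thickness_at_least ::
    "nat set set \<Rightarrow> ((nat \<Rightarrow> real) \<Rightarrow> real ^ 'n) \<Rightarrow> real \<Rightarrow> bool" where
  "combinatorial_thickness_at_least X I T \<longleftrightarrow>
     (\<forall>\<sigma>\<in>X. \<forall>\<tau>\<in>X. non_adjacent \<sigma> \<tau> \<longrightarrow>
        T \<le> setdist (I ` closed_simplex \<sigma>) (I ` closed_simplex \<tau>))"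

end

theory Submission
  imports Defs
begin

text \<open>
  Map the vertices at random into a cube of side about \<open>R = C N\<^bsup>1/(n-k)\<^esup>\<close> and extend linearly. A
  given unit ball meets a given simplex with probability of order \<open>R\<^bsup>k-n\<^esup>\<close>, and simplices without
  common vertices are independent, so with positive probability every unit ball meets only
  \<open>O(log N)\<close> simplices. Now move the points of the simplices by a random bounded amount varying at unit
  scale. Two disjoint simplices come \<open>\<epsilon>\<close>-close in a given unit ball with probability of order
  \<open>\<epsilon>\<^bsup>n-2k\<^esup> \<le> \<epsilon>\<close>, and each such event depends on only \<open>O(log N)\<close> others, so all of them
  can be avoided at once with \<open>\<epsilon>\<close> of order \<open>1 / log N\<close>. Rescaling by \<open>1/\<epsilon>\<close> and a final
  small generic perturbation, which makes the map injective as \<open>n > 2k\<close>, give the embedding, even with a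
  single factor \<open>log N\<close>.
\<close>

section \<open>Counting lattice points and assignments\<close>

text \<open>All randomness is uniform on finite integer grids, so that probabilities are quotients
  of cardinalities, and simplices are replaced by their barycentric lattice points: mesh 1/R for the
  density estimate, mesh 1/(R J) with J of order 1/\<epsilon> for the separation. Lipschitz bounds
  lead back to all points. The obstacle is that a random straight simplex may be nearly degenerate,
  and a bounded ball could then contain far more than about J^k of its lattice points. Colouring the
  vertices and keeping each colour near its own point of a configuration in general position forces
  every simplex to be expanded by a factor of at least R. The logarithm has one source: the union
  bound over about R^n centres needs m of order log N disjoint simplices, so the multiplicity M is
  of order log N. In the second step a random vector has J^n values, it takes part in about M J^(2k)
  events, and each event forbids boundedly many values of its pivot. As n - 2k is at least 1, it is
  enough that J exceeds a constant times M, and rescaling by J costs one factor log N.\<close>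

lemma card_int_interval_le:
  assumes "r \<ge> 0"
  shows "real (card {m::int. \<bar>real_of_int m - t\<bar> \<le> r}) \<le> 2 * r + 1"
proof -
  have "{m::int. \<bar>real_of_int m - t\<bar> \<le> r} = {\<lceil>t - r\<rceil>..\<lfloor>t + r\<rfloor>}"
    by (auto simp: abs_le_iff ceiling_le_iff le_floor_iff)
  moreover have "real (nat (\<lfloor>t + r\<rfloor> - \<lceil>t - r\<rceil> + 1)) \<le> 2 * r + 1"
    using assms by linarith
  ultimately show ?thesis by simp
qed

lemma card_nat_interval_le:
  assumes "r \<ge> 0"
  shows "finite {m::nat. \<bar>real m - t\<bar> \<le> r}" "real (card {m::nat. \<bar>real m - t\<bar> \<le> r}) \<le> 2 * r + 1"
proof -
  have sub: "int ` {m::nat. \<bar>real m - t\<bar> \<le> r} \<subseteq> {m::int. \<bar>real_of_int m - t\<bar> \<le> r}" by auto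
  have fin: "finite {m::int. \<bar>real_of_int m - t\<bar> \<le> r}"
    by (rule finite_subset[of _ "{\<lceil>t - r\<rceil>..\<lfloor>t + r\<rfloor>}"]) (auto simp: abs_le_iff ceiling_le_iff le_floor_iff)
  show "finite {m::nat. \<bar>real m - t\<bar> \<le> r}"
    using finite_subset[OF sub fin] finite_imageD[of int] by (metis inj_of_nat inj_on_subset subset_UNIV)
  have "card {m::nat. \<bar>real m - t\<bar> \<le> r} = card (int ` {m::nat. \<bar>real m - t\<bar> \<le> r})"
    by (simp add: card_image)
  also have "\<dots> \<le> card {m::int. \<bar>real_of_int m - t\<bar> \<le> r}"
    using sub fin by (rule card_mono[rotated])
  finally show "real (card {m::nat. \<bar>real m - t\<bar> \<le> r}) \<le> 2 * r + 1"
    using card_int_interval_le[OF assms, of t] by linarith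
qed

text \<open>Plays two roles: sample space of the random vectors, and set of centres at which balls
  of bounded radius are tested.\<close>

definition grid :: "nat \<Rightarrow> (real^'n) set" where
  "grid Q = {z. \<forall>i. z $ i \<in> real ` {..<Q}}"

lemma grid_eq: "grid Q = (\<lambda>f. (\<chi> i. f i) :: real^'n) ` (PiE UNIV (\<lambda>_. real ` {..<Q}))"
proof -
  have "z \<in> (\<lambda>f. (\<chi> i. f i) :: real^'n) ` (PiE UNIV (\<lambda>_. real ` {..<Q}))" if "z \<in> grid Q" for z
    using that by (intro image_eqI[of _ _ "\<lambda>i. z $ i"]) (auto simp: grid_def)
  then show ?thesis by (auto simp: grid_def PiE_def Pi_def)
qed

lemma finite_grid [simp]: "finite (grid Q)"
  unfolding grid_eq by (intro finite_imageI finite_PiE) auto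

lemma card_grid: "card (grid Q :: (real^'n) set) = Q ^ CARD('n)"
proof -
  have "inj_on (\<lambda>f. (\<chi> i. f i) :: real^'n) A" for A
    by (auto simp: inj_on_def vec_eq_iff)
  then show ?thesis
    unfolding grid_eq by (simp add: card_image card_PiE)
qed

lemma norm_le_of_components:
  fixes z :: "real^'n"
  assumes "\<And>i. \<bar>z $ i\<bar> \<le> c"
  shows "norm z \<le> real CARD('n) * c"
proof -
  have "norm z \<le> (\<Sum>i\<in>UNIV. \<bar>z $ i\<bar>)" by (rule norm_le_l1_cart)
  also have "\<dots> \<le> (\<Sum>i\<in>(UNIV::'n set). c)" using assms by (intro sum_mono) auto
  finally show ?thesis by simp
qed

lemma norm_grid_le:
  assumes "(z :: real^'n) \<in> grid Q"
  shows "norm z \<le> real CARD('n) * real Q"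
proof (rule norm_le_of_components)
  fix i
  from assms have "z $ i \<in> real ` {..<Q}" by (auto simp: grid_def)
  then show "\<bar>z $ i\<bar> \<le> real Q" by auto
qed

lemma card_grid_ball:
  fixes t :: "real^'n"
  assumes "r \<ge> 0"
  shows "real (card {z \<in> grid Q. norm (z - t) \<le> r}) \<le> (2 * r + 1) ^ CARD('n)"
proof -
  let ?F = "\<lambda>i. {m::nat. \<bar>real m - t $ i\<bar> \<le> r}"
  let ?P = "PiE (UNIV::'n set) ?F"
  have finP: "finite ?P" using card_nat_interval_le(1)[OF assms] by (intro finite_PiE) auto
  have "{z \<in> grid Q. norm (z - t) \<le> r} \<subseteq> (\<lambda>f. (\<chi> i. real (f i)) :: real^'n) ` ?P"
  proof
    fix z assume z: "z \<in> {z \<in> grid Q. norm (z - t) \<le> r}"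
    then have "\<forall>i. \<exists>m. z $ i = real m" by (auto simp: grid_def)
    then obtain f where f: "\<And>i. z $ i = real (f i)" by metis
    have "\<bar>z $ i - t $ i\<bar> \<le> r" for i
      using component_le_norm_cart[of "z - t" i] z by simp
    then show "z \<in> (\<lambda>f. (\<chi> i. real (f i)) :: real^'n) ` ?P"
      using f by (intro image_eqI[of _ _ f]) (auto simp: vec_eq_iff)
  qed
  then have "card {z \<in> grid Q. norm (z - t) \<le> r} \<le> card ?P"
    using surj_card_le[OF finP] by blast
  moreover have "real (card ?P) \<le> (\<Prod>i\<in>(UNIV::'n set). (2 * r + 1))"
    unfolding card_PiE[OF finite] of_nat_prod
    using card_nat_interval_le(2)[OF assms] by (intro prod_mono) auto
  ultimately show ?thesis by simp
qed

text \<open>Dividing by \<open>c\<close> gives a ball of radius \<open>r / c\<close>. The bound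
  involves neither \<open>Q\<close> nor \<open>t\<close>: a random grid vector with coefficient
  \<open>c\<close> hits a given ball with probability of order Q^(-n), whatever the other variables
  contribute to \<open>t\<close>.\<close>

lemma card_grid_affine:
  fixes t :: "real^'n"
  assumes "r \<ge> 0" "c > 0"
  shows "real (card {z \<in> grid Q. norm (c *\<^sub>R z + t) \<le> r}) \<le> (2 * (r / c) + 1) ^ CARD('n)"
proof -
  have "norm (c *\<^sub>R z + t) = c * norm (z - (- (1 / c)) *\<^sub>R t)" for z
  proof -
    have "c *\<^sub>R z + t = c *\<^sub>R (z - (- (1 / c)) *\<^sub>R t)"
      using assms by (simp add: scaleR_right_distrib)
    then show ?thesis using assms by simp
  qed
  moreover have "c * x \<le> r \<longleftrightarrow> x \<le> r / c" for x
    using \<open>c > 0\<close> by (simp add: pos_le_divide_eq mult.commute)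
  ultimately have "{z \<in> grid Q. norm (c *\<^sub>R z + t) \<le> r} = {z \<in> grid Q. norm (z - (- (1 / c)) *\<^sub>R t) \<le> r / c}"
    by (simp only:)
  then have "card {z \<in> grid Q. norm (c *\<^sub>R z + t) \<le> r} = card {z \<in> grid Q. norm (z - (- (1 / c)) *\<^sub>R t) \<le> r / c}"
    by (rule arg_cong)
  then show ?thesis
    using card_grid_ball[of "r / c" Q "(- (1 / c)) *\<^sub>R t"] assms by (simp only: divide_nonneg_pos)
qed

lemma grid_near:
  fixes y :: "real^'n"
  assumes "\<And>i. 0 \<le> y $ i \<and> y $ i < real Q"
  obtains z where "z \<in> grid Q" "norm (y - z) \<le> real CARD('n)"
proof
  let ?z = "(\<chi> i. real (nat \<lfloor>y $ i\<rfloor>)) :: real^'n"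
  have "nat \<lfloor>y $ i\<rfloor> < Q" for i
    using assms[of i] by linarith
  then show "?z \<in> grid Q" by (auto simp: grid_def)
  have "\<bar>(y - ?z) $ i\<bar> \<le> 1" for i
  proof -
    have "real (nat \<lfloor>y $ i\<rfloor>) = of_int \<lfloor>y $ i\<rfloor>" using assms[of i] by simp
    then show ?thesis by simp linarith
  qed
  from norm_le_of_components[of "y - ?z", OF this] show "norm (y - ?z) \<le> real CARD('n)" by simp
qed

section \<open>Counting assignments one variable at a time\<close>

text \<open>The value at \<open>v\<close> is chosen last: a partial assignment has at most
  \<open>K\<close> completions satisfying \<open>P\<close>, and only those with at least one
  completion contribute.\<close>

lemma card_PiE_insert_le:
  assumes "finite A" "finite S"
    and K: "\<And>u. u \<in> PiE A (\<lambda>_. S) \<Longrightarrow> card {s \<in> S. P (u(v := s))} \<le> K"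
  shows "card {u \<in> PiE (insert v A) (\<lambda>_. S). P u}
       \<le> K * card {u \<in> PiE A (\<lambda>_. S). \<exists>s\<in>S. P (u(v := s))}"
proof -
  let ?U = "{u \<in> PiE A (\<lambda>_. S). \<exists>s\<in>S. P (u(v := s))}"
  let ?Z = "SIGMA u:?U. {s \<in> S. P (u(v := s))}"
  have finU: "finite ?U" using assms by (auto intro!: finite_PiE)
  have "{u \<in> PiE (insert v A) (\<lambda>_. S). P u} \<subseteq> (\<lambda>(u, s). u(v := s)) ` ?Z"
    unfolding PiE_insert_eq by force
  then have "card {u \<in> PiE (insert v A) (\<lambda>_. S). P u} \<le> card ?Z"
    using finU \<open>finite S\<close> by (intro surj_card_le) auto
  also have "\<dots> = (\<Sum>u\<in>?U. card {s \<in> S. P (u(v := s))})"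
    using finU \<open>finite S\<close> by (intro card_SigmaI) auto
  also have "\<dots> \<le> (\<Sum>u\<in>?U. K)" using K by (intro sum_mono) auto
  finally show ?thesis by (simp add: mult.commute)
qed

text \<open>A substitute for the Lovasz local lemma (Rosenfeld's counting argument): the number of
  assignments avoiding the bad events supported in \<open>A\<close> grows by a factor of at least
  \<open>card S / 2\<close> with each variable added to \<open>A\<close>. Instead of bounding the probability of an event,
  it suffices that one pivot variable has few bad values once the others are fixed.\<close>

lemma rosenfeld_avoid_events:
  fixes supp :: "'e \<Rightarrow> 'v set" and bad :: "'e \<Rightarrow> ('v \<Rightarrow> 's) \<Rightarrow> bool"
  assumes "finite V" "finite S" "S \<noteq> {}" "finite Ev"
    and supp: "\<And>e. e \<in> Ev \<Longrightarrow> supp e \<subseteq> V"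
    and local: "\<And>e u u'. e \<in> Ev \<Longrightarrow> (\<And>v. v \<in> supp e \<Longrightarrow> u v = u' v) \<Longrightarrow> bad e u \<Longrightarrow> bad e u'"
    and pivot: "\<And>e. e \<in> Ev \<Longrightarrow> piv e \<in> supp e"
    and K: "\<And>e u. e \<in> Ev \<Longrightarrow> card {s \<in> S. bad e (u(piv e := s))} \<le> K"
    and few: "\<And>v. v \<in> V \<Longrightarrow> 4 * K * card {e \<in> Ev. v \<in> supp e} \<le> card S"
  shows "\<exists>u \<in> PiE V (\<lambda>_. S). \<forall>e\<in>Ev. \<not> bad e u"
proof -
  \<comment> \<open>Only events supported in \<open>A\<close> are tested, so that goodness on
    \<open>A\<close> does not react to changes outside \<open>A\<close>.\<close>
  define good where "good A u \<longleftrightarrow> (\<forall>e\<in>Ev. supp e \<subseteq> A \<longrightarrow> \<not> bad e u)" for A u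
  define F where "F A = card {u \<in> PiE A (\<lambda>_. S). good A u}" for A
  have finC: "finite {u \<in> PiE A (\<lambda>_. S). P u}" if "finite A" for A :: "'v set" and P
    by (rule finite_subset[of _ "PiE A (\<lambda>_. S)"]) (use that \<open>finite S\<close> in \<open>auto intro!: finite_PiE\<close>)
  have good_upd: "good A (u(v := s)) \<longleftrightarrow> good A u" if "v \<notin> A" for A u v s
  proof -
    have "bad e (u(v := s)) \<longleftrightarrow> bad e u" if "e \<in> Ev" "supp e \<subseteq> A" for e
    proof -
      have eq: "(u(v := s)) x = u x" if "x \<in> supp e" for x
        using that \<open>supp e \<subseteq> A\<close> \<open>v \<notin> A\<close> by auto
      show ?thesis using local[OF that(1), of "u(v := s)" u] local[OF that(1), of u "u(v := s)"] eq by metis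
    qed
    then show ?thesis unfolding good_def by blast
  qed
  have good_mono: "good B u" if "good A u" "B \<subseteq> A" for A B u
    using that unfolding good_def by blast
  \<comment> \<open>Adding \<open>v\<close> multiplies the good assignments by
    \<open>card S\<close>; the claim is that the events completed by \<open>v\<close> spoil at most
    half of them. Each spoils at most \<open>2 * K * F A\<close>, and \<open>few\<close> bounds
    their number.\<close>
  have step: "card S * F A \<le> 2 * F (insert v A)" if "A \<subseteq> V" "v \<in> V - A" for A v
    using that
  proof (induction "card A" arbitrary: A v rule: less_induct)
    case less
    have finA: "finite A" using less.prems \<open>finite V\<close> finite_subset by blast
    let ?A' = "insert v A"
    let ?T = "{u \<in> PiE ?A' (\<lambda>_. S). good A u}"
    let ?G = "{u \<in> PiE ?A' (\<lambda>_. S). good ?A' u}"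
    let ?E = "{e \<in> Ev. v \<in> supp e \<and> supp e \<subseteq> ?A'}"
    let ?B = "\<lambda>e. {u \<in> PiE ?A' (\<lambda>_. S). good A u \<and> bad e u}"
    have finE: "finite ?E" using \<open>finite Ev\<close> by simp
    have cardT: "card ?T = card S * F A"
    proof -
      have inj: "inj_on (\<lambda>(y, g). g(v := y)) (S \<times> PiE A (\<lambda>_. S))"
        using less.prems by (intro inj_combinator) auto
      have "?T = (\<lambda>(y, g). g(v := y)) ` (S \<times> {u \<in> PiE A (\<lambda>_. S). good A u})"
        unfolding PiE_insert_eq using less.prems good_upd[of v A] by auto
      moreover have "inj_on (\<lambda>(y, g). g(v := y)) (S \<times> {u \<in> PiE A (\<lambda>_. S). good A u})"
        by (rule inj_on_subset[OF inj]) auto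
      ultimately show ?thesis by (simp add: card_image card_cartesian_product F_def)
    qed
    have cover: "?T \<subseteq> ?G \<union> (\<Union>e\<in>?E. ?B e)"
    proof
      fix u assume u: "u \<in> ?T"
      show "u \<in> ?G \<union> (\<Union>e\<in>?E. ?B e)"
      proof (cases "good ?A' u")
        case False
        then obtain e where e: "e \<in> Ev" "supp e \<subseteq> ?A'" "bad e u" unfolding good_def by auto
        have "v \<in> supp e" using u e unfolding good_def by blast
        then show ?thesis using u e by auto
      qed (use u in auto)
    qed
    have bound: "card (?B e) \<le> 2 * K * F A" if "e \<in> ?E" for e
    proof -
      let ?p = "piv e"
      have p: "?p \<in> ?A'" using that pivot by auto
      show ?thesis
      proof (cases "?p = v")
        \<comment> \<open>The pivot is the new variable: each good assignment on \<open>A\<close>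
          has at most \<open>K\<close> spoiled extensions.\<close>
        case True
        have "card (?B e) \<le> K * card {u \<in> PiE A (\<lambda>_. S). \<exists>s\<in>S. good A (u(v := s)) \<and> bad e (u(v := s))}"
          using that True
          by (intro card_PiE_insert_le finA \<open>finite S\<close>)
             (auto intro!: order.trans[OF card_mono K[of e]] simp: \<open>finite S\<close>)
        also have "\<dots> \<le> K * F A" unfolding F_def
          using less.prems good_upd[of v A] by (intro mult_le_mono2 card_mono finC finA) auto
        finally show ?thesis by simp
      next
        \<comment> \<open>The pivot is an old variable. It is revealed last, at cost
          \<open>K\<close>, with goodness retained only on \<open>A - {piv e}\<close>; the free
          value at \<open>v\<close> costs \<open>card S\<close>, and the induction hypothesis trades
          \<open>card S * F (A - {piv e})\<close> for \<open>2 * F A\<close>.\<close>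
        case False
        then have pA: "?p \<in> A" using p by auto
        let ?A0 = "A - {?p}"
        let ?A1 = "insert v ?A0"
        have A1: "insert ?p ?A1 = ?A'" using pA by auto
        have fin1: "finite ?A1" using finA by simp
        have "card (?B e) = card {u \<in> PiE (insert ?p ?A1) (\<lambda>_. S). good A u \<and> bad e u}"
          unfolding A1 ..
        also have "\<dots> \<le> K * card {u \<in> PiE ?A1 (\<lambda>_. S). \<exists>s\<in>S. good A (u(?p := s)) \<and> bad e (u(?p := s))}"
          using that
          by (intro card_PiE_insert_le fin1 \<open>finite S\<close>)
             (auto intro!: order.trans[OF card_mono K[of e]] simp: \<open>finite S\<close>)
        also have "\<dots> \<le> K * card {u \<in> PiE ?A1 (\<lambda>_. S). good ?A0 u}"
        proof (intro mult_le_mono2 card_mono)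
          show "finite {u \<in> PiE ?A1 (\<lambda>_. S). good ?A0 u}"
            using finC[OF fin1] .
          show "{u \<in> PiE ?A1 (\<lambda>_. S). \<exists>s\<in>S. good A (u(?p := s)) \<and> bad e (u(?p := s))}
             \<subseteq> {u \<in> PiE ?A1 (\<lambda>_. S). good ?A0 u}"
            using good_mono[of A _ ?A0] good_upd[of ?p ?A0] by auto
        qed
        also have "card {u \<in> PiE ?A1 (\<lambda>_. S). good ?A0 u}
            \<le> card S * card {u \<in> PiE ?A0 (\<lambda>_. S). \<exists>s\<in>S. good ?A0 (u(v := s))}"
        proof (rule card_PiE_insert_le)
          show "finite ?A0" using finA by simp
          show "card {s \<in> S. good ?A0 (u(v := s))} \<le> card S" for u
            by (rule card_mono[OF \<open>finite S\<close>]) blast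
        qed fact
        also have "card {u \<in> PiE ?A0 (\<lambda>_. S). \<exists>s\<in>S. good ?A0 (u(v := s))} \<le> F ?A0"
        proof -
          have "v \<notin> ?A0" using less.prems by auto
          then have "{u \<in> PiE ?A0 (\<lambda>_. S). \<exists>s\<in>S. good ?A0 (u(v := s))} \<subseteq> {u \<in> PiE ?A0 (\<lambda>_. S). good ?A0 u}"
            using good_upd[of v ?A0] by blast
          then show ?thesis unfolding F_def using finA by (intro card_mono finC) auto
        qed
        also have "card S * F ?A0 \<le> 2 * F A"
        proof -
          have "card ?A0 < card A" using pA finA by (metis card_Diff1_less)
          moreover have "insert ?p ?A0 = A" using pA by auto
          ultimately show ?thesis using less.hyps[of ?A0 ?p] less.prems pA by auto
        qed
        finally show ?thesis by (simp add: mult.assoc mult.left_commute)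
      qed
    qed
    have "card S * F A \<le> card (?G \<union> (\<Union>e\<in>?E. ?B e))"
      unfolding cardT[symmetric]
    proof (rule card_mono[OF _ cover])
      show "finite (?G \<union> (\<Union>e\<in>?E. ?B e))"
        by (rule finite_subset[of _ "PiE ?A' (\<lambda>_. S)"]) (use finA \<open>finite S\<close> in \<open>auto intro!: finite_PiE\<close>)
    qed
    also have "\<dots> \<le> card ?G + card (\<Union>e\<in>?E. ?B e)" by (rule card_Un_le)
    also have "card (\<Union>e\<in>?E. ?B e) \<le> (\<Sum>e\<in>?E. card (?B e))" by (rule card_UN_le[OF finE])
    also have "\<dots> \<le> (\<Sum>e\<in>?E. 2 * K * F A)" by (intro sum_mono bound)
    also have "\<dots> = 2 * K * card ?E * F A" by simp
    finally have 1: "card S * F A \<le> F ?A' + 2 * K * card ?E * F A" unfolding F_def by simp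
    have "card ?E \<le> card {e \<in> Ev. v \<in> supp e}" using \<open>finite Ev\<close> by (intro card_mono) auto
    then have "4 * K * card ?E \<le> 4 * K * card {e \<in> Ev. v \<in> supp e}" by (rule mult_le_mono2)
    also have "\<dots> \<le> card S" using few[of v] less.prems by auto
    finally have "4 * K * card ?E \<le> card S" .
    then have "4 * K * card ?E * F A \<le> card S * F A" by (rule mult_le_mono1)
    then show ?case using 1 by linarith
  qed
  have "0 < F A" if "A \<subseteq> V" for A
    using finite_subset[OF that \<open>finite V\<close>] that
  proof (induction A rule: finite_induct)
    case empty
    \<comment> \<open>Every support contains a pivot, so no event lives on the empty set and the
      count starts at 1.\<close>
    have "\<not> supp e \<subseteq> {}" if "e \<in> Ev" for e using pivot[OF that] by auto
    then have "{u \<in> PiE {} (\<lambda>_. S). good {} u} = {\<lambda>_. undefined}"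
      unfolding good_def by auto
    then show ?case unfolding F_def by simp
  next
    case (insert v A)
    then have "card S * F A \<le> 2 * F (insert v A)" by (intro step) auto
    moreover have "card S > 0" using \<open>finite S\<close> \<open>S \<noteq> {}\<close> by (simp add: card_gt_0_iff)
    ultimately show ?case using insert by (metis insert_subset less_le_trans mult_pos_pos nat_0_less_mult_iff)
  qed
  then have "F V > 0" by simp
  then have "{u \<in> PiE V (\<lambda>_. S). good V u} \<noteq> {}" unfolding F_def using card_gt_0_iff by blast
  then show ?thesis unfolding good_def using supp by auto
qed

section \<open>Lattice points of a simplex and points in general position\<close>

definition net :: "nat set \<Rightarrow> nat \<Rightarrow> (nat \<Rightarrow> real) set" where
  "net \<sigma> D = {a \<in> closed_simplex \<sigma>. \<forall>v. \<exists>j::nat. a v = real j / real D}"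

lemma net_subset: "net \<sigma> D \<subseteq> closed_simplex \<sigma>"
  by (auto simp: net_def)

text \<open>Round all coordinates except the one at \<open>u\<close> down to multiples of
  \<open>1 / D\<close> and let \<open>u\<close> absorb the difference: at most \<open>k\<close>
  coordinates lose less than \<open>1 / D\<close> each.\<close>

lemma net_near:
  assumes fin: "finite \<sigma>" and ne: "\<sigma> \<noteq> {}" and card: "card \<sigma> \<le> k + 1" and D: "D \<ge> 1"
    and x: "x \<in> closed_simplex \<sigma>"
  obtains a where "a \<in> net \<sigma> D" "\<And>v. \<bar>x v - a v\<bar> \<le> real k / real D"
proof -
  obtain u where u: "u \<in> \<sigma>" using ne by auto
  define b where "b v = nat \<lfloor>real D * x v\<rfloor>" for v
  have x0: "0 \<le> x v" for v using x by (auto simp: closed_simplex_def)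
  have b: "real (b v) \<le> real D * x v" "real D * x v < real (b v) + 1" for v
  proof -
    have "real (b v) = of_int \<lfloor>real D * x v\<rfloor>" using x0[of v] by (simp add: b_def)
    then show "real (b v) \<le> real D * x v" "real D * x v < real (b v) + 1" by linarith+
  qed
  have sumx: "(\<Sum>v\<in>\<sigma>. x v) = 1" using x by (auto simp: closed_simplex_def)
  have split: "(\<Sum>v\<in>\<sigma>. f v) = f u + (\<Sum>v\<in>\<sigma>-{u}. f v)" for f :: "nat \<Rightarrow> real"
    using fin u by (rule sum.remove)
  define s where "s = (\<Sum>v\<in>\<sigma>-{u}. b v)"
  have le: "real s \<le> real D * (\<Sum>v\<in>\<sigma>-{u}. x v)"
    unfolding s_def of_nat_sum sum_distrib_left by (intro sum_mono b)
  have ge: "real D * (\<Sum>v\<in>\<sigma>-{u}. x v) \<le> real s + real k"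
  proof -
    have "real D * (\<Sum>v\<in>\<sigma>-{u}. x v) \<le> (\<Sum>v\<in>\<sigma>-{u}. real (b v) + 1)"
      unfolding sum_distrib_left using b(2) by (intro sum_mono) (simp add: less_imp_le)
    also have "\<dots> = real s + real (card (\<sigma>-{u}))" by (simp add: s_def sum.distrib)
    also have "card (\<sigma>-{u}) \<le> k" using card fin u by simp
    finally show ?thesis by simp
  qed
  have xu: "real D * x u = real D - real D * (\<Sum>v\<in>\<sigma>-{u}. x v)"
    using split[of x] sumx by (simp add: algebra_simps flip: distrib_left)
  have "0 \<le> real D * x u" using x0[of u] by simp
  then have sD: "s \<le> D" using le xu by linarith
  define j where "j v = (if v \<in> \<sigma> - {u} then b v else if v = u then D - s else 0)" for v
  define a where "a v = real (j v) / real D" for v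
  have "(\<Sum>v\<in>\<sigma>. a v) = 1"
  proof -
    have "(\<Sum>v\<in>\<sigma>. real (j v)) = real D"
    proof -
      have "(\<Sum>v\<in>\<sigma>-{u}. real (j v)) = real s" unfolding s_def of_nat_sum by (intro sum.cong) (auto simp: j_def)
      moreover have "real (j u) = real D - real s" using sD by (simp add: j_def)
      ultimately show ?thesis using split[of "\<lambda>v. real (j v)"] by simp
    qed
    then show ?thesis using D by (simp add: a_def flip: sum_divide_distrib)
  qed
  then have "a \<in> net \<sigma> D"
    using u by (auto simp: net_def closed_simplex_def a_def j_def)
  moreover have "\<bar>x v - a v\<bar> \<le> real k / real D" for v
  proof -
    have "\<bar>real D * x v - real (j v)\<bar> \<le> real k"
    proof (cases "v \<in> \<sigma> - {u}")
      case True
      \<comment> \<open>There is a vertex besides \<open>u\<close>; hence a rounding error below 1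
        is within the bound \<open>k\<close>.\<close>
      have "1 \<le> k" using card True fin u card_Diff_singleton[of u \<sigma>]
        by (metis Suc_eq_plus1 Suc_le_eq card_gt_0_iff diff_Suc_1 diff_le_mono empty_iff finite_Diff less_le_trans One_nat_def)
      then show ?thesis using True b[of v] by (simp add: j_def abs_le_iff)
    next
      case False
      show ?thesis
      proof (cases "v = u")
        case True
        then show ?thesis using le ge xu sD by (simp add: j_def abs_le_iff)
      next
        case F: False
        then have "x v = 0" using False x by (auto simp: closed_simplex_def)
        then show ?thesis using False F by (simp add: j_def)
      qed
    qed
    moreover have "real D * (x v - a v) = real D * x v - real (j v)" using D by (simp add: a_def right_diff_distrib)
    ultimately have "real D * \<bar>x v - a v\<bar> \<le> real k"
      by (metis abs_mult abs_of_nat)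
    then show ?thesis using D by (simp add: pos_le_divide_eq mult.commute)
  qed
  ultimately show thesis by (rule that)
qed

text \<open>The coordinates sum to 1, so one of them is determined by the others and the exponent is
  the dimension \<open>k\<close> instead of the number of vertices. The later comparison of J^(2k)
  with J^n rests on this exponent.\<close>

lemma card_net_ball:
  assumes fin: "finite \<sigma>" and ne: "\<sigma> \<noteq> {}" and card: "card \<sigma> \<le> k + 1" and D: "D \<ge> 1" and \<delta>: "\<delta> \<ge> 0"
  shows "finite {a \<in> net \<sigma> D. \<forall>v. \<bar>a v - y v\<bar> \<le> \<delta>}" (is "finite ?A")
    and "real (card {a \<in> net \<sigma> D. \<forall>v. \<bar>a v - y v\<bar> \<le> \<delta>}) \<le> (2 * (real D * \<delta>) + 1) ^ k"
proof -
  obtain u where u: "u \<in> \<sigma>" using ne by auto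
  let ?F = "\<lambda>v. {j::nat. \<bar>real j - real D * y v\<bar> \<le> real D * \<delta>}"
  let ?P = "PiE (\<sigma>-{u}) ?F"
  have D\<delta>: "0 \<le> real D * \<delta>" using \<delta> by simp
  have finP: "finite ?P" using card_nat_interval_le(1)[OF D\<delta>] fin by (intro finite_PiE) auto
  define g where "g f v = (if v \<in> \<sigma> - {u} then real (f v) / real D
      else if v = u then 1 - (\<Sum>w\<in>\<sigma>-{u}. real (f w) / real D) else 0)" for f :: "nat \<Rightarrow> nat" and v
  have sub: "?A \<subseteq> g ` ?P"
  proof
    fix a assume a: "a \<in> ?A"
    then have "\<forall>v. \<exists>j::nat. a v = real j / real D" by (auto simp: net_def)
    then obtain j where j: "\<And>v. a v = real (j v) / real D" by metis
    have "\<bar>real (j v) - real D * y v\<bar> \<le> real D * \<delta>" for v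
    proof -
      have "\<bar>a v - y v\<bar> \<le> \<delta>" using a by auto
      then have "real D * \<bar>a v - y v\<bar> \<le> real D * \<delta>" by (intro mult_left_mono) auto
      moreover have "real D * (a v - y v) = real (j v) - real D * y v" using D j[of v] by (simp add: right_diff_distrib)
      ultimately show ?thesis by (metis abs_mult abs_of_nat)
    qed
    then have "restrict j (\<sigma>-{u}) \<in> ?P" by auto
    moreover have "a = g (restrict j (\<sigma>-{u}))"
    proof
      fix v
      have "(\<Sum>v\<in>\<sigma>. a v) = 1" "\<And>v. v \<notin> \<sigma> \<Longrightarrow> a v = 0" using a by (auto simp: net_def closed_simplex_def)
      moreover have "(\<Sum>v\<in>\<sigma>. a v) = a u + (\<Sum>v\<in>\<sigma>-{u}. a v)" using fin u by (rule sum.remove)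
      moreover have "(\<Sum>w\<in>\<sigma>-{u}. real (restrict j (\<sigma>-{u}) w) / real D) = (\<Sum>v\<in>\<sigma>-{u}. a v)"
        by (intro sum.cong) (auto simp: j)
      ultimately show "a v = g (restrict j (\<sigma>-{u})) v"
        by (auto simp: g_def j)
    qed
    ultimately show "a \<in> g ` ?P" by blast
  qed
  show "finite ?A" using finite_subset[OF sub] finP by blast
  have "card ?A \<le> card ?P" using surj_card_le[OF finP sub] .
  moreover have "real (card ?P) \<le> (\<Prod>v\<in>\<sigma>-{u}. (2 * (real D * \<delta>) + 1))"
    unfolding card_PiE[OF finite_Diff[OF fin]] of_nat_prod
    using card_nat_interval_le(2)[OF D\<delta>] by (intro prod_mono) auto
  moreover have "(\<Prod>v\<in>\<sigma>-{u}. (2 * (real D * \<delta>) + 1)) \<le> (2 * (real D * \<delta>) + 1) ^ k"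
  proof -
    have "card (\<sigma>-{u}) \<le> k" using card fin u by simp
    then show ?thesis using D\<delta> by (simp del: card_Diff_insert card_Diff_singleton) (rule power_increasing, auto)
  qed
  ultimately show "real (card ?A) \<le> (2 * (real D * \<delta>) + 1) ^ k" by linarith
qed

lemma closed_simplex_le_1:
  assumes "x \<in> closed_simplex \<sigma>" "finite \<sigma>"
  shows "0 \<le> x v" "x v \<le> 1"
proof -
  show x0: "0 \<le> x v" for v using assms by (auto simp: closed_simplex_def)
  show "x v \<le> 1"
  proof (cases "v \<in> \<sigma>")
    case True
    then have "x v \<le> (\<Sum>v\<in>\<sigma>. x v)" using assms(2) x0 by (intro member_le_sum) auto
    then show ?thesis using assms by (auto simp: closed_simplex_def)
  qed (use assms in \<open>auto simp: closed_simplex_def\<close>)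
qed

lemma finite_net:
  assumes "finite \<sigma>" "\<sigma> \<noteq> {}" "card \<sigma> \<le> k + 1" "D \<ge> 1"
  shows "finite (net \<sigma> D)" "real (card (net \<sigma> D)) \<le> (2 * real D + 1) ^ k"
proof -
  have eq: "{a \<in> net \<sigma> D. \<forall>v. \<bar>a v - 0\<bar> \<le> 1} = net \<sigma> D"
    using closed_simplex_le_1[OF _ assms(1)] net_subset by fastforce
  show "finite (net \<sigma> D)" "real (card (net \<sigma> D)) \<le> (2 * real D + 1) ^ k"
    using card_net_ball[OF assms, of 1 "\<lambda>_. 0"] unfolding eq by simp_all
qed

text \<open>At most \<open>k + 1\<close> numbers sum to 1. The vertex found here serves as a pivot:
  changing its random vector moves the point by a definite fraction of the change.\<close>

lemma large_barycentric_coordinate: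
  assumes "x \<in> closed_simplex \<sigma>" "finite \<sigma>" "card \<sigma> \<le> k + 1"
  obtains v where "v \<in> \<sigma>" "1 / (real k + 1) \<le> x v"
proof -
  have "\<exists>v\<in>\<sigma>. 1 / (real k + 1) \<le> x v"
  proof (rule ccontr)
    assume "\<not> ?thesis"
    then have lt: "\<And>v. v \<in> \<sigma> \<Longrightarrow> x v < 1 / (real k + 1)" by force
    have sum1: "(\<Sum>v\<in>\<sigma>. x v) = 1" using assms by (auto simp: closed_simplex_def)
    then have "\<sigma> \<noteq> {}" by auto
    then have "(\<Sum>v\<in>\<sigma>. x v) < (\<Sum>v\<in>\<sigma>. 1 / (real k + 1))" using lt assms(2) by (intro sum_strict_mono) auto
    also have "\<dots> = real (card \<sigma>) / (real k + 1)" by simp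
    also have "\<dots> \<le> 1" using assms(3) by (simp add: divide_le_eq)
    finally show False using sum1 by simp
  qed
  then show thesis using that by blast
qed

section \<open>Greedy colouring, the moment curve and disjoint subfamilies\<close>

lemma greedy_coloring:
  fixes E :: "'a \<Rightarrow> 'a \<Rightarrow> bool"
  assumes "finite V" and deg: "\<And>v. v \<in> V \<Longrightarrow> card {u \<in> V. u \<noteq> v \<and> E u v} < L"
    and sym: "\<And>u v. E u v \<Longrightarrow> E v u"
  shows "\<exists>c. (\<forall>v\<in>V. c v < (L::nat)) \<and> (\<forall>u\<in>V. \<forall>v\<in>V. u \<noteq> v \<longrightarrow> E u v \<longrightarrow> c u \<noteq> c v)"
  using assms(1) deg
proof (induction V rule: finite_induct)
  case empty
  then show ?case by simp
next
  case (insert w V)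
  have "card {u \<in> V. u \<noteq> v \<and> E u v} < L" if "v \<in> V" for v
  proof -
    have "card {u \<in> V. u \<noteq> v \<and> E u v} \<le> card {u \<in> insert w V. u \<noteq> v \<and> E u v}"
      using insert by (intro card_mono) auto
    then show ?thesis using insert.prems[of v] that by simp
  qed
  then have "\<exists>c. (\<forall>v\<in>V. c v < L) \<and> (\<forall>u\<in>V. \<forall>v\<in>V. u \<noteq> v \<longrightarrow> E u v \<longrightarrow> c u \<noteq> c v)"
    by (rule insert.IH)
  then obtain c
    where c: "\<forall>v\<in>V. c v < L" "\<forall>u\<in>V. \<forall>v\<in>V. u \<noteq> v \<longrightarrow> E u v \<longrightarrow> c u \<noteq> c v"
    by (elim exE conjE)
  let ?N = "{u \<in> insert w V. u \<noteq> w \<and> E u w}"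
  have "card (c ` ?N) \<le> card ?N" using insert by (intro card_image_le) auto
  then have "card (c ` ?N) < card {..<L}" using insert.prems[of w] by simp
  then have "\<not> {..<L} \<subseteq> c ` ?N" using card_mono[of "c ` ?N" "{..<L}"] insert.hyps by auto
  then obtain j where j: "j < L" "j \<notin> c ` ?N" by auto
  have "\<forall>u\<in>insert w V. \<forall>v\<in>insert w V. u \<noteq> v \<longrightarrow> E u v \<longrightarrow> (c(w := j)) u \<noteq> (c(w := j)) v"
  proof (intro ballI impI)
    fix u v assume uv: "u \<in> insert w V" "v \<in> insert w V" "u \<noteq> v" "E u v"
    show "(c(w := j)) u \<noteq> (c(w := j)) v"
    proof (cases "u = w \<or> v = w")
      case True
      have *: "c x \<noteq> j" if "x \<in> V" "E x w" for x
      proof -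
        have "x \<in> ?N" using that insert.hyps(2) by blast
        then show ?thesis using j(2) by blast
      qed
      show ?thesis
      proof (cases "u = w")
        case True
        then show ?thesis using uv *[of v] sym by auto
      next
        case False
        then show ?thesis using uv *[of u] \<open>u = w \<or> v = w\<close> by auto
      qed
    next
      case False
      then show ?thesis using uv c(2) by auto
    qed
  qed
  moreover have "\<forall>v\<in>insert w V. (c(w := j)) v < L" using c j by auto
  ultimately show ?case by blast
qed

text \<open>Points on a scaled moment curve; the affine coordinates are recovered by Lagrange
  interpolation.\<close>

lemma general_position_points:
  fixes K :: real and L :: nat
  shows "\<exists>e :: nat \<Rightarrow> real^'n. (\<forall>j i. 0 \<le> e j $ i) \<and>
    (\<forall>J (y :: nat \<Rightarrow> real). J \<subseteq> {..<L} \<longrightarrow> card J \<le> CARD('n) + 1 \<longrightarrow> (\<Sum>j\<in>J. y j) = 0 \<longrightarrow>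
       (\<forall>j\<in>J. K * \<bar>y j\<bar> \<le> norm (\<Sum>j\<in>J. y j *\<^sub>R e j)))"
proof -
  obtain \<pi> :: "'n \<Rightarrow> nat" where \<pi>: "bij_betw \<pi> UNIV {1..CARD('n)}"
    using finite_same_card_bij[of "UNIV :: 'n set" "{1..CARD('n)}"] by auto
  \<comment> \<open>The exponents run from 1 to n; the moment of order 0 is supplied by the
    condition that the weights sum to 0.\<close>
  define m :: "nat \<Rightarrow> real^'n" where "m j = (\<chi> i. real j ^ \<pi> i)" for j
  \<comment> \<open>Lagrange basis polynomial: 1 at the node \<open>j\<close>, 0 at the other nodes
    of \<open>J\<close>. With at most n + 1 nodes its degree is at most n, so its coefficients
    recover \<open>y j\<close> from the moments of order 0 to n.\<close>
  define lag :: "nat set \<Rightarrow> nat \<Rightarrow> real poly" where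
    "lag J j = (\<Prod>i\<in>J-{j}. smult (1 / (real j - real i)) [:- real i, 1:])" for J j
  define c where "c J j = (\<Sum>l\<le>CARD('n). \<bar>coeff (lag J j) l\<bar>)" for J j
  have lag: "\<bar>y j\<bar> \<le> c J j * norm (\<Sum>i\<in>J. y i *\<^sub>R m i)"
    if J: "J \<subseteq> {..<L}" "card J \<le> CARD('n) + 1" "(\<Sum>i\<in>J. y i) = 0" "j \<in> J" for J j and y :: "nat \<Rightarrow> real"
  proof -
    have fin: "finite J" using J(1) finite_subset by blast
    have deg: "degree (lag J j) \<le> CARD('n)"
    proof -
      have "degree (lag J j) \<le> (\<Sum>i\<in>J-{j}. degree (smult (1 / (real j - real i)) [:- real i, 1:]))"
        using degree_prod_sum_le[OF finite_Diff[OF fin], of "\<lambda>i. smult (1 / (real j - real i)) [:- real i, 1:]" "{j}"]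
        by (simp only: comp_def lag_def)
      also have "\<dots> \<le> (\<Sum>i\<in>J-{j}. 1)" by (intro sum_mono) (auto simp: degree_smult_eq)
      also have "\<dots> \<le> CARD('n)" using J fin by simp
      finally show ?thesis .
    qed
    have val: "poly (lag J j) (real i) = (if i = j then 1 else 0)" if "i \<in> J" for i
    proof (cases "i = j")
      case True
      then show ?thesis by (auto simp: lag_def poly_prod intro!: prod.neutral simp flip: diff_divide_distrib)
    next
      case False
      then show ?thesis using that fin by (auto simp: lag_def poly_prod intro!: bexI[of _ i])
    qed
    have "y j = (\<Sum>i\<in>J. if i = j then y j else 0)"
      using J(4) fin by simp
    also have "\<dots> = (\<Sum>i\<in>J. y i * poly (lag J j) (real i))"
      by (intro sum.cong) (auto simp: val)
    also have "\<dots> = (\<Sum>i\<in>J. \<Sum>l\<le>CARD('n). y i * (coeff (lag J j) l * real i ^ l))"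
    proof -
      have "poly (lag J j) x = (\<Sum>l\<le>CARD('n). coeff (lag J j) l * x ^ l)" for x
        by (rule poly_altdef[THEN trans])
           (use deg in \<open>auto intro!: sum.mono_neutral_left intro: le_degree\<close>)
      then show ?thesis by (simp add: sum_distrib_left)
    qed
    also have "\<dots> = (\<Sum>l\<le>CARD('n). coeff (lag J j) l * (\<Sum>i\<in>J. y i * real i ^ l))"
      by (subst sum.swap) (simp add: sum_distrib_left mult_ac)
    finally have "\<bar>y j\<bar> \<le> (\<Sum>l\<le>CARD('n). \<bar>coeff (lag J j) l * (\<Sum>i\<in>J. y i * real i ^ l)\<bar>)"
      by (metis sum_abs)
    also have "\<dots> \<le> (\<Sum>l\<le>CARD('n). \<bar>coeff (lag J j) l\<bar> * norm (\<Sum>i\<in>J. y i *\<^sub>R m i))"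
    proof (intro sum_mono)
      fix l assume l: "l \<in> {..CARD('n)}"
      have "\<bar>\<Sum>i\<in>J. y i * real i ^ l\<bar> \<le> norm (\<Sum>i\<in>J. y i *\<^sub>R m i)"
      proof (cases "l = 0")
        case True
        then show ?thesis using J by simp
      next
        case False
        then have "l \<in> \<pi> ` UNIV" using \<pi> l by (auto simp: bij_betw_def)
        then obtain t where "l = \<pi> t" by auto
        then have "(\<Sum>i\<in>J. y i * real i ^ l) = (\<Sum>i\<in>J. y i *\<^sub>R m i) $ t"
          by (simp add: m_def)
        then show ?thesis using component_le_norm_cart by metis
      qed
      then show "\<bar>coeff (lag J j) l * (\<Sum>i\<in>J. y i * real i ^ l)\<bar> \<le> \<bar>coeff (lag J j) l\<bar> * norm (\<Sum>i\<in>J. y i *\<^sub>R m i)"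
        unfolding abs_mult by (intro mult_left_mono) auto
    qed
    also have "\<dots> = c J j * norm (\<Sum>i\<in>J. y i *\<^sub>R m i)" by (simp add: c_def sum_distrib_right)
    finally show ?thesis .
  qed
  \<comment> \<open>One constant for the finitely many node sets \<open>J\<close>; scaling the curve
    by \<open>\<bar>K\<bar> * \<Lambda>\<close> then yields the factor \<open>K\<close>.\<close>
  define \<Lambda> where "\<Lambda> = (\<Sum>J\<in>Pow {..<L}. \<Sum>j\<in>{..<L}. c J j)"
  have c0: "0 \<le> c J j" for J j by (auto simp: c_def intro!: sum_nonneg)
  have c\<Lambda>: "c J j \<le> \<Lambda>" if "J \<subseteq> {..<L}" "j \<in> J" for J j
  proof -
    have "c J j \<le> (\<Sum>j\<in>{..<L}. c J j)" using that c0 by (intro member_le_sum) auto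
    also have "\<dots> \<le> \<Lambda>" unfolding \<Lambda>_def using that c0
      by (intro member_le_sum[where f = "\<lambda>J. \<Sum>j\<in>{..<L}. c J j"]) (auto intro!: sum_nonneg)
    finally show ?thesis .
  qed
  have \<Lambda>0: "0 \<le> \<Lambda>" unfolding \<Lambda>_def using c0 by (auto intro!: sum_nonneg)
  let ?s = "\<bar>K\<bar> * \<Lambda>"
  show ?thesis
  proof (intro exI[of _ "\<lambda>j. ?s *\<^sub>R m j"] conjI allI impI ballI)
    fix j i show "0 \<le> (?s *\<^sub>R m j) $ i" using \<Lambda>0 by (simp add: m_def)
  next
    fix J j and y :: "nat \<Rightarrow> real"
    assume J: "J \<subseteq> {..<L}" "card J \<le> CARD('n) + 1" "(\<Sum>j\<in>J. y j) = 0" "j \<in> J"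
    have "K * \<bar>y j\<bar> \<le> \<bar>K\<bar> * \<bar>y j\<bar>" by (intro mult_right_mono) auto
    also have "\<dots> \<le> \<bar>K\<bar> * (c J j * norm (\<Sum>i\<in>J. y i *\<^sub>R m i))" by (intro mult_left_mono lag J) auto
    also have "\<dots> \<le> \<bar>K\<bar> * (\<Lambda> * norm (\<Sum>i\<in>J. y i *\<^sub>R m i))"
      using c\<Lambda>[OF J(1,4)] by (intro mult_left_mono mult_right_mono) auto
    also have "\<dots> = norm (?s *\<^sub>R (\<Sum>i\<in>J. y i *\<^sub>R m i))" using \<Lambda>0 by (simp add: abs_mult mult.assoc)
    also have "?s *\<^sub>R (\<Sum>i\<in>J. y i *\<^sub>R m i) = (\<Sum>i\<in>J. y i *\<^sub>R (?s *\<^sub>R m i))"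
      by (simp add: scaleR_right.sum mult_ac)
    finally show "K * \<bar>y j\<bar> \<le> norm (\<Sum>j\<in>J. y j *\<^sub>R (?s *\<^sub>R m j))" .
  qed
qed

text \<open>Greedy choice: a member has at most \<open>d\<close> vertices, each in at most
  \<open>L\<close> members, so it meets at most \<open>d * L\<close> members including itself.
  Discard these and repeat.\<close>

lemma pairwise_disjoint_subfamily:
  assumes "finite T" "\<And>\<sigma>. \<sigma> \<in> T \<Longrightarrow> finite \<sigma> \<and> \<sigma> \<noteq> {} \<and> card \<sigma> \<le> d"
    and deg: "\<And>v. card {\<sigma> \<in> T. v \<in> \<sigma>} \<le> L"
    and "m * (d * L) < card T"
  shows "\<exists>D \<subseteq> T. card D = m + 1 \<and> pairwise disjnt D"
  using assms
proof (induction m arbitrary: T)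
  case 0
  then obtain \<sigma> where "\<sigma> \<in> T" by fastforce
  then show ?case by (intro exI[of _ "{\<sigma>}"]) auto
next
  case (Suc m)
  then obtain \<sigma> where \<sigma>: "\<sigma> \<in> T" by fastforce
  let ?B = "{\<tau> \<in> T. \<tau> \<inter> \<sigma> \<noteq> {}}"
  have "card ?B \<le> card (\<Union>v\<in>\<sigma>. {\<tau> \<in> T. v \<in> \<tau>})"
    using Suc.prems \<sigma> by (intro card_mono) auto
  also have "\<dots> \<le> (\<Sum>v\<in>\<sigma>. card {\<tau> \<in> T. v \<in> \<tau>})"
    using Suc.prems(2)[OF \<sigma>] by (intro card_UN_le) auto
  also have "\<dots> \<le> (\<Sum>v\<in>\<sigma>. L)" using Suc.prems(3) by (intro sum_mono) auto
  also have "\<dots> \<le> d * L" using Suc.prems(2)[OF \<sigma>] by simp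
  finally have B: "card ?B \<le> d * L" .
  let ?T = "T - ?B"
  have cT: "card ?T = card T - card ?B" using Suc.prems(1) by (intro card_Diff_subset) auto
  have "\<exists>D \<subseteq> ?T. card D = m + 1 \<and> pairwise disjnt D"
  proof (rule Suc.IH)
    show "finite ?T" using Suc.prems by auto
    show "\<And>\<sigma>. \<sigma> \<in> ?T \<Longrightarrow> finite \<sigma> \<and> \<sigma> \<noteq> {} \<and> card \<sigma> \<le> d" using Suc.prems(2) by blast
    show "card {\<sigma> \<in> ?T. v \<in> \<sigma>} \<le> L" for v
      using Suc.prems(1) by (intro order.trans[OF card_mono Suc.prems(3)[of v]]) auto
    show "m * (d * L) < card ?T" using B Suc.prems(4) cT by simp
  qed
  then obtain D where D: "D \<subseteq> ?T" "card D = m + 1" "pairwise disjnt D" by blast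
  have "\<sigma> \<notin> D" using D(1) \<sigma> Suc.prems(2)[OF \<sigma>] by blast
  moreover have "finite D" using D(2) by (metis Suc_eq_plus1 card.infinite nat.distinct(1))
  ultimately have "card (insert \<sigma> D) = Suc m + 1" using D(2) by simp
  moreover have "pairwise disjnt (insert \<sigma> D)"
    using D(1,3) \<sigma> by (auto simp: pairwise_insert disjnt_def)
  moreover have "insert \<sigma> D \<subseteq> T" using D(1) \<sigma> by auto
  ultimately show ?case by blast
qed

section \<open>Straight simplices in spread-out position\<close>

text \<open>The sum runs over all vertices, so one formula is valid on every simplex. It is linear
  in \<open>p\<close> as well as in \<open>x\<close>; later \<open>p\<close> is a family of vectors
  that itself varies with the point.\<close>

definition lin :: "nat set \<Rightarrow> (nat \<Rightarrow> real^'n) \<Rightarrow> (nat \<Rightarrow> real) \<Rightarrow> real^'n" where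
  "lin V p x = (\<Sum>v\<in>V. x v *\<^sub>R p v)"

lemma complexD:
  assumes "is_complex X" "\<sigma> \<in> X"
  shows "finite \<sigma>" "\<sigma> \<noteq> {}" "\<sigma> \<subseteq> vertices X"
  using assms by (auto simp: is_complex_def vertices_def)

lemma finite_vertices: "is_complex X \<Longrightarrow> finite (vertices X)"
  by (auto simp: is_complex_def vertices_def)

lemma lin_restrict:
  assumes "finite V" "\<sigma> \<subseteq> V" "\<And>v. v \<notin> \<sigma> \<Longrightarrow> x v = 0"
  shows "lin V p x = (\<Sum>v\<in>\<sigma>. x v *\<^sub>R p v)"
  unfolding lin_def using assms by (intro sum.mono_neutral_right) auto

lemma lin_diff: "lin V p x - lin V p y = lin V p (\<lambda>v. x v - y v)"
  by (simp add: lin_def scaleR_diff_left sum_subtractf)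

lemma norm_lin_le:
  assumes "finite V" "\<sigma> \<subseteq> V" "\<And>v. v \<notin> \<sigma> \<Longrightarrow> x v = 0" "card \<sigma> \<le> d"
    and "\<And>v. v \<in> \<sigma> \<Longrightarrow> \<bar>x v\<bar> \<le> \<delta>" "\<And>v. v \<in> \<sigma> \<Longrightarrow> norm (p v) \<le> B" "0 \<le> \<delta>" "0 \<le> B"
  shows "norm (lin V p x) \<le> real d * (\<delta> * B)"
proof -
  have "lin V p x = (\<Sum>v\<in>\<sigma>. x v *\<^sub>R p v)" by (rule lin_restrict) fact+
  then have "norm (lin V p x) \<le> (\<Sum>v\<in>\<sigma>. norm (x v *\<^sub>R p v))"
    by (simp only: norm_sum)
  also have "\<dots> \<le> (\<Sum>v\<in>\<sigma>. \<delta> * B)"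
    using assms by (intro sum_mono) (auto intro!: mult_mono)
  also have "\<dots> \<le> real d * (\<delta> * B)" using assms(4,7,8) by (simp add: mult_right_mono)
  finally show ?thesis .
qed

section \<open>Incidence counts, colourings and joint events\<close>

lemma card_complex_le:
  assumes X: "is_complex X" and deg: "\<forall>v\<in>vertices X. card {\<sigma>\<in>X. v \<in> \<sigma>} \<le> L"
  shows "card X \<le> card (vertices X) * L"
proof -
  have "card X \<le> card (\<Union>v\<in>vertices X. {\<sigma>\<in>X. v \<in> \<sigma>})"
  proof (rule card_mono)
    show "finite (\<Union>v\<in>vertices X. {\<sigma>\<in>X. v \<in> \<sigma>})"
      by (rule finite_subset[of _ X]) (use X in \<open>auto simp: is_complex_def\<close>)
    show "X \<subseteq> (\<Union>v\<in>vertices X. {\<sigma>\<in>X. v \<in> \<sigma>})"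
    proof
      fix \<sigma> assume "\<sigma> \<in> X"
      moreover then obtain v where "v \<in> \<sigma>" using complexD(2)[OF X] by blast
      ultimately show "\<sigma> \<in> (\<Union>v\<in>vertices X. {\<sigma>\<in>X. v \<in> \<sigma>})" by (auto simp: vertices_def)
    qed
  qed
  also have "\<dots> \<le> (\<Sum>v\<in>vertices X. card {\<sigma>\<in>X. v \<in> \<sigma>})"
    using finite_vertices[OF X] by (rule card_UN_le)
  also have "\<dots> \<le> (\<Sum>v\<in>vertices X. L)" using deg by (intro sum_mono) auto
  finally show ?thesis by simp
qed

text \<open>The edges at \<open>v\<close> together with \<open>{v}\<close> are distinct simplices
  containing \<open>v\<close>, so \<open>v\<close> has fewer than \<open>L\<close> neighbours and
  greedy colouring succeeds with \<open>L\<close> colours. Any two vertices of a simplex are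
  neighbours.\<close>

lemma complex_coloring:
  assumes X: "is_complex X" and deg: "\<forall>v\<in>vertices X. card {\<sigma>\<in>X. v \<in> \<sigma>} \<le> L"
  obtains c where "\<And>v. v \<in> vertices X \<Longrightarrow> c v < L" "\<And>\<sigma>. \<sigma> \<in> X \<Longrightarrow> inj_on c \<sigma>"
proof -
  define E where "E u v \<longleftrightarrow> (\<exists>\<sigma>\<in>X. u \<in> \<sigma> \<and> v \<in> \<sigma>)" for u v
  have finX: "finite X" using X by (simp add: is_complex_def)
  have face: "\<tau> \<in> X" if "\<sigma> \<in> X" "\<tau> \<subseteq> \<sigma>" "\<tau> \<noteq> {}" for \<sigma> \<tau> using X that unfolding is_complex_def by blast
  have "card {u \<in> vertices X. u \<noteq> v \<and> E u v} < L" if v: "v \<in> vertices X" for v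
  proof -
    let ?U = "{u \<in> vertices X. u \<noteq> v \<and> E u v}"
    have sub: "(\<lambda>u. {u, v}) ` insert v ?U \<subseteq> {\<sigma>\<in>X. v \<in> \<sigma>}"
      using v face by (auto simp: E_def vertices_def)
    have fin: "finite ?U" using finite_vertices[OF X] by simp
    have "inj_on (\<lambda>u. {u, v}) (insert v ?U)" by (auto simp: inj_on_def doubleton_eq_iff)
    then have "card (insert v ?U) = card ((\<lambda>u. {u, v}) ` insert v ?U)" by (rule card_image[symmetric])
    also have "\<dots> \<le> card {\<sigma>\<in>X. v \<in> \<sigma>}" using finX by (intro card_mono sub) simp
    also have "\<dots> \<le> L" using deg v by blast
    finally show ?thesis using fin by simp
  qed
  moreover have "E v u" if "E u v" for u v using that by (auto simp: E_def)
  ultimately have "\<exists>c. (\<forall>v\<in>vertices X. c v < L) \<and>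
      (\<forall>u\<in>vertices X. \<forall>v\<in>vertices X. u \<noteq> v \<longrightarrow> E u v \<longrightarrow> c u \<noteq> c v)"
    by (intro greedy_coloring finite_vertices X)
  then obtain c where c: "\<forall>v\<in>vertices X. c v < L"
      "\<forall>u\<in>vertices X. \<forall>v\<in>vertices X. u \<noteq> v \<longrightarrow> E u v \<longrightarrow> c u \<noteq> c v" by (elim exE conjE)
  show thesis
  proof
    show "c v < L" if "v \<in> vertices X" for v using c(1) that by blast
    show "inj_on c \<sigma>" if "\<sigma> \<in> X" for \<sigma>
    proof (rule inj_onI, rule ccontr)
      fix u v assume uv: "u \<in> \<sigma>" "v \<in> \<sigma>" "c u = c v" "u \<noteq> v"
      then have "u \<in> vertices X" "v \<in> vertices X" "E u v" using that by (auto simp: E_def vertices_def)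
      then show False using c(2) uv by blast
    qed
  qed
qed

text \<open>In terms of probability: all events of \<open>D\<close> occur with probability at most
  (K / card S)^(card D). Independence appears as the condition that resampling the pivot of one
  event leaves the others unchanged, so events can be removed one by one together with their pivot
  variables.\<close>

lemma card_PiE_indep_events:
  fixes cond :: "'e \<Rightarrow> ('v \<Rightarrow> 's) \<Rightarrow> bool"
  assumes "finite D" "finite V" "finite S"
    and "\<And>e. e \<in> D \<Longrightarrow> piv e \<in> V" "inj_on piv D"
    and "\<And>e e' u s. e \<in> D \<Longrightarrow> e' \<in> D \<Longrightarrow> e \<noteq> e' \<Longrightarrow> cond e' (u(piv e := s)) = cond e' u"
    and "\<And>e u. e \<in> D \<Longrightarrow> card {s \<in> S. cond e (u(piv e := s))} \<le> K"
  shows "card {u \<in> PiE V (\<lambda>_. S). \<forall>e\<in>D. cond e u} * card S ^ card D \<le> K ^ card D * card S ^ card V"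
  using assms(1,2,4-)
proof (induction D arbitrary: V rule: finite_induct)
  case empty
  then show ?case by (simp add: card_PiE)
next
  case (insert e D)
  let ?V = "V - {piv e}"
  have V: "insert (piv e) ?V = V" using insert.prems(2)[of e] by auto
  have finV: "finite ?V" using insert.prems(1) by simp
  let ?A = "{u \<in> PiE ?V (\<lambda>_. S). \<forall>e\<in>D. cond e u}"
  have finA: "finite ?A"
    by (rule finite_subset[of _ "PiE ?V (\<lambda>_. S)"]) (use finV \<open>finite S\<close> in \<open>auto intro!: finite_PiE\<close>)
  have IH: "card ?A * card S ^ card D \<le> K ^ card D * card S ^ card ?V"
  proof (rule insert.IH)
    show "finite ?V" by fact
    show "piv e' \<in> ?V" if "e' \<in> D" for e'
      using insert.prems(2)[of e'] insert.prems(3) insert.hyps that by (auto simp: inj_on_def)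
    show "inj_on piv D" using insert.prems(3) by simp
    show "cond e'' (u(piv e' := s)) = cond e'' u" if "e' \<in> D" "e'' \<in> D" "e' \<noteq> e''" for e' e'' u s
      by (rule insert.prems(4)) (use that in simp_all)
    show "card {s \<in> S. cond e' (u(piv e' := s))} \<le> K" if "e' \<in> D" for e' u
      by (rule insert.prems(5)) (use that in simp)
  qed
  have "card {u \<in> PiE V (\<lambda>_. S). \<forall>e\<in>insert e D. cond e u}
      = card {u \<in> PiE (insert (piv e) ?V) (\<lambda>_. S). \<forall>e\<in>insert e D. cond e u}" unfolding V ..
  also have "\<dots> \<le> K * card {u \<in> PiE ?V (\<lambda>_. S). \<exists>s\<in>S. \<forall>e'\<in>insert e D. cond e' (u(piv e := s))}"
  proof (rule card_PiE_insert_le[OF finV \<open>finite S\<close>])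
    fix u
    have "card {s \<in> S. \<forall>e'\<in>insert e D. cond e' (u(piv e := s))} \<le> card {s \<in> S. cond e (u(piv e := s))}"
      using \<open>finite S\<close> by (intro card_mono) auto
    also have "\<dots> \<le> K" by (rule insert.prems(5)) simp
    finally show "card {s \<in> S. \<forall>e'\<in>insert e D. cond e' (u(piv e := s))} \<le> K" .
  qed
  also have "\<dots> \<le> K * card ?A"
  proof (intro mult_le_mono2 card_mono finA subsetI CollectI conjI ballI)
    fix u e'
    assume "u \<in> {u \<in> PiE ?V (\<lambda>_. S). \<exists>s\<in>S. \<forall>e'\<in>insert e D. cond e' (u(piv e := s))}" and e': "e' \<in> D"
    then obtain s where "cond e' (u(piv e := s))" by blast
    moreover have "cond e' (u(piv e := s)) = cond e' u"
      by (rule insert.prems(4)) (use e' insert.hyps in auto)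
    ultimately show "cond e' u" by simp
  qed auto
  finally have "card {u \<in> PiE V (\<lambda>_. S). \<forall>e\<in>insert e D. cond e u} * card S ^ card (insert e D)
      \<le> K * card ?A * card S ^ card (insert e D)" by (rule mult_le_mono1)
  also have "\<dots> = K * card S * (card ?A * card S ^ card D)" using insert.hyps by simp
  also have "\<dots> \<le> K * card S * (K ^ card D * card S ^ card ?V)" by (intro mult_le_mono2 IH)
  also have "\<dots> = K ^ card (insert e D) * (card S * card S ^ card ?V)"
    using insert.hyps by simp
  also have "card S * card S ^ card ?V = card S ^ card V"
  proof -
    have "card V = Suc (card ?V)" using card_Suc_Diff1[OF insert.prems(1) insert.prems(2)[of e]] by simp
    then show ?thesis by simp
  qed
  finally show ?case .
qed

definition bounded_complex :: "nat \<Rightarrow> nat \<Rightarrow> nat set set \<Rightarrow> bool" where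
  "bounded_complex k L X \<longleftrightarrow> is_complex X \<and> (\<forall>\<sigma>\<in>X. card \<sigma> \<le> k + 1) \<and>
     (\<forall>v\<in>vertices X. card {\<sigma>\<in>X. v \<in> \<sigma>} \<le> L)"

text \<open>The strict upper bound makes integer parts of points of the box lie in
  \<open>grid (R * B)\<close>. The second condition excludes degenerate simplices: a ball of radius
  \<open>r\<close> meets a simplex in a set of barycentric diameter at most
  \<open>2 * r / R\<close>. In the third, \<open>M\<close> is the multiplicity at radius
  \<open>r\<close>.\<close>

definition well_spread ::
    "nat set set \<Rightarrow> nat \<Rightarrow> nat \<Rightarrow> real \<Rightarrow> nat \<Rightarrow> (nat \<Rightarrow> real^'n) \<Rightarrow> bool" where
  "well_spread X R B r M p \<longleftrightarrow>
     (\<forall>v\<in>vertices X. \<forall>i. 0 \<le> p v $ i \<and> p v $ i < real (R * B)) \<and>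
     (\<forall>\<tau>\<in>X. \<forall>x\<in>closed_simplex \<tau>. \<forall>x'\<in>closed_simplex \<tau>. \<forall>v.
        real R * \<bar>x v - x' v\<bar> \<le> norm (lin (vertices X) p x - lin (vertices X) p x')) \<and>
     (\<forall>y. (\<forall>i. 0 \<le> y $ i \<and> y $ i < real (R * B)) \<longrightarrow>
        card {\<tau>\<in>X. \<exists>x\<in>closed_simplex \<tau>. norm (lin (vertices X) p x - y) \<le> r} \<le> M)"

text \<open>The vertices of colour \<open>j\<close> are placed at random near the \<open>j\<close>-th point of a fixed
  configuration in general position, so that no simplex degenerates; the density bound is a union
  bound over the centre and over families of \<open>m\<close> disjoint simplices, whose positions are
  independent.\<close>

lemma spread_positions:
  fixes k L :: nat
  assumes kn: "k < CARD('n)"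
  shows "\<exists>B\<ge>1. \<forall>r\<ge>0. \<exists>C>0. \<forall>X R m. bounded_complex k L X \<longrightarrow> 1 \<le> R \<longrightarrow>
    C * real (card (vertices X)) \<le> real R ^ (CARD('n) - k) \<longrightarrow> (R * B) ^ CARD('n) < 2 ^ m \<longrightarrow>
    (\<exists>p :: nat \<Rightarrow> real^'n. well_spread X R B r (m * ((k + 1) * L)) p)"
proof -
  define n where "n = CARD('n)"
  \<comment> \<open>The grid vectors change an image difference by at most
    \<open>(k + 1) * n * R\<close> times the largest coordinate difference; the additional 1 is what
    remains as the factor \<open>R\<close> in \<open>sep\<close>.\<close>
  define K where "K = (real k + 1) * real n + 1"
  obtain e :: "nat \<Rightarrow> real^'n" where e0: "\<forall>j i. 0 \<le> e j $ i" and
    e: "\<forall>J (y :: nat \<Rightarrow> real). J \<subseteq> {..<L} \<longrightarrow> card J \<le> CARD('n) + 1 \<longrightarrow> (\<Sum>j\<in>J. y j) = 0 \<longrightarrow>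
       (\<forall>j\<in>J. K * \<bar>y j\<bar> \<le> norm (\<Sum>j\<in>J. y j *\<^sub>R e j))"
    using general_position_points[of L K] by (elim exE conjE)
  \<comment> \<open>Large enough that \<open>R *\<^sub>R e j\<close> plus a vector of
    \<open>grid R\<close> stays in the box of side \<open>R * B\<close>.\<close>
  define B where "B = nat \<lceil>\<Sum>j<L. \<Sum>i\<in>UNIV. e j $ i\<rceil> + 1"
  have B: "e j $ i + 1 \<le> real B" if "j < L" for j i
  proof -
    have "e j $ i \<le> (\<Sum>i\<in>UNIV. e j $ i)" using e0 by (intro member_le_sum) auto
    also have "\<dots> \<le> (\<Sum>j<L. \<Sum>i\<in>UNIV. e j $ i)" using that e0
      by (intro member_le_sum[where f = "\<lambda>j. \<Sum>i\<in>UNIV. e j $ i"]) (auto intro!: sum_nonneg)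
    finally show ?thesis unfolding B_def by linarith
  qed
  have B1: "1 \<le> B" by (simp add: B_def)
  have "\<exists>C>0. \<forall>X R m. bounded_complex k L X \<longrightarrow> 1 \<le> R \<longrightarrow>
    C * real (card (vertices X)) \<le> real R ^ (CARD('n) - k) \<longrightarrow> (R * B) ^ CARD('n) < 2 ^ m \<longrightarrow>
    (\<exists>p :: nat \<Rightarrow> real^'n. well_spread X R B r (m * ((k + 1) * L)) p)"
    if r: "0 \<le> r" for r
  proof -
    \<comment> \<open>If a simplex comes within \<open>r\<close> of \<open>y\<close>, one of its
      lattice points is within \<open>r1\<close> of a grid centre: \<open>n\<close> pays for
      rounding \<open>y\<close>, the last term for changing at most \<open>k + 1\<close> coordinates
      by \<open>k / R\<close> against vertices of norm at most \<open>n * R * B\<close>.\<close>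
    define r1 where "r1 = r + real n + real (k + 1) * (real k * (real n * real B))"
    have r1: "0 \<le> r1" using r by (simp add: r1_def)
    define K1 where "K1 = nat \<lceil>(2 * (r1 * (real k + 1)) + 1) ^ n\<rceil>"
    \<comment> \<open>Makes the expected number of lattice points near a given centre at most 1/2,
      see \<open>YK\<close>.\<close>
    define C where "C = 2 * real L * 3 ^ k * real K1 + 1"
    show ?thesis
    proof (intro exI[of _ C] conjI allI impI)
      show "0 < C" by (simp add: C_def add_nonneg_pos)
    next
      fix X R m
      assume bX: "bounded_complex k L X" and R: "1 \<le> R"
        and CR: "C * real (card (vertices X)) \<le> real R ^ (CARD('n) - k)"
        and m: "(R * B) ^ CARD('n) < 2 ^ m"
      have X: "is_complex X" and dim: "\<forall>\<sigma>\<in>X. card \<sigma> \<le> k + 1"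
        and deg: "\<forall>v\<in>vertices X. card {\<sigma>\<in>X. v \<in> \<sigma>} \<le> L"
        using bX by (simp_all add: bounded_complex_def)
      define V where "V = vertices X"
      have finV: "finite V" and finX: "finite X"
        using finite_vertices[OF X] X by (auto simp: V_def is_complex_def)
      have simplexD: "finite \<sigma>" "\<sigma> \<noteq> {}" "\<sigma> \<subseteq> V" "card \<sigma> \<le> k + 1" if "\<sigma> \<in> X" for \<sigma>
        using complexD[OF X that] dim that by (auto simp: V_def)
      obtain c where c: "\<And>v. v \<in> V \<Longrightarrow> c v < L" "\<And>\<sigma>. \<sigma> \<in> X \<Longrightarrow> inj_on c \<sigma>"
        using complex_coloring[OF X deg] unfolding V_def by blast
      define p where "p u v = real R *\<^sub>R e (c v) + u v" for u :: "nat \<Rightarrow> real^'n" and v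
      let ?G = "grid R :: (real^'n) set"
      have range: "0 \<le> p u v $ i \<and> p u v $ i < real (R * B)" if "u \<in> PiE V (\<lambda>_. ?G)" "v \<in> V" for u v i
      proof -
        have "u v \<in> ?G" using that by auto
        then have "u v $ i \<in> real ` {..<R}" by (auto simp: grid_def)
        then have u: "0 \<le> u v $ i" "u v $ i < real R" by auto
        have "real R * (e (c v) $ i + 1) \<le> real R * real B" using B[OF c(1)[OF that(2)]] by (intro mult_left_mono) auto
        then have "real R * e (c v) $ i + real R \<le> real R * real B" by (simp add: distrib_left)
        moreover have "0 \<le> real R * e (c v) $ i" using e0 by simp
        ultimately show ?thesis using u by (simp add: p_def)
      qed
      have pnorm: "norm (p u v) \<le> real n * (real R * real B)" if "u \<in> PiE V (\<lambda>_. ?G)" "v \<in> V" for u v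
        unfolding n_def
      proof (rule norm_le_of_components)
        fix i show "\<bar>p u v $ i\<bar> \<le> real R * real B" using range[OF that, of i] by (simp add: abs_le_iff)
      qed
      have sep: "real R * \<bar>x v - x' v\<bar> \<le> norm (lin V (p u) x - lin V (p u) x')"
        if u: "u \<in> PiE V (\<lambda>_. ?G)" and \<tau>: "\<tau> \<in> X" and x: "x \<in> closed_simplex \<tau>" "x' \<in> closed_simplex \<tau>"
        for u \<tau> x x' v
      proof -
        define y where "y v = x v - x' v" for v
        have y0: "y v = 0" if "v \<notin> \<tau>" for v using x that by (auto simp: y_def closed_simplex_def)
        have sumy: "(\<Sum>v\<in>\<tau>. y v) = 0" using x by (auto simp: y_def closed_simplex_def sum_subtractf)
        \<comment> \<open>The largest coordinate difference bounds both the noise of the grid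
          vectors and all other coordinates.\<close>
        obtain w where w: "w \<in> \<tau>" "\<And>v. v \<in> \<tau> \<Longrightarrow> \<bar>y v\<bar> \<le> \<bar>y w\<bar>"
          using obtains_MAX[OF simplexD(1,2)[OF \<tau>], of "\<lambda>v. \<bar>y v\<bar>"] simplexD(1)[OF \<tau>] by (metis Max_ge finite_imageI imageI)
        have inj: "inj_on c \<tau>" by (rule c(2)[OF \<tau>])
        define y' where "y' j = y (inv_into \<tau> c j)" for j
        have y': "y' (c v) = y v" if "v \<in> \<tau>" for v using that inj by (simp add: y'_def)
        have "K * \<bar>y' (c w)\<bar> \<le> norm (\<Sum>j\<in>c ` \<tau>. y' j *\<^sub>R e j)"
        proof (rule e[rule_format])
          show "c ` \<tau> \<subseteq> {..<L}" using c(1) simplexD(3)[OF \<tau>] by auto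
          show "card (c ` \<tau>) \<le> CARD('n) + 1" using card_image_le[OF simplexD(1)[OF \<tau>], of c] simplexD(4)[OF \<tau>] kn by simp
          show "(\<Sum>j\<in>c ` \<tau>. y' j) = 0" using sumy by (simp add: sum.reindex[OF inj] y')
          show "c w \<in> c ` \<tau>" using w by blast
        qed
        also have "(\<Sum>j\<in>c ` \<tau>. y' j *\<^sub>R e j) = (\<Sum>v\<in>\<tau>. y v *\<^sub>R e (c v))"
          by (simp add: sum.reindex[OF inj] y')
        finally have 1: "K * \<bar>y w\<bar> \<le> norm (\<Sum>v\<in>\<tau>. y v *\<^sub>R e (c v))" using y' w by simp
        have "norm (\<Sum>v\<in>\<tau>. y v *\<^sub>R u v) \<le> (\<Sum>v\<in>\<tau>. \<bar>y w\<bar> * (real n * real R))"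
        proof (rule sum_norm_le)
          fix v assume v: "v \<in> \<tau>"
          then have "u v \<in> ?G" using u simplexD(3)[OF \<tau>] by auto
          then have "norm (u v) \<le> real n * real R" unfolding n_def by (rule norm_grid_le)
          then show "norm (y v *\<^sub>R u v) \<le> \<bar>y w\<bar> * (real n * real R)"
            using w(2)[OF v] by (auto intro!: mult_mono)
        qed
        also have "\<dots> = real (card \<tau>) * (\<bar>y w\<bar> * (real n * real R))" by simp
        also have "\<dots> \<le> (real k + 1) * (\<bar>y w\<bar> * (real n * real R))"
          using simplexD(4)[OF \<tau>] by (intro mult_right_mono) auto
        finally have 2: "norm (\<Sum>v\<in>\<tau>. y v *\<^sub>R u v) \<le> (real k + 1) * (\<bar>y w\<bar> * (real n * real R))" .
        have "lin V (p u) x - lin V (p u) x' = (\<Sum>v\<in>\<tau>. y v *\<^sub>R p u v)"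
          unfolding lin_diff using lin_restrict[OF finV simplexD(3)[OF \<tau>], of y "p u"] y0 by (simp add: y_def[abs_def])
        also have "\<dots> = real R *\<^sub>R (\<Sum>v\<in>\<tau>. y v *\<^sub>R e (c v)) + (\<Sum>v\<in>\<tau>. y v *\<^sub>R u v)"
          by (simp add: p_def scaleR_right_distrib sum.distrib scaleR_right.sum mult.commute)
        finally have "norm (lin V (p u) x - lin V (p u) x')
            \<ge> norm (real R *\<^sub>R (\<Sum>v\<in>\<tau>. y v *\<^sub>R e (c v))) - norm (\<Sum>v\<in>\<tau>. y v *\<^sub>R u v)"
          by (metis norm_diff_ineq)
        moreover have "norm (real R *\<^sub>R (\<Sum>v\<in>\<tau>. y v *\<^sub>R e (c v))) \<ge> real R * (K * \<bar>y w\<bar>)"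
          using 1 by (simp add: mult_left_mono)
        ultimately have "real R * (K * \<bar>y w\<bar>) - (real k + 1) * (\<bar>y w\<bar> * (real n * real R))
            \<le> norm (lin V (p u) x - lin V (p u) x')" using 2 by linarith
        moreover have "real R * (K * \<bar>y w\<bar>) - (real k + 1) * (\<bar>y w\<bar> * (real n * real R)) = real R * \<bar>y w\<bar>"
          by (simp add: K_def algebra_simps)
        moreover have "\<bar>y v\<bar> \<le> \<bar>y w\<bar>" using w(2)[of v] y0[of v] by (cases "v \<in> \<tau>") auto
        then have "real R * \<bar>y v\<bar> \<le> real R * \<bar>y w\<bar>" by (intro mult_left_mono) auto
        ultimately show ?thesis by (simp add: y_def)
      qed
      have netR: "finite (net \<sigma> R)" "real (card (net \<sigma> R)) \<le> (2 * real R + 1) ^ k" if "\<sigma> \<in> X" for \<sigma>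
        using finite_net[OF simplexD(1,2,4)[OF that] R] by auto
      \<comment> \<open>Mesh \<open>1 / R\<close> in barycentric coordinates means bounded distances
        in space, the vertices having norm of order \<open>R\<close>. Each simplex thus contributes
        only about R^k points.\<close>
      define Y where "Y = (SIGMA \<sigma>:X. net \<sigma> R)"
      have finY: "finite Y" unfolding Y_def using finX netR(1) by auto
      have cardY: "real (card Y) \<le> real (card V) * real L * 3 ^ k * real R ^ k"
      proof -
        have "real (card Y) = (\<Sum>\<sigma>\<in>X. real (card (net \<sigma> R)))"
          unfolding Y_def using finX netR(1) by (subst card_SigmaI) auto
        also have "\<dots> \<le> (\<Sum>\<sigma>\<in>X. (3 * real R) ^ k)"
        proof (rule sum_mono)
          fix \<sigma> assume "\<sigma> \<in> X"
          then have "real (card (net \<sigma> R)) \<le> (2 * real R + 1) ^ k" by (rule netR(2))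
          also have "\<dots> \<le> (3 * real R) ^ k" using R by (intro power_mono) auto
          finally show "real (card (net \<sigma> R)) \<le> (3 * real R) ^ k" .
        qed
        also have "\<dots> = real (card X) * (3 ^ k * real R ^ k)" by (simp add: power_mult_distrib)
        also have "\<dots> \<le> real (card V * L) * (3 ^ k * real R ^ k)"
          using card_complex_le[OF X deg] unfolding V_def of_nat_le_iff by (intro mult_right_mono) (auto simp flip: of_nat_mult)
        finally show ?thesis by (simp add: mult.assoc)
      qed
      have YK: "2 * (card Y * K1) \<le> R ^ n"
      proof -
        have "real (2 * (card Y * K1)) \<le> 2 * (real (card V) * real L * 3 ^ k * real R ^ k) * real K1"
          using mult_right_mono[OF cardY, of "real K1"] by (simp add: mult_ac)
        also have "\<dots> = (2 * real L * 3 ^ k * real K1) * real (card V) * real R ^ k" by (simp add: mult_ac)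
        also have "\<dots> \<le> C * real (card V) * real R ^ k" by (intro mult_right_mono) (auto simp: C_def)
        also have "\<dots> \<le> real R ^ (n - k) * real R ^ k" using CR unfolding V_def n_def by (intro mult_right_mono) auto
        also have "\<dots> = real (R ^ n)" using kn by (simp add: n_def flip: power_add)
        finally show ?thesis unfolding of_nat_le_iff .
      qed
      define cond where "cond q s u \<longleftrightarrow> norm (lin V (p u) (snd s) - q) \<le> r1" for q and s :: "nat set \<times> (nat \<Rightarrow> real)" and u
      \<comment> \<open>Disjoint simplices have distinct pivots, and the pivot of one has weight 0
        in the points of the others; this gives the product bound for a whole family.\<close>
      define \<D> where "\<D> = {D. D \<subseteq> Y \<and> card D = m \<and> (\<forall>s\<in>D. \<forall>t\<in>D. s \<noteq> t \<longrightarrow> fst s \<inter> fst t = {})}"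
      define bad where "bad q D = {u \<in> PiE V (\<lambda>_. ?G). \<forall>s\<in>D. cond q s u}" for q D
      have fin\<D>: "finite \<D>" unfolding \<D>_def using finY by auto
      have cardG: "card ?G = R ^ n" by (simp add: card_grid n_def)
      have bad: "card (bad q D) * (R ^ n) ^ m \<le> K1 ^ m * (R ^ n) ^ card V" if D: "D \<in> \<D>" for q D
      proof -
        have DY: "D \<subseteq> Y" and Dm: "card D = m" and disj: "\<And>s t. s \<in> D \<Longrightarrow> t \<in> D \<Longrightarrow> s \<noteq> t \<Longrightarrow> fst s \<inter> fst t = {}"
          using D by (auto simp: \<D>_def)
        have sD: "fst s \<in> X" "snd s \<in> closed_simplex (fst s)" if "s \<in> D" for s
          using that DY by (auto simp: Y_def net_def)
        have "\<exists>v. v \<in> fst s \<and> 1 / (real k + 1) \<le> snd s v" if "s \<in> D" for s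
          using large_barycentric_coordinate[OF sD(2)[OF that] simplexD(1,4)[OF sD(1)[OF that]]] by blast
        then obtain piv where piv: "\<And>s. s \<in> D \<Longrightarrow> piv s \<in> fst s" "\<And>s. s \<in> D \<Longrightarrow> 1 / (real k + 1) \<le> snd s (piv s)"
          by metis
        have "card (bad q D) * card ?G ^ card D \<le> K1 ^ card D * card ?G ^ card V"
          unfolding bad_def
        proof (rule card_PiE_indep_events)
          show "finite D" using DY finY finite_subset by blast
          show "finite V" "finite ?G" using finV by auto
          show "piv s \<in> V" if "s \<in> D" for s using piv(1)[OF that] simplexD(3)[OF sD(1)[OF that]] by blast
          show "inj_on piv D" using piv(1) disj by (intro inj_onI) (metis disjoint_iff)
        next
          fix s t u z assume st: "s \<in> D" "t \<in> D" "s \<noteq> t"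
          have "snd t (piv s) = 0" using sD(2)[OF st(2)] piv(1)[OF st(1)] disj[OF st] by (auto simp: closed_simplex_def)
          then have "lin V (p (u(piv s := z))) (snd t) = lin V (p u) (snd t)"
            unfolding lin_def by (intro sum.cong) (auto simp: p_def)
          then show "cond q t (u(piv s := z)) = cond q t u" by (simp add: cond_def)
        next
          fix s u assume s: "s \<in> D"
          let ?w = "piv s" and ?a = "snd s"
          have wV: "?w \<in> V" using piv(1)[OF s] simplexD(3)[OF sD(1)[OF s]] by blast
          define t where "t = (\<Sum>v\<in>V-{?w}. ?a v *\<^sub>R p u v) + ?a ?w *\<^sub>R (real R *\<^sub>R e (c ?w)) - q"
          have "lin V (p (u(?w := z))) ?a - q = ?a ?w *\<^sub>R z + t" for z
          proof -
            have "lin V (p (u(?w := z))) ?a = ?a ?w *\<^sub>R p (u(?w := z)) ?w + (\<Sum>v\<in>V-{?w}. ?a v *\<^sub>R p (u(?w := z)) v)"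
              unfolding lin_def by (rule sum.remove[OF finV wV])
            also have "(\<Sum>v\<in>V-{?w}. ?a v *\<^sub>R p (u(?w := z)) v) = (\<Sum>v\<in>V-{?w}. ?a v *\<^sub>R p u v)"
              by (intro sum.cong) (auto simp: p_def)
            finally have "lin V (p (u(?w := z))) ?a = ?a ?w *\<^sub>R p (u(?w := z)) ?w + (\<Sum>v\<in>V-{?w}. ?a v *\<^sub>R p u v)" .
            moreover have "p (u(?w := z)) ?w = real R *\<^sub>R e (c ?w) + z" by (simp add: p_def)
            ultimately show ?thesis unfolding t_def by (simp add: scaleR_right_distrib del: scaleR_scaleR)
          qed
          then have "{z \<in> ?G. cond q s (u(?w := z))} = {z \<in> ?G. norm (?a ?w *\<^sub>R z + t) \<le> r1}"
            by (simp add: cond_def)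
          moreover have aw: "0 < ?a ?w" using piv(2)[OF s] by (rule less_le_trans[rotated]) simp
          ultimately have "real (card {z \<in> ?G. cond q s (u(?w := z))}) \<le> (2 * (r1 / ?a ?w) + 1) ^ CARD('n)"
            using card_grid_affine[OF r1 aw, of R t] by (simp only:)
          also have "\<dots> \<le> (2 * (r1 * (real k + 1)) + 1) ^ CARD('n)"
          proof -
            have "r1 / ?a ?w \<le> r1 / (1 / (real k + 1))" using piv(2)[OF s] r1 by (intro divide_left_mono) (auto simp: aw)
            then show ?thesis using r1 aw by (intro power_mono) auto
          qed
          also have "\<dots> \<le> real K1" unfolding K1_def n_def by linarith
          finally show "card {z \<in> ?G. cond q s (u(?w := z))} \<le> K1" by simp
        qed
        then show ?thesis by (simp add: Dm cardG)
      qed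
      define Q where "Q = (grid (R * B) :: (real^'n) set)"
      have cardQ: "card Q < 2 ^ m" using m by (simp add: Q_def card_grid)
      have m1: "1 \<le> m"
      proof (rule ccontr)
        assume "\<not> 1 \<le> m"
        then have "m = 0" by simp
        then have "card Q = 0" using cardQ by simp
        moreover have "0 < card Q" using R B1 by (simp add: Q_def card_grid)
        ultimately show False by simp
      qed
      have card\<D>: "card \<D> \<le> card Y ^ m"
      proof (cases "m \<le> card Y")
        case True
        have "card \<D> \<le> card {D. D \<subseteq> Y \<and> card D = m}" unfolding \<D>_def using finY by (intro card_mono) auto
        also have "\<dots> = card Y choose m" by (rule n_subsets[OF finY])
        also have "\<dots> \<le> card Y ^ m" by (rule binomial_le_pow[OF True])
        finally show ?thesis .
      next
        case False
        have "D \<notin> \<D>" for D using False card_mono[OF finY, of D] by (auto simp: \<D>_def)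
        then have "\<D> = {}" by blast
        then show ?thesis by simp
      qed
      define Z where "Z = (\<Union>q\<in>Q. \<Union>D\<in>\<D>. bad q D)"
      have "card Z \<le> (\<Sum>q\<in>Q. card (\<Union>D\<in>\<D>. bad q D))" unfolding Z_def by (rule card_UN_le) (simp add: Q_def)
      also have "\<dots> \<le> (\<Sum>q\<in>Q. \<Sum>D\<in>\<D>. card (bad q D))" by (intro sum_mono card_UN_le fin\<D>)
      finally have "card Z * (R ^ n) ^ m \<le> (\<Sum>q\<in>Q. \<Sum>D\<in>\<D>. card (bad q D)) * (R ^ n) ^ m" by (rule mult_le_mono1)
      also have "\<dots> = (\<Sum>q\<in>Q. \<Sum>D\<in>\<D>. card (bad q D) * (R ^ n) ^ m)" by (simp add: sum_distrib_right)
      also have "\<dots> \<le> (\<Sum>q\<in>Q. \<Sum>D\<in>\<D>. K1 ^ m * (R ^ n) ^ card V)" by (intro sum_mono bad)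
      also have "\<dots> = card Q * (card \<D> * (K1 ^ m * (R ^ n) ^ card V))" by simp
      also have "\<dots> \<le> card Q * (card Y ^ m * (K1 ^ m * (R ^ n) ^ card V))"
        using card\<D> by (intro mult_le_mono2 mult_le_mono1)
      also have "\<dots> = card Q * (card Y * K1) ^ m * (R ^ n) ^ card V" by (simp add: power_mult_distrib)
      finally have Z1: "card Z * (R ^ n) ^ m \<le> card Q * (card Y * K1) ^ m * (R ^ n) ^ card V" .
      \<comment> \<open>The union bound: fewer than 2^m centres, at most (card Y)^m families, each
        bad with probability at most (K1 / R^n)^m, and
        \<open>2 * (card Y * K1) \<le> R ^ n\<close>.\<close>
      have "card Q * (card Y * K1) ^ m < (R ^ n) ^ m"
      proof (cases "card Y * K1 = 0")
        case True
        then have "card Q * (card Y * K1) ^ m = 0" using m1 by simp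
        moreover have "0 < (R ^ n) ^ m" using R by simp
        ultimately show ?thesis by (simp only:)
      next
        case False
        then have "card Q * (card Y * K1) ^ m < 2 ^ m * (card Y * K1) ^ m" using cardQ by simp
        also have "\<dots> = (2 * (card Y * K1)) ^ m" by (simp add: power_mult_distrib)
        also have "\<dots> \<le> (R ^ n) ^ m" by (rule power_mono[OF YK]) simp
        finally show ?thesis .
      qed
      then have "card Q * (card Y * K1) ^ m * (R ^ n) ^ card V < (R ^ n) ^ m * (R ^ n) ^ card V"
        by (rule mult_strict_right_mono) (use R in simp)
      with Z1 have "card Z * (R ^ n) ^ m < (R ^ n) ^ m * (R ^ n) ^ card V" by (rule le_less_trans)
      then have "card Z * (R ^ n) ^ m < (R ^ n) ^ card V * (R ^ n) ^ m" by (simp only: mult.commute[of "(R ^ n) ^ m"])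
      then have "card Z < (R ^ n) ^ card V" using mult_less_cancel2 by blast
      also have "\<dots> = card (PiE V (\<lambda>_. ?G))" using finV by (simp add: card_PiE cardG)
      finally have "card Z < card (PiE V (\<lambda>_. ?G))" .
      moreover have "finite Z" unfolding Z_def bad_def using finV fin\<D>
        by (auto intro!: finite_UN_I finite_subset[OF _ finite_PiE[of V "\<lambda>_. ?G"]] simp: Q_def)
      ultimately have "\<not> PiE V (\<lambda>_. ?G) \<subseteq> Z" using card_mono by (metis not_le)
      then obtain u where u: "u \<in> PiE V (\<lambda>_. ?G)" "u \<notin> Z" by blast
      have few: "card {\<tau>\<in>X. \<exists>x\<in>closed_simplex \<tau>. norm (lin V (p u) x - y) \<le> r} \<le> m * ((k + 1) * L)"
        if y: "\<forall>i. 0 \<le> y $ i \<and> y $ i < real (R * B)" for y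
      proof (rule ccontr)
        let ?T = "{\<tau>\<in>X. \<exists>x\<in>closed_simplex \<tau>. norm (lin V (p u) x - y) \<le> r}"
        assume "\<not> card ?T \<le> m * ((k + 1) * L)"
        \<comment> \<open>The argument is \<open>m - 1\<close> because the subfamily obtained has
          one member more.\<close>
        moreover have "(m - 1) * ((k + 1) * L) \<le> m * ((k + 1) * L)" by (intro mult_le_mono1) simp
        ultimately have big: "(m - 1) * ((k + 1) * L) < card ?T" by linarith
        have "\<exists>D \<subseteq> ?T. card D = (m - 1) + 1 \<and> pairwise disjnt D"
        proof (rule pairwise_disjoint_subfamily[OF _ _ _ big])
          show "finite ?T" using finX by simp
          show "finite \<sigma> \<and> \<sigma> \<noteq> {} \<and> card \<sigma> \<le> k + 1" if "\<sigma> \<in> ?T" for \<sigma> using that simplexD[of \<sigma>] by blast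
          show "card {\<sigma> \<in> ?T. v \<in> \<sigma>} \<le> L" for v
          proof (cases "v \<in> V")
            case True
            have "card {\<sigma> \<in> ?T. v \<in> \<sigma>} \<le> card {\<sigma> \<in> X. v \<in> \<sigma>}" using finX by (intro card_mono) auto
            then show ?thesis using deg True unfolding V_def by fastforce
          next
            case False
            then have "{\<sigma> \<in> ?T. v \<in> \<sigma>} = {}" using simplexD(3) by blast
            then show ?thesis by (metis card.empty le0)
          qed
        qed
        then obtain D0 where D0: "D0 \<subseteq> ?T" "card D0 = m" "pairwise disjnt D0" using m1 by auto
        obtain q where q: "q \<in> Q" "norm (y - q) \<le> real n"
          using grid_near[of y "R * B"] y unfolding Q_def n_def by blast
        have "\<exists>a. a \<in> net \<tau> R \<and> norm (lin V (p u) a - q) \<le> r1" if \<tau>D: "\<tau> \<in> D0" for \<tau>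
        proof -
          obtain x where \<tau>: "\<tau> \<in> X" and x: "x \<in> closed_simplex \<tau>" "norm (lin V (p u) x - y) \<le> r" using D0(1) \<tau>D by blast
          obtain a where a: "a \<in> net \<tau> R" "\<And>v. \<bar>x v - a v\<bar> \<le> real k / real R"
            using net_near[OF simplexD(1,2,4)[OF \<tau>] R x(1)] by blast
          have "norm (lin V (p u) (\<lambda>v. x v - a v)) \<le> real (k + 1) * (real k / real R * (real n * (real R * real B)))"
          proof (rule norm_lin_le[OF finV simplexD(3)[OF \<tau>] _ simplexD(4)[OF \<tau>]])
            show "x v - a v = 0" if "v \<notin> \<tau>" for v
              using that x(1) a(1) by (auto simp: net_def closed_simplex_def)
            show "norm (p u v) \<le> real n * (real R * real B)" if "v \<in> \<tau>" for v
              using that simplexD(3)[OF \<tau>] by (intro pnorm u) auto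
          qed (use a(2) in auto)
          also have "\<dots> = real (k + 1) * (real k * (real n * real B))" using R by simp
          finally have "norm (lin V (p u) x - lin V (p u) a) \<le> real (k + 1) * (real k * (real n * real B))"
            by (simp add: lin_diff)
          moreover have "lin V (p u) a - q = (y - q) + (lin V (p u) x - y) - (lin V (p u) x - lin V (p u) a)" by simp
          then have "norm (lin V (p u) a - q) \<le> norm (y - q) + norm (lin V (p u) x - y) + norm (lin V (p u) x - lin V (p u) a)"
            using norm_triangle_ineq[of "y - q" "lin V (p u) x - y"]
              norm_triangle_ineq4[of "(y - q) + (lin V (p u) x - y)" "lin V (p u) x - lin V (p u) a"] by simp
          ultimately show ?thesis using a(1) x(2) q(2) by (auto simp: r1_def)
        qed
        then obtain a where a: "\<And>\<tau>. \<tau> \<in> D0 \<Longrightarrow> a \<tau> \<in> net \<tau> R" "\<And>\<tau>. \<tau> \<in> D0 \<Longrightarrow> norm (lin V (p u) (a \<tau>) - q) \<le> r1"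
          by metis
        define D where "D = (\<lambda>\<tau>. (\<tau>, a \<tau>)) ` D0"
        have "card D = m" unfolding D_def using D0(2) by (simp add: card_image inj_on_def)
        moreover have "D \<subseteq> Y" using D0(1) a(1) by (auto simp: D_def Y_def)
        moreover have "fst s \<inter> fst t = {}" if "s \<in> D" "t \<in> D" "s \<noteq> t" for s t
        proof -
          have "fst s \<in> D0" "fst t \<in> D0" "fst s \<noteq> fst t" using that by (auto simp: D_def)
          then show ?thesis using D0(3) by (simp add: pairwise_def disjnt_def)
        qed
        ultimately have "D \<in> \<D>" by (auto simp: \<D>_def)
        moreover have "u \<in> bad q D" using u(1) a(2) by (auto simp: bad_def cond_def D_def)
        ultimately have "u \<in> Z" using q(1) by (auto simp: Z_def)
        then show False using u(2) by simp
      qed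
      show "\<exists>p :: nat \<Rightarrow> real^'n. well_spread X R B r (m * ((k + 1) * L)) p"
        unfolding well_spread_def V_def[symmetric]
        using range[OF u(1)] sep[OF u(1)] few by (intro exI[of _ "p u"] conjI) blast+
    qed
  qed
  then show ?thesis using B1 by (intro exI[of _ B] conjI) blast+
qed

section \<open>Separating disjoint simplices\<close>

text \<open>Distances in the simplex are measured by the sup norm of barycentric coordinates,
  expressed through a common bound \<open>\<delta>\<close>. The condition is imposed on single
  simplices because lattice rounding stays within one.\<close>

definition lipschitz_on_simplex :: "real \<Rightarrow> nat set \<Rightarrow> ((nat \<Rightarrow> real) \<Rightarrow> real^'n) \<Rightarrow> bool" where
  "lipschitz_on_simplex \<Lambda> \<sigma> g \<longleftrightarrow> (\<forall>x\<in>closed_simplex \<sigma>. \<forall>y\<in>closed_simplex \<sigma>. \<forall>\<delta>\<ge>0.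
     (\<forall>v. \<bar>x v - y v\<bar> \<le> \<delta>) \<longrightarrow> norm (g x - g y) \<le> \<Lambda> * \<delta>)"

text \<open>A tent of height and radius n + 1: every point of the box has a grid point within
  distance n, where the tent is still at least 1, while only boundedly many tents reach a given
  point.\<close>

definition bump :: "real^'n \<Rightarrow> real^'n \<Rightarrow> real" where
  "bump z y = max 0 (real CARD('n) + 1 - norm (y - z))"

text \<open>The vectors \<open>w (z, v)\<close> are drawn from \<open>grid J\<close>; after division
  by \<open>J\<close> they lie in a unit cube with spacing \<open>1 / J\<close>. Displacements are
  thus bounded uniformly in \<open>J\<close> while their resolution matches the separation
  sought.\<close>

definition field :: "(real^'n) set \<Rightarrow> nat \<Rightarrow> ((real^'n) \<times> nat \<Rightarrow> real^'n) \<Rightarrow> nat \<Rightarrow> real^'n \<Rightarrow> real^'n" where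
  "field Z J w v y = (\<Sum>z\<in>Z. bump z y *\<^sub>R ((1 / real J) *\<^sub>R w (z, v)))"

lemma bump_bounds: "0 \<le> bump z y" "bump z (y :: real^'n) \<le> real CARD('n) + 1"
  by (auto simp: bump_def)

lemma bump_eq_0: "real CARD('n) + 1 < norm (y - z) \<Longrightarrow> bump z (y :: real^'n) = 0"
  by (auto simp: bump_def)

lemma bump_diff: "\<bar>bump z y - bump z y'\<bar> \<le> norm (y - y')"
proof -
  have "\<bar>norm (y - z) - norm (y' - z)\<bar> \<le> norm (y - y')"
    using norm_triangle_ineq3[of "y - z" "y' - z"] by simp
  then show ?thesis unfolding bump_def by linarith
qed

text \<open>At most \<open>c\<close> tents are non-zero at one point and at most
  \<open>2 * c\<close> at one of two points, so the bounds do not grow with \<open>Q\<close> or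
  \<open>J\<close>.\<close>

lemma field_bounds:
  fixes w :: "(real^'n) \<times> nat \<Rightarrow> real^'n"
  defines "c \<equiv> (2 * (real CARD('n) + 1) + 1) ^ CARD('n)"
  assumes J: "1 \<le> J" and w: "\<And>z. z \<in> grid Q \<Longrightarrow> w (z, v) \<in> grid J"
  shows "norm (field (grid Q) J w v y) \<le> c * ((real CARD('n) + 1) * real CARD('n))"
    and "norm (field (grid Q) J w v y - field (grid Q) J w v y') \<le> 2 * c * real CARD('n) * norm (y - y')"
proof -
  let ?n = "real CARD('n)"
  let ?Z = "grid Q :: (real^'n) set"
  let ?N = "\<lambda>y. {z \<in> ?Z. norm (z - y) \<le> ?n + 1}"
  have N: "real (card (?N y)) \<le> c" for y unfolding c_def by (rule card_grid_ball) simp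
  have finN: "finite (?N y)" for y by simp
  have bN: "bump z y = 0" if "z \<in> ?Z" "z \<notin> ?N y" for z y
    using that by (intro bump_eq_0) (auto simp: norm_minus_commute)
  have w1: "norm ((1 / real J) *\<^sub>R w (z, v)) \<le> ?n" if "z \<in> ?Z" for z
  proof -
    have "norm (w (z, v)) \<le> ?n * real J" using w[OF that] by (rule norm_grid_le)
    then show ?thesis using J by (simp add: divide_le_eq)
  qed
  have "norm (field ?Z J w v y) = norm (\<Sum>z\<in>?N y. bump z y *\<^sub>R ((1 / real J) *\<^sub>R w (z, v)))"
    unfolding field_def using bN by (intro arg_cong[of _ _ norm] sum.mono_neutral_right) auto
  also have "\<dots> \<le> (\<Sum>z\<in>?N y. (?n + 1) * ?n)"
  proof (rule sum_norm_le)
    fix z assume "z \<in> ?N y"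
    then show "norm (bump z y *\<^sub>R ((1 / real J) *\<^sub>R w (z, v))) \<le> (?n + 1) * ?n"
      unfolding norm_scaleR[of "bump z y"] using bump_bounds[of z y] w1[of z] by (intro mult_mono) auto
  qed
  also have "\<dots> = real (card (?N y)) * ((?n + 1) * ?n)" by simp
  also have "\<dots> \<le> c * ((?n + 1) * ?n)" by (rule mult_right_mono[OF N]) simp
  finally show "norm (field ?Z J w v y) \<le> c * ((?n + 1) * ?n)" .
  have "field ?Z J w v y - field ?Z J w v y' = (\<Sum>z\<in>?Z. (bump z y - bump z y') *\<^sub>R ((1 / real J) *\<^sub>R w (z, v)))"
    unfolding field_def scaleR_diff_left sum_subtractf ..
  also have "\<dots> = (\<Sum>z\<in>?N y \<union> ?N y'. (bump z y - bump z y') *\<^sub>R ((1 / real J) *\<^sub>R w (z, v)))"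
    using bN by (intro sum.mono_neutral_right) auto
  finally have "norm (field ?Z J w v y - field ?Z J w v y')
      \<le> (\<Sum>z\<in>?N y \<union> ?N y'. norm (y - y') * ?n)"
  proof (elim ssubst, intro sum_norm_le)
    fix z assume "z \<in> ?N y \<union> ?N y'"
    then show "norm ((bump z y - bump z y') *\<^sub>R ((1 / real J) *\<^sub>R w (z, v))) \<le> norm (y - y') * ?n"
      unfolding norm_scaleR[of "bump z y - bump z y'"] using bump_diff[of z y y'] w1[of z] by (intro mult_mono) auto
  qed
  also have "\<dots> = real (card (?N y \<union> ?N y')) * (norm (y - y') * ?n)" by simp
  also have "\<dots> \<le> (2 * c) * (norm (y - y') * ?n)"
  proof (rule mult_right_mono)
    have "real (card (?N y \<union> ?N y')) \<le> real (card (?N y)) + real (card (?N y'))"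
      using card_Un_le[of "?N y" "?N y'"] by simp
    then show "real (card (?N y \<union> ?N y')) \<le> 2 * c" using N[of y] N[of y'] by linarith
  qed simp
  finally show "norm (field ?Z J w v y - field ?Z J w v y') \<le> 2 * c * ?n * norm (y - y')" by (simp add: mult_ac)
qed

text \<open>The field is affine in each single random vector, with slope
  \<open>bump z y / J\<close>, which is the form needed to count bad values of a pivot; the fields
  of other vertices do not react.\<close>

lemma field_upd:
  assumes "finite Z" "z \<in> Z"
  shows "field Z J (w((z, v) := s)) v y
       = field Z J (w((z, v) := 0)) v y + bump z y *\<^sub>R ((1 / real J) *\<^sub>R s)"
    and "u \<noteq> v \<Longrightarrow> field Z J (w((z, v) := s)) u y = field Z J w u y"
proof -
  have split: "field Z J (w((z, v) := s)) v y
      = bump z y *\<^sub>R ((1 / real J) *\<^sub>R s) + (\<Sum>z'\<in>Z-{z}. bump z' y *\<^sub>R ((1 / real J) *\<^sub>R w (z', v)))" for s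
  proof -
    have "(\<Sum>z'\<in>Z-{z}. bump z' y *\<^sub>R ((1 / real J) *\<^sub>R (w((z, v) := s)) (z', v)))
      = (\<Sum>z'\<in>Z-{z}. bump z' y *\<^sub>R ((1 / real J) *\<^sub>R w (z', v)))"
      by (intro sum.cong) auto
    then show ?thesis unfolding field_def sum.remove[OF assms] by simp
  qed
  show "field Z J (w((z, v) := s)) v y
       = field Z J (w((z, v) := 0)) v y + bump z y *\<^sub>R ((1 / real J) *\<^sub>R s)"
    unfolding split[of s] split[of 0] by simp
  show "field Z J (w((z, v) := s)) u y = field Z J w u y" if "u \<noteq> v"
    unfolding field_def using that by (intro sum.cong) auto
qed

lemma lin_in_box:
  fixes p :: "nat \<Rightarrow> real^'n"
  assumes "finite V" "\<sigma> \<subseteq> V" "x \<in> closed_simplex \<sigma>"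
    and p: "\<And>v. v \<in> V \<Longrightarrow> 0 \<le> p v $ i \<and> p v $ i < Q"
  shows "0 \<le> lin V p x $ i \<and> lin V p x $ i < Q"
proof -
  have fin: "finite \<sigma>" using assms finite_subset by blast
  have x0: "\<And>v. 0 \<le> x v" "\<And>v. v \<notin> \<sigma> \<Longrightarrow> x v = 0" "(\<Sum>v\<in>\<sigma>. x v) = 1"
    using assms(3) by (auto simp: closed_simplex_def)
  have "lin V p x = (\<Sum>v\<in>\<sigma>. x v *\<^sub>R p v)" by (rule lin_restrict) (use assms x0 in auto)
  then have eq: "lin V p x $ i = (\<Sum>v\<in>\<sigma>. x v * p v $ i)" by simp
  have "0 \<le> lin V p x $ i" unfolding eq using p assms(2) x0(1) by (intro sum_nonneg mult_nonneg_nonneg) auto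
  \<comment> \<open>Some vertex has positive weight, which makes the upper inequality
    strict.\<close>
  moreover obtain v where v: "v \<in> \<sigma>" "x v \<noteq> 0" using x0(3) by (metis sum.neutral zero_neq_one)
  have "0 < (\<Sum>v\<in>\<sigma>. x v * (Q - p v $ i))"
  proof (rule sum_pos2[OF fin v(1)])
    show "0 < x v * (Q - p v $ i)" using p[of v] v x0(1)[of v] assms(2) by (intro mult_pos_pos) auto
    show "0 \<le> x u * (Q - p u $ i)" if "u \<in> \<sigma>" for u
      using p[of u] that x0(1)[of u] assms(2) by (intro mult_nonneg_nonneg) (auto simp: less_imp_le)
  qed
  then have "0 < Q - lin V p x $ i"
    unfolding eq using x0(3) by (simp add: right_diff_distrib sum_subtractf flip: sum_distrib_right)
  ultimately show ?thesis by simp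
qed

text \<open>Each vertex \<open>v\<close> carries its own random vector field \<open>field Z J w v\<close>, and a point with
  barycentric coordinates \<open>x\<close> is moved by the \<open>x\<close>-average of these fields. So the displacements of
  disjoint simplices are independent, while the displacement at a point involves boundedly many
  random vectors. Two lattice points on disjoint simplices come within about \<open>1 / J\<close> of each other
  with probability of order \<open>J\<^sup>-\<^sup>n\<close>, and each random vector influences about
  \<open>M J\<^sup>2\<^sup>k\<close> pairs of lattice points.\<close>

lemma separating_perturbation:
  fixes B k L :: nat
  assumes kn: "2 * k + 1 \<le> CARD('n)"
  shows "\<exists>r\<ge>0. \<exists>C2\<ge>0. \<exists>C3\<ge>0. \<forall>X R M J (p :: nat \<Rightarrow> real^'n).
    bounded_complex k L X \<longrightarrow> 1 \<le> R \<longrightarrow> 1 \<le> J \<longrightarrow> C2 * real M \<le> real J \<longrightarrow>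
    well_spread X R B r M p \<longrightarrow>
    (\<exists>(f :: (nat \<Rightarrow> real) \<Rightarrow> real^'n) \<Lambda>. continuous_on UNIV f \<and>
       0 \<le> \<Lambda> \<and> (\<forall>\<sigma>\<in>X. lipschitz_on_simplex \<Lambda> \<sigma> f) \<and>
       (\<forall>x\<in>realization X. norm (f x) \<le> C3 * real R) \<and>
       (\<forall>\<sigma>\<in>X. \<forall>\<tau>\<in>X. \<sigma> \<inter> \<tau> = {} \<longrightarrow>
          (\<forall>x\<in>closed_simplex \<sigma>. \<forall>y\<in>closed_simplex \<tau>. 1 / real J \<le> norm (f x - f y))))"
proof -
  define n where "n = CARD('n)"
  define c where "c = (2 * (real n + 1) + 1) ^ n"
  define c1 where "c1 = c * ((real n + 1) * real n)"
  define c2 where "c2 = 2 * c * real n"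
  have c0: "0 \<le> c" "0 \<le> c1" "0 \<le> c2" by (auto simp: c_def c1_def c2_def)
  define d where "d = real (k + 1)"
  \<comment> \<open>The Lipschitz constant of the perturbed map divided by \<open>R\<close>: linear
    part, change of the weights of the fields, change of the fields along the linear part.\<close>
  define \<Lambda>0 where "\<Lambda>0 = d * (real n * real B) + d * c1 + d * (c2 * (d * (real n * real B)))"
  \<comment> \<open>Points at image distance below \<open>1 / J\<close> have lattice points at image
    distance at most \<open>\<theta> / J\<close>: rounding each with mesh \<open>1 / (R * J)\<close>
    costs \<open>\<Lambda>0 * k / J\<close>.\<close>
  define \<theta> where "\<theta> = 1 + 2 * (\<Lambda>0 * real k)"
  \<comment> \<open>Bounds the unperturbed distance of any pair that can become close, as each point
    moves by at most \<open>d * c1\<close>; it also exceeds the range n + 1 of a tent.\<close>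
  define \<rho> where "\<rho> = \<theta> + 2 * (d * c1) + real n + 1"
  have d1: "1 \<le> d" by (simp add: d_def)
  have \<Lambda>0: "0 \<le> \<Lambda>0" using c0 d1 by (simp add: \<Lambda>0_def)
  have \<theta>1: "1 \<le> \<theta>" using \<Lambda>0 by (simp add: \<theta>_def)
  have \<rho>0: "0 \<le> \<rho>" using \<theta>1 c0 d1 by (simp add: \<rho>_def)
  \<comment> \<open>Times J^k, this bounds the lattice points of one simplex mapped into a ball of
    radius \<open>\<rho>\<close>.\<close>
  define \<kappa> where "\<kappa> = (4 * \<rho> + 1) ^ k"
  have \<kappa>0: "0 \<le> \<kappa>" using \<rho>0 by (simp add: \<kappa>_def)
  define K where "K = nat \<lceil>(2 * (\<theta> * d) + 1) ^ n\<rceil>"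
  \<comment> \<open>8 is 4 from the avoidance lemma times 2 for the two members of a pair;
    \<open>L\<close> counts simplices at a vertex, and \<open>\<kappa>\<close> enters once for each
    member.\<close>
  define C2 where "C2 = 8 * real K * real L * \<kappa>\<^sup>2"
  define C3 where "C3 = d * (real n * real B) + d * c1"
  show ?thesis
  proof (rule exI[of _ \<rho>], rule conjI[OF \<rho>0], rule exI[of _ C2], rule conjI, use \<kappa>0 in \<open>simp add: C2_def\<close>,
      rule exI[of _ C3], rule conjI, use c0 d1 in \<open>simp add: C3_def\<close>, intro allI impI)
    fix X R M J and p :: "nat \<Rightarrow> real^'n"
    assume bX: "bounded_complex k L X" and R: "1 \<le> R" and J: "1 \<le> J"
      and CJ: "C2 * real M \<le> real J" and p: "well_spread X R B \<rho> M p"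
    have X: "is_complex X" and dim: "\<forall>\<sigma>\<in>X. card \<sigma> \<le> k + 1"
      and deg: "\<forall>v\<in>vertices X. card {\<sigma>\<in>X. v \<in> \<sigma>} \<le> L"
      using bX by (simp_all add: bounded_complex_def)
    have range0: "\<forall>v\<in>vertices X. \<forall>i. 0 \<le> p v $ i \<and> p v $ i < real (R * B)"
      and sep0: "\<forall>\<tau>\<in>X. \<forall>x\<in>closed_simplex \<tau>. \<forall>x'\<in>closed_simplex \<tau>. \<forall>v.
       real R * \<bar>x v - x' v\<bar> \<le> norm (lin (vertices X) p x - lin (vertices X) p x')"
      and few0: "\<forall>y. (\<forall>i. 0 \<le> y $ i \<and> y $ i < real (R * B)) \<longrightarrow>
       card {\<tau>\<in>X. \<exists>x\<in>closed_simplex \<tau>. norm (lin (vertices X) p x - y) \<le> \<rho>} \<le> M"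
      using p unfolding well_spread_def by blast+
    define V where "V = vertices X"
    define A where "A = lin V p"
    have finV: "finite V" and finX: "finite X"
      using finite_vertices[OF X] X by (auto simp: V_def is_complex_def)
    have simplexD: "finite \<sigma>" "\<sigma> \<noteq> {}" "\<sigma> \<subseteq> V" "card \<sigma> \<le> k + 1" if "\<sigma> \<in> X" for \<sigma>
      using complexD[OF X that] dim that by (auto simp: V_def)
    have sep: "real R * \<bar>x v - x' v\<bar> \<le> norm (A x - A x')"
      if "\<tau> \<in> X" "x \<in> closed_simplex \<tau>" "x' \<in> closed_simplex \<tau>" for \<tau> x x' v
      using sep0 that unfolding A_def V_def by blast
    have box: "0 \<le> A x $ i \<and> A x $ i < real (R * B)" if "\<sigma> \<in> X" "x \<in> closed_simplex \<sigma>" for \<sigma> x i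
      unfolding A_def using range0 by (intro lin_in_box[OF finV simplexD(3)[OF that(1)] that(2)]) (auto simp: V_def)
    have few: "card {\<tau>\<in>X. \<exists>x\<in>closed_simplex \<tau>. norm (A x - A a) \<le> \<rho>} \<le> M"
      if "\<sigma> \<in> X" "a \<in> closed_simplex \<sigma>" for \<sigma> a
      using few0 box[OF that] unfolding A_def V_def by blast
    have pnorm: "norm (p v) \<le> real n * (real R * real B)" if "v \<in> V" for v
      unfolding n_def
    proof (rule norm_le_of_components)
      fix i show "\<bar>p v $ i\<bar> \<le> real R * real B" using range0 that by (auto simp: abs_le_iff V_def less_imp_le)
    qed
    have cs: "0 \<le> x v" "x v \<le> 1" "v \<notin> \<sigma> \<Longrightarrow> x v = 0" if "\<sigma> \<in> X" "x \<in> closed_simplex \<sigma>" for x v \<sigma>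
      using closed_simplex_le_1[OF that(2) simplexD(1)[OF that(1)]] that(2) by (auto simp: closed_simplex_def)
    have A_diff: "norm (A x - A x') \<le> d * (real n * real B) * real R * \<delta>"
      if "\<sigma> \<in> X" "x \<in> closed_simplex \<sigma>" "x' \<in> closed_simplex \<sigma>" "\<And>v. \<bar>x v - x' v\<bar> \<le> \<delta>" "0 \<le> \<delta>" for \<sigma> x x' \<delta>
    proof -
      have "norm (lin V p (\<lambda>v. x v - x' v)) \<le> real (k + 1) * (\<delta> * (real n * (real R * real B)))"
        using that pnorm simplexD(3)[OF that(1)] cs(3)[OF that(1,2)] cs(3)[OF that(1,3)]
        by (intro norm_lin_le[OF finV simplexD(3)[OF that(1)] _ simplexD(4)[OF that(1)]]) auto
      then show ?thesis by (simp add: A_def lin_diff d_def mult_ac)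
    qed
    define Z where "Z = (grid (R * B) :: (real^'n) set)"
    define W where "W = (grid J :: (real^'n) set)"
    define I where "I = Z \<times> V"
    define F where "F w v y = field Z J w v y" for w v y
    \<comment> \<open>The fields are evaluated at the unperturbed image \<open>A x\<close>, so
      \<open>f w x\<close> is affine in \<open>w\<close> with coefficients independent of
      \<open>w\<close>.\<close>
    define f where "f w x = A x + lin V (\<lambda>v. F w v (A x)) x" for w x
    have finZ: "finite Z" by (simp add: Z_def)
    have F1: "norm (F w v y) \<le> c1" and F2: "norm (F w v y - F w v y') \<le> c2 * norm (y - y')"
      if "w \<in> PiE I (\<lambda>_. W)" "v \<in> V" for w v y y'
    proof -
      have wJ: "w (z, v) \<in> grid J" if "z \<in> grid (R * B)" for z
        using \<open>w \<in> PiE I (\<lambda>_. W)\<close> \<open>v \<in> V\<close> that by (auto simp: I_def Z_def W_def)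
      show "norm (F w v y) \<le> c1"
        unfolding F_def Z_def c1_def c_def n_def by (rule field_bounds(1)) (fact J, fact wJ)
      show "norm (F w v y - F w v y') \<le> c2 * norm (y - y')"
        unfolding F_def Z_def c2_def c_def n_def by (rule field_bounds(2)) (fact J, fact wJ)
    qed
    have pert: "norm (f w x - A x) \<le> d * c1"
      if "w \<in> PiE I (\<lambda>_. W)" "\<sigma> \<in> X" "x \<in> closed_simplex \<sigma>" for w \<sigma> x
    proof -
      have "norm (lin V (\<lambda>v. F w v (A x)) x) \<le> real (k + 1) * (1 * c1)"
        using cs[OF that(2,3)] F1[OF that(1)] simplexD(3)[OF that(2)] c0
        by (intro norm_lin_le[OF finV simplexD(3)[OF that(2)] _ simplexD(4)[OF that(2)]]) auto
      then show ?thesis by (simp add: f_def d_def)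
    qed
    have lip: "norm (f w x - f w x') \<le> \<Lambda>0 * real R * \<delta>"
      if w: "w \<in> PiE I (\<lambda>_. W)" and \<sigma>: "\<sigma> \<in> X" and x: "x \<in> closed_simplex \<sigma>" "x' \<in> closed_simplex \<sigma>"
        and \<delta>: "\<And>v. \<bar>x v - x' v\<bar> \<le> \<delta>" "0 \<le> \<delta>" for w \<sigma> x x' \<delta>
    proof -
      have A: "norm (A x - A x') \<le> d * (real n * real B) * real R * \<delta>" by (rule A_diff[OF \<sigma> x \<delta>])
      have 1: "norm (lin V (\<lambda>v. F w v (A x)) (\<lambda>v. x v - x' v)) \<le> real (k + 1) * (\<delta> * c1)"
        using cs(3)[OF \<sigma> x(1)] cs(3)[OF \<sigma> x(2)] F1[OF w] simplexD(3)[OF \<sigma>] c0 \<delta>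
        by (intro norm_lin_le[OF finV simplexD(3)[OF \<sigma>] _ simplexD(4)[OF \<sigma>]]) auto
      have 2: "norm (lin V (\<lambda>v. F w v (A x) - F w v (A x')) x') \<le> real (k + 1) * (1 * (c2 * norm (A x - A x')))"
        using cs[OF \<sigma> x(2)] F2[OF w] simplexD(3)[OF \<sigma>] c0
        by (intro norm_lin_le[OF finV simplexD(3)[OF \<sigma>] _ simplexD(4)[OF \<sigma>]]) auto
      have "f w x - f w x' = (A x - A x') + lin V (\<lambda>v. F w v (A x)) (\<lambda>v. x v - x' v)
          + lin V (\<lambda>v. F w v (A x) - F w v (A x')) x'"
        by (simp add: f_def lin_def scaleR_diff_left scaleR_diff_right sum_subtractf)
      then have "norm (f w x - f w x') \<le> norm (A x - A x') + norm (lin V (\<lambda>v. F w v (A x)) (\<lambda>v. x v - x' v))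
          + norm (lin V (\<lambda>v. F w v (A x) - F w v (A x')) x')"
        using norm_triangle_ineq[of "A x - A x'" "lin V (\<lambda>v. F w v (A x)) (\<lambda>v. x v - x' v)"]
          norm_triangle_ineq[of "(A x - A x') + lin V (\<lambda>v. F w v (A x)) (\<lambda>v. x v - x' v)"
            "lin V (\<lambda>v. F w v (A x) - F w v (A x')) x'"] by simp
      also have "\<dots> \<le> norm (A x - A x') + d * (\<delta> * c1) + d * (c2 * norm (A x - A x'))"
        using 1 2 by (simp add: d_def)
      also have "\<dots> \<le> d * (real n * real B) * real R * \<delta> + d * (\<delta> * c1) + d * (c2 * (d * (real n * real B) * real R * \<delta>))"
        using A c0 d1 \<delta>(2) by (intro add_mono mult_left_mono) auto
      also have "\<dots> \<le> d * (real n * real B) * real R * \<delta> + d * (\<delta> * c1) * real R + d * (c2 * (d * (real n * real B) * real R * \<delta>))"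
      proof -
        have "d * (\<delta> * c1) * 1 \<le> d * (\<delta> * c1) * real R" using R c0 d1 \<delta> by (intro mult_left_mono) auto
        then show ?thesis by simp
      qed
      also have "\<dots> = \<Lambda>0 * real R * \<delta>" by (simp add: \<Lambda>0_def algebra_simps)
      finally show ?thesis .
    qed
    \<comment> \<open>With this mesh, rounding moves perturbed images by order \<open>1 / J\<close>,
      the scale of the separation.\<close>
    define D where "D = R * J"
    have D1: "1 \<le> D" using R J by (simp add: D_def)
    have finnet: "finite (net \<sigma> D)" if "\<sigma> \<in> X" for \<sigma>
      using finite_net(1)[OF simplexD(1,2,4)[OF that] D1] .
    have near: "real (card {a \<in> net \<sigma> D. norm (A a - y) \<le> \<rho>}) \<le> \<kappa> * real J ^ k" if \<sigma>: "\<sigma> \<in> X" for \<sigma> y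
    proof (cases "{a \<in> net \<sigma> D. norm (A a - y) \<le> \<rho>} = {}")
      case True
      then show ?thesis using \<kappa>0 by (simp only: card.empty) simp
    next
      case False
      then obtain a0 where a0: "a0 \<in> net \<sigma> D" "norm (A a0 - y) \<le> \<rho>" by blast
      \<comment> \<open>By \<open>sep\<close>, lattice points mapped into the same ball differ by at
        most this much in each coordinate, about \<open>2 * \<rho> * J\<close> steps of the
        mesh.\<close>
      let ?\<delta> = "2 * \<rho> / real R"
      have sub: "{a \<in> net \<sigma> D. norm (A a - y) \<le> \<rho>} \<subseteq> {a \<in> net \<sigma> D. \<forall>v. \<bar>a v - a0 v\<bar> \<le> ?\<delta>}"
      proof (intro subsetI CollectI conjI allI)
        fix a v assume a: "a \<in> {a \<in> net \<sigma> D. norm (A a - y) \<le> \<rho>}"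
        then have "real R * \<bar>a v - a0 v\<bar> \<le> norm (A a - A a0)"
          using net_subset a0 by (intro sep[OF \<sigma>]) auto
        also have "\<dots> \<le> norm (A a - y) + norm (A a0 - y)"
          using norm_triangle_ineq4[of "A a - y" "A a0 - y"] by simp
        also have "\<dots> \<le> 2 * \<rho>" using a a0 by simp
        finally show "\<bar>a v - a0 v\<bar> \<le> ?\<delta>" using R by (simp add: pos_le_divide_eq mult.commute)
      qed auto
      have "card {a \<in> net \<sigma> D. norm (A a - y) \<le> \<rho>} \<le> card {a \<in> net \<sigma> D. \<forall>v. \<bar>a v - a0 v\<bar> \<le> ?\<delta>}"
        using finnet[OF \<sigma>] by (intro card_mono sub) auto
      also have "real \<dots> \<le> (2 * (real D * ?\<delta>) + 1) ^ k"
        using \<rho>0 by (intro card_net_ball(2)[OF simplexD(1,2,4)[OF \<sigma>] D1]) auto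
      also have "2 * (real D * ?\<delta>) + 1 = 4 * \<rho> * real J + 1" using R by (simp add: D_def)
      also have "(4 * \<rho> * real J + 1) ^ k \<le> ((4 * \<rho> + 1) * real J) ^ k"
        using \<rho>0 J by (intro power_mono) (auto simp: distrib_right)
      also have "\<dots> = \<kappa> * real J ^ k" by (simp add: \<kappa>_def power_mult_distrib)
      finally show ?thesis by simp
    qed
    define supp1 where "supp1 s = {z \<in> Z. norm (A (snd s) - z) \<le> real n + 1} \<times> fst s" for s :: "nat set \<times> (nat \<Rightarrow> real)"
    define supp where "supp e = supp1 (fst e) \<union> supp1 (snd e)" for e
    define P where "P = (SIGMA \<sigma>:X. net \<sigma> D)"
    \<comment> \<open>Pairs that start further apart than \<open>\<rho>\<close> cannot collide.
      Leaving them out makes the number of events per variable depend on the multiplicity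
      \<open>M\<close> instead of the size of the complex.\<close>
    define Ev where "Ev = {e. fst e \<in> P \<and> snd e \<in> P \<and> fst (fst e) \<inter> fst (snd e) = {} \<and>
        norm (A (snd (fst e)) - A (snd (snd e))) \<le> \<rho>}"
    define bad where "bad e w \<longleftrightarrow> norm (f w (snd (fst e)) - f w (snd (snd e))) \<le> \<theta> / real J"
      for e :: "(nat set \<times> (nat \<Rightarrow> real)) \<times> (nat set \<times> (nat \<Rightarrow> real))" and w
    have PD: "fst s \<in> X" "snd s \<in> closed_simplex (fst s)" "snd s \<in> net (fst s) D" if "s \<in> P" for s
      using that by (auto simp: P_def net_def)
    have finP: "finite P" unfolding P_def using finX finnet by auto
    have finEv: "finite Ev" by (rule finite_subset[of _ "P \<times> P"]) (use finP in \<open>auto simp: Ev_def\<close>)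
    have f_cong: "f w (snd s) = f w' (snd s)" if s: "s \<in> P" and eq: "\<And>i. i \<in> supp1 s \<Longrightarrow> w i = w' i" for s w w'
    proof -
      have "lin V (\<lambda>v. F w v (A (snd s))) (snd s) = lin V (\<lambda>v. F w' v (A (snd s))) (snd s)"
        unfolding lin_def
      proof (rule sum.cong[OF refl])
        fix v
        show "snd s v *\<^sub>R F w v (A (snd s)) = snd s v *\<^sub>R F w' v (A (snd s))"
        proof (cases "v \<in> fst s")
          case True
          have "F w v (A (snd s)) = F w' v (A (snd s))"
            unfolding F_def field_def
          proof (rule sum.cong[OF refl])
            fix z assume z: "z \<in> Z"
            show "bump z (A (snd s)) *\<^sub>R ((1 / real J) *\<^sub>R w (z, v)) = bump z (A (snd s)) *\<^sub>R ((1 / real J) *\<^sub>R w' (z, v))"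
            proof (cases "norm (A (snd s) - z) \<le> real n + 1")
              case near: True
              then have "(z, v) \<in> supp1 s" using z True by (simp add: supp1_def)
              then show ?thesis using eq by simp
            next
              case False
              then show ?thesis using bump_eq_0[of "A (snd s)" z] by (simp add: n_def)
            qed
          qed
          then show ?thesis by simp
        next
          case False
          then show ?thesis using PD(2)[OF s] by (simp add: closed_simplex_def)
        qed
      qed
      then show ?thesis by (simp add: f_def)
    qed
    \<comment> \<open>Combine a vertex of weight at least \<open>1 / (k + 1)\<close> with a grid
      point within n of the image, where the tent is at least 1.\<close>
    have "\<exists>i. i \<in> supp1 s \<and> 1 / d \<le> snd s (snd i) * bump (fst i) (A (snd s))" if s: "s \<in> P" for s
    proof -
      obtain v where v: "v \<in> fst s" "1 / (real k + 1) \<le> snd s v"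
        using large_barycentric_coordinate[OF PD(2)[OF s] simplexD(1,4)[OF PD(1)[OF s]]] by blast
      obtain z where z: "z \<in> Z" "norm (A (snd s) - z) \<le> real n"
        using grid_near[of "A (snd s)" "R * B"] box[OF PD(1,2)[OF s]] unfolding Z_def n_def by blast
      have "1 \<le> bump z (A (snd s))" using z(2) by (simp add: bump_def n_def)
      then have "1 / d * 1 \<le> snd s v * bump z (A (snd s))" using v(2) d1 
        by (intro mult_mono) (auto simp: d_def add.commute intro: order.trans[rotated])
      then show ?thesis using v z by (intro exI[of _ "(z, v)"]) (auto simp: supp1_def)
    qed
    then obtain piv1 where piv1: "\<And>s. s \<in> P \<Longrightarrow> piv1 s \<in> supp1 s"
        "\<And>s. s \<in> P \<Longrightarrow> 1 / d \<le> snd s (snd (piv1 s)) * bump (fst (piv1 s)) (A (snd s))" by metis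
    define piv where "piv e = piv1 (fst e)" for e :: "(nat set \<times> (nat \<Rightarrow> real)) \<times> (nat set \<times> (nat \<Rightarrow> real))"
    have supp1_I: "supp1 s \<subseteq> I" if "s \<in> P" for s
      using simplexD(3)[OF PD(1)[OF that]] by (auto simp: supp1_def I_def)
    have "\<exists>w\<in>PiE I (\<lambda>_. W). \<forall>e\<in>Ev. \<not> bad e w"
    proof (rule rosenfeld_avoid_events[where supp = supp and piv = piv and K = K])
      show "finite I" "finite W" "finite Ev" using finZ finV finEv by (auto simp: I_def W_def)
      have "card W \<noteq> 0" using J by (simp add: W_def card_grid)
      then show "W \<noteq> {}" by auto
      show "supp e \<subseteq> I" if "e \<in> Ev" for e using that supp1_I by (auto simp: supp_def Ev_def)
      show "piv e \<in> supp e" if "e \<in> Ev" for e using that piv1(1) by (auto simp: supp_def piv_def Ev_def)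
    next
      fix e w w' assume e: "e \<in> Ev" and eq: "\<And>v. v \<in> supp e \<Longrightarrow> w v = w' v" and b: "bad e w"
      have "f w (snd (fst e)) = f w' (snd (fst e))" "f w (snd (snd e)) = f w' (snd (snd e))"
        using e eq by (auto intro!: f_cong simp: Ev_def supp_def)
      then show "bad e w'" using b by (simp add: bad_def)
    next
      fix e w assume e: "e \<in> Ev"
      obtain s1 s2 where es: "e = (s1, s2)" by (cases e)
      have s: "s1 \<in> P" "s2 \<in> P" "fst s1 \<inter> fst s2 = {}" using e by (auto simp: Ev_def es)
      obtain z v where zv: "piv1 s1 = (z, v)" by (cases "piv1 s1")
      have z: "z \<in> Z" and v: "v \<in> fst s1" using piv1(1)[OF s(1)] by (auto simp: zv supp1_def)
      have vV: "v \<in> V" using v simplexD(3)[OF PD(1)[OF s(1)]] by blast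
      let ?a = "snd s1" and ?b = "snd s2"
      let ?c = "?a v * bump z (A ?a)"
      have c: "1 / d \<le> ?c" using piv1(2)[OF s(1)] by (simp add: zv)
      then have c_pos: "0 < ?c" using d1 by (intro less_le_trans[OF _ c]) simp
      define t where "t = f (w((z, v) := 0)) ?a - f w ?b"
      \<comment> \<open>The second simplex does not contain \<open>v\<close>, so resampling the
        pivot moves only the first point of the pair.\<close>
      have fb: "f (w((z, v) := q)) ?b = f w ?b" for q
        by (rule f_cong[OF s(2)]) (use v s(3) in \<open>auto simp: supp1_def\<close>)
      have fa: "f (w((z, v) := q)) ?a = f (w((z, v) := 0)) ?a + (?c / real J) *\<^sub>R q" for q
      proof -
        have "lin V (\<lambda>u. F (w((z, v) := q)) u (A ?a)) ?a - lin V (\<lambda>u. F (w((z, v) := 0)) u (A ?a)) ?a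
            = (\<Sum>u\<in>V. if u = v then ?a u *\<^sub>R (bump z (A ?a) *\<^sub>R ((1 / real J) *\<^sub>R q)) else 0)"
          unfolding lin_def sum_subtractf[symmetric] scaleR_diff_right[symmetric]
        proof (rule sum.cong[OF refl])
          fix u
          show "?a u *\<^sub>R (F (w((z, v) := q)) u (A ?a) - F (w((z, v) := 0)) u (A ?a))
              = (if u = v then ?a u *\<^sub>R (bump z (A ?a) *\<^sub>R ((1 / real J) *\<^sub>R q)) else 0)"
            using field_upd(1)[OF finZ z, of J w v q] field_upd(2)[OF finZ z, of u v J w q]
              field_upd(2)[OF finZ z, of u v J w 0] by (auto simp: F_def)
        qed
        also have "\<dots> = (?c / real J) *\<^sub>R q" using finV vV by simp
        finally show ?thesis by (simp add: f_def algebra_simps)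
      qed
      have "{q \<in> W. bad e (w(piv e := q))} = {q \<in> W. norm ((?c / real J) *\<^sub>R q + t) \<le> \<theta> / real J}"
      proof -
        have "f (w((z, v) := q)) ?a - f (w((z, v) := q)) ?b = (?c / real J) *\<^sub>R q + t" for q
          unfolding fa[of q] fb t_def by simp
        then show ?thesis by (simp add: bad_def piv_def es zv)
      qed
      moreover have "real (card {q \<in> W. norm ((?c / real J) *\<^sub>R q + t) \<le> \<theta> / real J})
          \<le> (2 * ((\<theta> / real J) / (?c / real J)) + 1) ^ CARD('n)"
        unfolding W_def using \<theta>1 c_pos J by (intro card_grid_affine) auto
      moreover have "(2 * ((\<theta> / real J) / (?c / real J)) + 1) ^ CARD('n) \<le> (2 * (\<theta> * d) + 1) ^ CARD('n)"
      proof -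
        \<comment> \<open>Target radius and step length both scale as \<open>1 / J\<close>, so the
          number of bad values is bounded independently of \<open>J\<close>.\<close>
        have "(\<theta> / real J) / (?c / real J) = \<theta> / ?c" using J by simp
        also have "\<dots> \<le> \<theta> / (1 / d)" using c \<theta>1 d1 c_pos by (intro divide_left_mono) auto
        finally have "(\<theta> / real J) / (?c / real J) \<le> \<theta> * d" by simp
        moreover have "0 \<le> (\<theta> / real J) / (?c / real J)" using \<theta>1 c_pos by (intro divide_nonneg_nonneg) auto
        ultimately show ?thesis by (intro power_mono) auto
      qed
      moreover have "(2 * (\<theta> * d) + 1) ^ CARD('n) \<le> real K" unfolding K_def n_def by linarith
      ultimately show "card {q \<in> W. bad e (w(piv e := q))} \<le> K" by (simp only: flip: of_nat_le_iff[where 'a = real])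
    next
      fix i assume "i \<in> I"
      then obtain z v where zv: "i = (z, v)" "v \<in> V" by (auto simp: I_def)
      \<comment> \<open>\<open>P1\<close> contains the lattice points that the variable
        \<open>i\<close> can move, \<open>P2 s\<close> the possible partners of \<open>s\<close>;
        the former lie on at most \<open>L\<close> simplices, the latter on at most
        \<open>M\<close>.\<close>
      define P1 where "P1 = (SIGMA \<sigma>:{\<sigma>\<in>X. v \<in> \<sigma>}. {a \<in> net \<sigma> D. norm (A a - z) \<le> \<rho>})"
      define P2 where "P2 s = (SIGMA \<tau>:{\<tau>\<in>X. \<exists>x\<in>closed_simplex \<tau>. norm (A x - A (snd s)) \<le> \<rho>}.
          {b \<in> net \<tau> D. norm (A b - A (snd s)) \<le> \<rho>})" for s :: "nat set \<times> (nat \<Rightarrow> real)"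
      have fin12: "finite P1" "finite (P2 s)" for s unfolding P1_def P2_def using finX finnet by auto
      have P1: "real (card P1) \<le> real L * (\<kappa> * real J ^ k)"
      proof -
        have "real (card P1) = (\<Sum>\<sigma>\<in>{\<sigma>\<in>X. v \<in> \<sigma>}. real (card {a \<in> net \<sigma> D. norm (A a - z) \<le> \<rho>}))"
          unfolding P1_def using finX finnet by (subst card_SigmaI) auto
        also have "\<dots> \<le> (\<Sum>\<sigma>\<in>{\<sigma>\<in>X. v \<in> \<sigma>}. \<kappa> * real J ^ k)" by (intro sum_mono near) auto
        also have "\<dots> = real (card {\<sigma>\<in>X. v \<in> \<sigma>}) * (\<kappa> * real J ^ k)" by simp
        also have "\<dots> \<le> real L * (\<kappa> * real J ^ k)"
          using deg zv \<kappa>0 unfolding V_def by (intro mult_right_mono) auto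
        finally show ?thesis .
      qed
      have P2: "real (card (P2 s)) \<le> real M * (\<kappa> * real J ^ k)" if "s \<in> P1" for s
      proof -
        let ?T = "{\<tau>\<in>X. \<exists>x\<in>closed_simplex \<tau>. norm (A x - A (snd s)) \<le> \<rho>}"
        have s: "fst s \<in> X" "snd s \<in> closed_simplex (fst s)" using that net_subset by (auto simp: P1_def net_def)
        have "real (card (P2 s)) = (\<Sum>\<tau>\<in>?T. real (card {b \<in> net \<tau> D. norm (A b - A (snd s)) \<le> \<rho>}))"
          unfolding P2_def using finX finnet by (subst card_SigmaI) auto
        also have "\<dots> \<le> (\<Sum>\<tau>\<in>?T. \<kappa> * real J ^ k)" by (intro sum_mono near) auto
        also have "\<dots> = real (card ?T) * (\<kappa> * real J ^ k)" by simp
        also have "\<dots> \<le> real M * (\<kappa> * real J ^ k)"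
          using few[OF s] \<kappa>0 by (intro mult_right_mono) auto
        finally show ?thesis .
      qed
      define E1 where "E1 = (SIGMA s:P1. P2 s)"
      have finE1: "finite E1" unfolding E1_def using fin12 by auto
      have "real (card E1) = (\<Sum>s\<in>P1. real (card (P2 s)))"
        unfolding E1_def using fin12 by (subst card_SigmaI) auto
      also have "\<dots> \<le> (\<Sum>s\<in>P1. real M * (\<kappa> * real J ^ k))" by (intro sum_mono P2)
      also have "\<dots> = real (card P1) * (real M * (\<kappa> * real J ^ k))" by simp
      also have "\<dots> \<le> real L * (\<kappa> * real J ^ k) * (real M * (\<kappa> * real J ^ k))"
        using P1 \<kappa>0 by (intro mult_right_mono) auto
      finally have E1: "real (card E1) \<le> real L * (\<kappa> * real J ^ k) * (real M * (\<kappa> * real J ^ k))" .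
      have half: "e \<in> E1" if "fst e \<in> P" "snd e \<in> P" "norm (A (snd (fst e)) - A (snd (snd e))) \<le> \<rho>" "i \<in> supp1 (fst e)" for e
      proof -
        have "norm (A (snd (fst e)) - z) \<le> \<rho>"
        proof -
          have "norm (A (snd (fst e)) - z) \<le> real n + 1" using that(4) by (auto simp: supp1_def zv)
          moreover have "0 \<le> d * c1" using c0 d1 by simp
          ultimately show ?thesis unfolding \<rho>_def using \<theta>1 by linarith
        qed
        then have "fst e \<in> P1" using that(1,4) by (auto simp: P1_def P_def supp1_def zv mem_Sigma_iff split_beta)
        moreover have "snd e \<in> P2 (fst e)"
        proof -
          have "norm (A (snd (snd e)) - A (snd (fst e))) \<le> \<rho>" using that(3) by (simp add: norm_minus_commute)
          then show ?thesis using PD[OF that(2)] unfolding P2_def by (cases "snd e") auto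
        qed
        ultimately show ?thesis unfolding E1_def by (cases e) auto
      qed
      \<comment> \<open>The variable may act on either member of a pair, whence the swapped
        copy.\<close>
      have "{e \<in> Ev. i \<in> supp e} \<subseteq> E1 \<union> prod.swap ` E1"
      proof
        fix e assume e: "e \<in> {e \<in> Ev. i \<in> supp e}"
        then consider "i \<in> supp1 (fst e)" | "i \<in> supp1 (fst (prod.swap e))" by (auto simp: supp_def)
        then show "e \<in> E1 \<union> prod.swap ` E1"
        proof cases
          case 1
          then show ?thesis using half[of e] e by (auto simp: Ev_def)
        next
          case 2
          then have "prod.swap e \<in> E1" using half[of "prod.swap e"] e by (auto simp: Ev_def norm_minus_commute)
          then show ?thesis by (intro UnI2 image_eqI[of _ _ "prod.swap e"]) auto
        qed
      qed
      then have "card {e \<in> Ev. i \<in> supp e} \<le> card (E1 \<union> prod.swap ` E1)"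
        using finE1 by (intro card_mono) auto
      also have "\<dots> \<le> card E1 + card (prod.swap ` E1)" by (rule card_Un_le)
      also have "card (prod.swap ` E1) \<le> card E1" using finE1 by (rule card_image_le)
      finally have "real (card {e \<in> Ev. i \<in> supp e}) \<le> 2 * real (card E1)" by simp
      then have c12: "real (card {e \<in> Ev. i \<in> supp e}) \<le> 2 * (real L * (\<kappa> * real J ^ k) * (real M * (\<kappa> * real J ^ k)))"
        using E1 by linarith
      have "real (4 * K * card {e \<in> Ev. i \<in> supp e}) = 4 * real K * real (card {e \<in> Ev. i \<in> supp e})" by simp
      also have "\<dots> \<le> 4 * real K * (2 * (real L * (\<kappa> * real J ^ k) * (real M * (\<kappa> * real J ^ k))))"
        by (rule mult_left_mono[OF c12]) simp
      also have "\<dots> = C2 * real M * real J ^ (2 * k)"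
      proof -
        have J2: "real J ^ (2 * k) = real J ^ k * real J ^ k" by (simp add: mult_2 power_add)
        show ?thesis unfolding C2_def power2_eq_square J2 by algebra
      qed
      also have "\<dots> \<le> real J * real J ^ (2 * k)" by (rule mult_right_mono[OF CJ]) simp
      also have "\<dots> = real J ^ (2 * k + 1)" by simp
      \<comment> \<open>Here \<open>2 * k + 1 \<le> n\<close> enters: beyond the J^(2k) pairs of
        lattice points there remains one factor \<open>J\<close>, which has paid for
        \<open>C2 * M\<close>.\<close>
      also have "\<dots> \<le> real J ^ CARD('n)" using J kn by (intro power_increasing) auto
      also have "\<dots> = real (card W)" by (simp add: W_def card_grid)
      finally show "4 * K * card {e \<in> Ev. i \<in> supp e} \<le> card W" by (simp only: of_nat_le_iff)
    qed
    then obtain w where w: "w \<in> PiE I (\<lambda>_. W)" and good: "\<And>e. e \<in> Ev \<Longrightarrow> \<not> bad e w" by blast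
    have thick: "1 / real J \<le> norm (f w x - f w y)"
      if \<sigma>: "\<sigma> \<in> X" and \<tau>: "\<tau> \<in> X" and disj: "\<sigma> \<inter> \<tau> = {}" and x: "x \<in> closed_simplex \<sigma>" and y: "y \<in> closed_simplex \<tau>"
      for \<sigma> \<tau> x y
    proof (rule ccontr)
      assume "\<not> 1 / real J \<le> norm (f w x - f w y)"
      then have lt: "norm (f w x - f w y) < 1 / real J" by simp
      obtain a where a: "a \<in> net \<sigma> D" "\<And>v. \<bar>x v - a v\<bar> \<le> real k / real D"
        using net_near[OF simplexD(1,2,4)[OF \<sigma>] D1 x] by blast
      obtain b where b: "b \<in> net \<tau> D" "\<And>v. \<bar>y v - b v\<bar> \<le> real k / real D"
        using net_near[OF simplexD(1,2,4)[OF \<tau>] D1 y] by blast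
      have ac: "a \<in> closed_simplex \<sigma>" "b \<in> closed_simplex \<tau>" using a b by (auto simp: net_def)
      have RD: "\<Lambda>0 * real R * (real k / real D) = \<Lambda>0 * real k / real J" using R by (simp add: D_def)
      have 1: "norm (f w x - f w a) \<le> \<Lambda>0 * real k / real J"
        using lip[OF w \<sigma> x ac(1) a(2)] RD by simp
      have 2: "norm (f w y - f w b) \<le> \<Lambda>0 * real k / real J"
        using lip[OF w \<tau> y ac(2) b(2)] RD by simp
      have "f w a - f w b = (f w x - f w y) - (f w x - f w a) + (f w y - f w b)" by simp
      then have "norm (f w a - f w b) \<le> norm (f w x - f w y) + norm (f w x - f w a) + norm (f w y - f w b)"
        using norm_triangle_ineq4[of "f w x - f w y" "f w x - f w a"]
          norm_triangle_ineq[of "(f w x - f w y) - (f w x - f w a)" "f w y - f w b"] by simp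
      also have "\<dots> \<le> 1 / real J + \<Lambda>0 * real k / real J + \<Lambda>0 * real k / real J" using lt 1 2 by linarith
      also have "\<dots> = \<theta> / real J" by (simp add: \<theta>_def add_divide_distrib)
      finally have close: "norm (f w a - f w b) \<le> \<theta> / real J" .
      have "\<theta> / real J \<le> \<theta>" using J \<theta>1 by (simp add: divide_le_eq mult_left_mono)
      \<comment> \<open>Closeness after a bounded perturbation means bounded distance before it, so
        this pair is one of the events that were avoided.\<close>
      have "A a - A b = (f w a - f w b) - (f w a - A a) + (f w b - A b)" by simp
      then have "norm (A a - A b) \<le> norm (f w a - f w b) + norm (f w a - A a) + norm (f w b - A b)"
        using norm_triangle_ineq4[of "f w a - f w b" "f w a - A a"]
          norm_triangle_ineq[of "(f w a - f w b) - (f w a - A a)" "f w b - A b"] by simp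
      also have "\<dots> \<le> \<theta> + d * c1 + d * c1"
        using close \<open>\<theta> / real J \<le> \<theta>\<close> pert[OF w \<sigma> ac(1)] pert[OF w \<tau> ac(2)] by linarith
      also have "\<dots> \<le> \<rho>" by (simp add: \<rho>_def)
      finally have "((\<sigma>, a), (\<tau>, b)) \<in> Ev" using \<sigma> \<tau> a b disj by (auto simp: Ev_def P_def)
      from good[OF this] show False using close by (simp add: bad_def)
    qed
    have bounded: "norm (f w x) \<le> C3 * real R" if xX: "x \<in> realization X" for x
    proof -
      obtain \<sigma> where \<sigma>: "\<sigma> \<in> X" "x \<in> closed_simplex \<sigma>" using xX by (auto simp: realization_def)
      have "norm (lin V p x) \<le> real (k + 1) * (1 * (real n * (real R * real B)))"
        using cs[OF \<sigma>] pnorm simplexD(3)[OF \<sigma>(1)]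
        by (intro norm_lin_le[OF finV simplexD(3)[OF \<sigma>(1)] _ simplexD(4)[OF \<sigma>(1)]]) auto
      then have "norm (A x) \<le> d * (real n * real B) * real R" by (simp add: A_def d_def mult_ac)
      moreover have "norm (f w x) \<le> norm (A x) + norm (f w x - A x)"
        using norm_triangle_ineq[of "A x" "f w x - A x"] by simp
      moreover have "d * c1 * 1 \<le> d * c1 * real R" using R c0 d1 by (intro mult_left_mono) auto
      ultimately show ?thesis using pert[OF w \<sigma>] by (simp add: C3_def distrib_right)
    qed
    have cont: "continuous_on UNIV (f w)"
    proof -
      have "continuous_on UNIV (\<lambda>x::nat \<Rightarrow> real. x v)" for v by (rule continuous_on_product_coordinates)
      then show ?thesis unfolding f_def A_def lin_def F_def field_def bump_def
        by (intro continuous_intros) auto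
    qed
    have "\<forall>\<sigma>\<in>X. lipschitz_on_simplex (\<Lambda>0 * real R) \<sigma> (f w)"
      unfolding lipschitz_on_simplex_def using lip[OF w] by blast
    then show "(\<exists>(f :: (nat \<Rightarrow> real) \<Rightarrow> real^'n) \<Lambda>. continuous_on UNIV f \<and>
       0 \<le> \<Lambda> \<and> (\<forall>\<sigma>\<in>X. lipschitz_on_simplex \<Lambda> \<sigma> f) \<and>
       (\<forall>x\<in>realization X. norm (f x) \<le> C3 * real R) \<and>
       (\<forall>\<sigma>\<in>X. \<forall>\<tau>\<in>X. \<sigma> \<inter> \<tau> = {} \<longrightarrow>
          (\<forall>x\<in>closed_simplex \<sigma>. \<forall>y\<in>closed_simplex \<tau>. 1 / real J \<le> norm (f x - f y))))"
      using cont thick bounded \<Lambda>0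
      by (intro exI[of _ "f w"] exI[of _ "\<Lambda>0 * real R"] conjI) auto
  qed
qed

section \<open>Injectivity by general position\<close>

text \<open>The set below is the Lipschitz image of a \<open>2k\<close>-dimensional set.\<close>

lemma negligible_slopes:
  fixes g :: "(nat \<Rightarrow> real) \<Rightarrow> real^'n"
  assumes \<sigma>: "finite \<sigma>" "\<sigma> \<noteq> {}" "card \<sigma> \<le> k + 1" and \<tau>: "finite \<tau>" "\<tau> \<noteq> {}" "card \<tau> \<le> k + 1"
    and kn: "2 * k + 1 \<le> CARD('n)" and \<Lambda>: "0 \<le> \<Lambda>"
    and lip: "lipschitz_on_simplex \<Lambda> \<sigma> g" "lipschitz_on_simplex \<Lambda> \<tau> g"
  shows "negligible {(1 / (y v - x v)) *\<^sub>R (g x - g y) | x y. x \<in> closed_simplex \<sigma> \<and> y \<in> closed_simplex \<tau> \<and> x v \<noteq> y v}"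
proof -
  obtain s where s: "s \<in> \<sigma>" using \<sigma> by blast
  obtain t where t: "t \<in> \<tau>" using \<tau> by blast
  obtain i0 :: 'n where True by simp
  \<comment> \<open>Two points have together at most \<open>2 * k\<close> free barycentric
    coordinates. As \<open>2 * k \<le> n - 1\<close>, they fit into the coordinates of
    \<open>real^'n\<close> other than \<open>i0\<close>, so the parameter set is null in a space of
    the same dimension as the target.\<close>
  let ?D = "(\<sigma> - {s}) <+> (\<tau> - {t})"
  have "card ?D = card (\<sigma> - {s}) + card (\<tau> - {t})" using \<sigma> \<tau> by (intro card_Plus) auto
  also have "\<dots> \<le> k + k" using \<sigma> \<tau> s t by (intro add_mono) auto
  also have "\<dots> \<le> card (UNIV - {i0})" using kn by (simp add: card_Diff_singleton)
  finally have "card ?D \<le> card (UNIV - {i0})" .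
  then obtain h where h: "h ` ?D \<subseteq> UNIV - {i0}" "inj_on h ?D"
    using card_le_inj[of ?D "UNIV - {i0}"] \<sigma> \<tau> by auto
  \<comment> \<open>Recovers a point of a simplex from its free coordinates; the coordinate at
    \<open>q\<close> is whatever is missing to 1.\<close>
  define G :: "nat set \<Rightarrow> nat \<Rightarrow> (nat \<Rightarrow> 'n) \<Rightarrow> real^'n \<Rightarrow> nat \<Rightarrow> real" where
    "G \<rho> q \<iota> z u = (if u \<in> \<rho> - {q} then z $ \<iota> u else if u = q then 1 - (\<Sum>u\<in>\<rho>-{q}. z $ \<iota> u) else 0)" for \<rho> q \<iota> z u
  define c where "c = real k + 1"
  have c0: "0 < c" by (simp add: c_def)
  have GL: "\<bar>G \<rho> q \<iota> z u - G \<rho> q \<iota> z' u\<bar> \<le> c * norm (z - z')"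
    if \<rho>: "finite \<rho>" "card \<rho> \<le> k + 1" for \<rho> q \<iota> z z' u
  proof -
    have comp: "\<bar>z $ i - z' $ i\<bar> \<le> norm (z - z')" for i
      using component_le_norm_cart[of "z - z'" i] by simp
    have le: "norm (z - z') \<le> c * norm (z - z')" by (simp add: c_def distrib_right)
    have "\<bar>(\<Sum>u\<in>\<rho>-{q}. z' $ \<iota> u) - (\<Sum>u\<in>\<rho>-{q}. z $ \<iota> u)\<bar> \<le> (\<Sum>u\<in>\<rho>-{q}. \<bar>z' $ \<iota> u - z $ \<iota> u\<bar>)"
      unfolding sum_subtractf[symmetric] by (rule sum_abs)
    also have "\<dots> \<le> (\<Sum>u\<in>\<rho>-{q}. norm (z - z'))" using comp by (intro sum_mono) (simp add: abs_minus_commute)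
    also have "\<dots> = real (card (\<rho> - {q})) * norm (z - z')" by simp
    also have "\<dots> \<le> c * norm (z - z')"
    proof (rule mult_right_mono)
      have "card (\<rho> - {q}) \<le> card \<rho>" using \<rho>(1) by (intro card_mono) auto
      then show "real (card (\<rho> - {q})) \<le> c" using \<rho>(2) unfolding c_def by linarith
    qed simp
    finally show ?thesis using comp[of "\<iota> u"] le by (auto simp: G_def)
  qed
  define G1 where "G1 = G \<sigma> s (\<lambda>u. h (Inl u))"
  define G2 where "G2 = G \<tau> t (\<lambda>u. h (Inr u))"
  have GL1: "\<bar>G1 z u - G1 z' u\<bar> \<le> c * norm (z - z')" and GL2: "\<bar>G2 z u - G2 z' u\<bar> \<le> c * norm (z - z')" for z z' u
    using GL \<sigma> \<tau> by (auto simp: G1_def G2_def)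
  define S where "S = {z. z $ i0 = 0 \<and> G1 z \<in> closed_simplex \<sigma> \<and> G2 z \<in> closed_simplex \<tau> \<and> G1 z v \<noteq> G2 z v}"
  define e where "e z = G2 z v - G1 z v" for z
  define N where "N z = g (G1 z) - g (G2 z)" for z
  define \<phi> where "\<phi> z = (1 / e z) *\<^sub>R N z" for z
  have "negligible S"
    by (rule negligible_subset[OF negligible_standard_hyperplane_cart[of i0]]) (auto simp: S_def)
  have "negligible (\<phi> ` S)"
  proof (rule negligible_locally_Lipschitz_image)
    fix z assume z: "z \<in> S"
    have ez: "e z \<noteq> 0" using z by (auto simp: S_def e_def)
    \<comment> \<open>On the ball of this radius the denominator keeps at least half of its absolute
      value, because \<open>e\<close> is Lipschitz with constant \<open>2 * c\<close>.\<close>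
    define \<eta> where "\<eta> = \<bar>e z\<bar> / (4 * c)"
    have \<eta>: "0 < \<eta>" using ez c0 by (simp add: \<eta>_def)
    define b where "b = (2 / \<bar>e z\<bar>) * (2 * \<Lambda> * c) + (4 * c / (\<bar>e z\<bar> * \<bar>e z\<bar>)) * norm (N z)"
    have "norm (\<phi> z' - \<phi> z) \<le> b * norm (z' - z)" if z': "z' \<in> S \<inter> ball z \<eta>" for z'
    proof -
      let ?r = "norm (z' - z)"
      have r: "?r < \<eta>" using z' by (simp add: dist_norm norm_minus_commute)
      have e_diff: "\<bar>e z' - e z\<bar> \<le> 2 * c * ?r"
        using GL1[of z' v z] GL2[of z' v z] unfolding e_def by linarith
      also have "\<dots> \<le> 2 * c * \<eta>" using r c0 by (intro mult_left_mono) auto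
      also have "\<dots> = \<bar>e z\<bar> / 2" using c0 by (simp add: \<eta>_def)
      finally have half: "\<bar>e z\<bar> / 2 \<le> \<bar>e z'\<bar>" by linarith
      have ez': "0 < \<bar>e z'\<bar>" using half ez by linarith
      have "norm (g (G1 z') - g (G1 z)) \<le> \<Lambda> * (c * ?r)"
        using lip(1) GL1[of z' _ z] z z' c0 unfolding lipschitz_on_simplex_def S_def by auto
      moreover have "norm (g (G2 z') - g (G2 z)) \<le> \<Lambda> * (c * ?r)"
        using lip(2) GL2[of z' _ z] z z' c0 unfolding lipschitz_on_simplex_def S_def by auto
      moreover have "N z' - N z = (g (G1 z') - g (G1 z)) - (g (G2 z') - g (G2 z))" by (simp add: N_def)
      ultimately have N: "norm (N z' - N z) \<le> 2 * \<Lambda> * c * ?r"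
        using norm_triangle_ineq4[of "g (G1 z') - g (G1 z)" "g (G2 z') - g (G2 z)"] by simp
      have "\<phi> z' - \<phi> z = (1 / e z') *\<^sub>R (N z' - N z) + (1 / e z' - 1 / e z) *\<^sub>R N z"
        by (simp add: \<phi>_def algebra_simps)
      then have "norm (\<phi> z' - \<phi> z) \<le> \<bar>1 / e z'\<bar> * norm (N z' - N z) + \<bar>1 / e z' - 1 / e z\<bar> * norm (N z)"
        using norm_triangle_ineq[of "(1 / e z') *\<^sub>R (N z' - N z)" "(1 / e z' - 1 / e z) *\<^sub>R N z"]
        by (simp only: norm_scaleR)
      also have "\<dots> \<le> (2 / \<bar>e z\<bar>) * (2 * \<Lambda> * c * ?r) + (4 * c * ?r / (\<bar>e z\<bar> * \<bar>e z\<bar>)) * norm (N z)"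
      proof (intro add_mono mult_mono N mult_right_mono)
        have "1 / \<bar>e z'\<bar> \<le> 1 / (\<bar>e z\<bar> / 2)" using half ez by (intro divide_left_mono) auto
        then show "\<bar>1 / e z'\<bar> \<le> 2 / \<bar>e z\<bar>" by simp
        have "\<bar>1 / e z' - 1 / e z\<bar> = \<bar>e z' - e z\<bar> / (\<bar>e z'\<bar> * \<bar>e z\<bar>)"
        proof -
          have "1 / e z' - 1 / e z = (e z - e z') / (e z' * e z)" using ez ez' by (simp add: diff_frac_eq)
          then show ?thesis by (simp only: abs_divide abs_mult abs_minus_commute[of "e z"])
        qed
        also have "\<dots> \<le> (2 * c * ?r) / ((\<bar>e z\<bar> / 2) * \<bar>e z\<bar>)"
        proof (rule frac_le)
          show "0 < \<bar>e z\<bar> / 2 * \<bar>e z\<bar>" using ez by (intro mult_pos_pos) auto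
          show "\<bar>e z\<bar> / 2 * \<bar>e z\<bar> \<le> \<bar>e z'\<bar> * \<bar>e z\<bar>" by (rule mult_right_mono[OF half]) simp
        qed (use e_diff c0 in auto)
        also have "\<dots> = 4 * c * ?r / (\<bar>e z\<bar> * \<bar>e z\<bar>)" using ez by (simp add: field_simps)
        finally show "\<bar>1 / e z' - 1 / e z\<bar> \<le> 4 * c * ?r / (\<bar>e z\<bar> * \<bar>e z\<bar>)" .
      qed (use c0 \<Lambda> in auto)
      also have "\<dots> = b * ?r" by (simp add: b_def algebra_simps)
      finally show ?thesis .
    qed
    then show "\<exists>T B. open T \<and> z \<in> T \<and> (\<forall>y\<in>S \<inter> T. norm (\<phi> y - \<phi> z) \<le> B * norm (y - z))"
      using \<eta> by (intro exI[of _ "ball z \<eta>"] exI[of _ b]) auto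
  qed (use \<open>negligible S\<close> in auto)
  moreover have "{(1 / (y v - x v)) *\<^sub>R (g x - g y) | x y. x \<in> closed_simplex \<sigma> \<and> y \<in> closed_simplex \<tau> \<and> x v \<noteq> y v} \<subseteq> \<phi> ` S"
  proof clarify
    fix x y assume xy: "x \<in> closed_simplex \<sigma>" "y \<in> closed_simplex \<tau>" "x v \<noteq> y v"
    define z :: "real^'n" where
      "z = (\<chi> i. if i \<in> h ` ?D then case_sum x y (inv_into ?D h i) else 0)"
    have z1: "z $ h (Inl u) = x u" if "u \<in> \<sigma> - {s}" for u
    proof -
      have "Inl u \<in> ?D" using that by auto
      then show ?thesis using inv_into_f_f[OF h(2)] by (auto simp: z_def)
    qed
    have z2: "z $ h (Inr u) = y u" if "u \<in> \<tau> - {t}" for u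
    proof -
      have "Inr u \<in> ?D" using that by auto
      then show ?thesis using inv_into_f_f[OF h(2)] by (auto simp: z_def)
    qed
    have recover: "G \<rho> q \<iota> z = w"
      if "finite \<rho>" "q \<in> \<rho>" "w \<in> closed_simplex \<rho>" and \<iota>: "\<And>u. u \<in> \<rho> - {q} \<Longrightarrow> z $ \<iota> u = w u" for \<rho> q \<iota> w
    proof
      fix u
      have "(\<Sum>u\<in>\<rho>-{q}. z $ \<iota> u) = (\<Sum>u\<in>\<rho>-{q}. w u)" using \<iota> by (intro sum.cong) auto
      moreover have "(\<Sum>u\<in>\<rho>. w u) = w q + (\<Sum>u\<in>\<rho>-{q}. w u)" using that by (intro sum.remove) auto
      ultimately show "G \<rho> q \<iota> z u = w u" using that by (auto simp: G_def closed_simplex_def)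
    qed
    have "G1 z = x" unfolding G1_def by (rule recover[OF \<sigma>(1) s xy(1) z1])
    moreover have "G2 z = y" unfolding G2_def by (rule recover[OF \<tau>(1) t xy(2) z2])
    moreover have "z $ i0 = 0" using h(1) by (auto simp: z_def)
    ultimately have "z \<in> S" "\<phi> z = (1 / (y v - x v)) *\<^sub>R (g x - g y)"
      using xy by (auto simp: S_def \<phi>_def e_def N_def)
    then show "(1 / (y v - x v)) *\<^sub>R (g x - g y) \<in> \<phi> ` S" by (metis image_eqI)
  qed
  ultimately show ?thesis by (rule negligible_subset)
qed

lemma lipschitz_on_simplex_lin:
  assumes "finite V" "lipschitz_on_simplex \<Lambda> \<sigma> f"
  obtains \<Lambda>' where "\<Lambda> \<le> \<Lambda>'" "lipschitz_on_simplex \<Lambda>' \<sigma> (\<lambda>x. f x + lin V b x)"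
proof
  let ?\<Lambda>' = "\<Lambda> + (\<Sum>v\<in>V. norm (b v))"
  show "\<Lambda> \<le> ?\<Lambda>'" by (simp add: sum_nonneg)
  show "lipschitz_on_simplex ?\<Lambda>' \<sigma> (\<lambda>x. f x + lin V b x)"
    unfolding lipschitz_on_simplex_def
  proof (intro ballI allI impI)
    fix x y \<delta> assume xy: "x \<in> closed_simplex \<sigma>" "y \<in> closed_simplex \<sigma>" "0 \<le> \<delta>" "\<forall>v. \<bar>x v - y v\<bar> \<le> \<delta>"
    have "norm (lin V b x - lin V b y) \<le> (\<Sum>v\<in>V. \<delta> * norm (b v))"
      unfolding lin_diff unfolding lin_def using xy by (intro sum_norm_le) (auto intro!: mult_right_mono)
    moreover have "norm (f x - f y) \<le> \<Lambda> * \<delta>" using assms(2) xy unfolding lipschitz_on_simplex_def by blast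
    moreover have "norm ((f x + lin V b x) - (f y + lin V b y)) = norm ((f x - f y) + (lin V b x - lin V b y))"
      by (simp add: algebra_simps)
    ultimately have *: "norm (lin V b x - lin V b y) \<le> (\<Sum>v\<in>V. \<delta> * norm (b v))" "norm (f x - f y) \<le> \<Lambda> * \<delta>"
        "norm ((f x + lin V b x) - (f y + lin V b y)) = norm ((f x - f y) + (lin V b x - lin V b y))" by blast+
    show "norm ((f x + lin V b x) - (f y + lin V b y)) \<le> ?\<Lambda>' * \<delta>"
    proof -
      have "(\<Sum>v\<in>V. \<delta> * norm (b v)) = (\<Sum>v\<in>V. norm (b v)) * \<delta>"
        by (simp add: sum_distrib_left mult.commute)
      then show ?thesis
        using * norm_triangle_ineq[of "f x - f y" "lin V b x - lin V b y"]
        unfolding distrib_right by linarith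
    qed
  qed
qed

text \<open>Vertices receive their vectors one at a time. The invariant for \<open>W\<close> is that
  distinct points agreeing outside \<open>W\<close> have distinct images. When \<open>v\<close> is
  added, points with the same coordinate at \<open>v\<close> are shifted equally and stay apart; for
  the others a collision would make the new vector one of the slopes of the preceding lemma, and
  these form a null set.\<close>

lemma injective_perturbation:
  fixes f :: "(nat \<Rightarrow> real) \<Rightarrow> real^'n"
  assumes X: "is_complex X" and dim: "\<forall>\<sigma>\<in>X. card \<sigma> \<le> k + 1" and kn: "2 * k + 1 \<le> CARD('n)"
    and \<Lambda>: "0 \<le> \<Lambda>" "\<forall>\<sigma>\<in>X. lipschitz_on_simplex \<Lambda> \<sigma> f" and \<epsilon>: "0 < \<epsilon>"
  shows "\<exists>b. (\<forall>v. norm (b v) \<le> \<epsilon>) \<and> inj_on (\<lambda>x. f x + lin (vertices X) b x) (realization X)"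
proof -
  have simplexD: "finite \<sigma>" "\<sigma> \<noteq> {}" "card \<sigma> \<le> k + 1" "\<sigma> \<subseteq> vertices X" if "\<sigma> \<in> X" for \<sigma>
    using complexD[OF X that] dim that by auto
  have finX: "finite X" using X by (simp add: is_complex_def)
  have "\<exists>b. (\<forall>v. norm (b v) \<le> \<epsilon>) \<and> (\<forall>x\<in>realization X. \<forall>y\<in>realization X. x \<noteq> y \<longrightarrow>
      (\<forall>u. u \<notin> W \<longrightarrow> x u = y u) \<longrightarrow> f x + lin W b x \<noteq> f y + lin W b y)" if "finite W" for W
    using that
  proof (induction W rule: finite_induct)
    case empty
    then show ?case using \<epsilon> by (intro exI[of _ "\<lambda>_. 0"]) (auto simp: fun_eq_iff)
  next
    case (insert v W)
    then obtain b where b: "\<forall>v. norm (b v) \<le> \<epsilon>" and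
      sepW: "\<And>x y. x \<in> realization X \<Longrightarrow> y \<in> realization X \<Longrightarrow> x \<noteq> y \<Longrightarrow> (\<And>u. u \<notin> W \<Longrightarrow> x u = y u) \<Longrightarrow>
        f x + lin W b x \<noteq> f y + lin W b y" by metis
    define g where "g x = f x + lin W b x" for x
    define Bad where "Bad = (\<Union>\<sigma>\<in>X. \<Union>\<tau>\<in>X. {(1 / (y v - x v)) *\<^sub>R (g x - g y) | x y.
        x \<in> closed_simplex \<sigma> \<and> y \<in> closed_simplex \<tau> \<and> x v \<noteq> y v})"
    have "negligible Bad"
    proof -
      have "negligible {(1 / (y v - x v)) *\<^sub>R (g x - g y) | x y.
        x \<in> closed_simplex \<sigma> \<and> y \<in> closed_simplex \<tau> \<and> x v \<noteq> y v}" if st: "\<sigma> \<in> X" "\<tau> \<in> X" for \<sigma> \<tau>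
      proof -
        have "lipschitz_on_simplex \<Lambda> \<sigma> f" "lipschitz_on_simplex \<Lambda> \<tau> f" using \<Lambda> st by auto
        then obtain \<Lambda>1 \<Lambda>2 where L: "\<Lambda> \<le> \<Lambda>1" "lipschitz_on_simplex \<Lambda>1 \<sigma> g" "\<Lambda> \<le> \<Lambda>2" "lipschitz_on_simplex \<Lambda>2 \<tau> g"
          using lipschitz_on_simplex_lin[OF insert.hyps(1), of \<Lambda> \<sigma> f b]
            lipschitz_on_simplex_lin[OF insert.hyps(1), of \<Lambda> \<tau> f b]
          unfolding g_def[abs_def] by metis
        have "lipschitz_on_simplex (max \<Lambda>1 \<Lambda>2) \<sigma> g" "lipschitz_on_simplex (max \<Lambda>1 \<Lambda>2) \<tau> g"
          using L(2,4) unfolding lipschitz_on_simplex_def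
          by (meson order_trans mult_right_mono max.cobounded1 max.cobounded2)+
        then show ?thesis
          using \<Lambda>(1) L(1) by (intro negligible_slopes[OF simplexD(1-3)[OF st(1)] simplexD(1-3)[OF st(2)] kn]) auto
      qed
      then show ?thesis unfolding Bad_def using finX by (intro negligible_Union finite_imageI ballI) auto
    qed
    moreover have "\<not> negligible (ball (0 :: real^'n) \<epsilon>)" using \<epsilon> by (intro open_not_negligible) auto
    ultimately have "\<not> ball 0 \<epsilon> \<subseteq> Bad" using negligible_subset by blast
    then obtain \<beta> where "\<beta> \<in> ball 0 \<epsilon>" "\<beta> \<notin> Bad" by blast
    then have \<beta>: "norm \<beta> < \<epsilon>" "\<beta> \<notin> Bad" by simp_all
    let ?b = "b(v := \<beta>)"
    have lin: "f x + lin (insert v W) ?b x = g x + x v *\<^sub>R \<beta>" for x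
    proof -
      have "(\<Sum>u\<in>W. x u *\<^sub>R ?b u) = lin W b x" unfolding lin_def using insert.hyps by (intro sum.cong) auto
      then show ?thesis using insert.hyps by (simp add: lin_def g_def)
    qed
    have "f x + lin (insert v W) ?b x \<noteq> f y + lin (insert v W) ?b y"
      if xy: "x \<in> realization X" "y \<in> realization X" "x \<noteq> y" "\<forall>u. u \<notin> insert v W \<longrightarrow> x u = y u" for x y
    proof
      assume "f x + lin (insert v W) ?b x = f y + lin (insert v W) ?b y"
      then have eq: "g x - g y = (y v - x v) *\<^sub>R \<beta>" unfolding lin by (simp add: algebra_simps)
      show False
      proof (cases "x v = y v")
        case True
        have "x u = y u" if "u \<notin> W" for u using xy(4) True that by (cases "u = v") auto
        then show False using sepW[OF xy(1-3)] eq True by (simp add: g_def)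
      next
        case False
        then have "\<beta> = (1 / (y v - x v)) *\<^sub>R (g x - g y)" unfolding eq by simp
        moreover obtain \<sigma> \<tau> where "\<sigma> \<in> X" "x \<in> closed_simplex \<sigma>" "\<tau> \<in> X" "y \<in> closed_simplex \<tau>"
          using xy(1,2) by (auto simp: realization_def)
        ultimately have "\<beta> \<in> Bad" using False unfolding Bad_def by blast
        then show False using \<beta>(2) by simp
      qed
    qed
    moreover have "\<forall>u. norm (?b u) \<le> \<epsilon>" using b \<beta>(1) by auto
    ultimately show ?case by blast
  qed
  from this[OF finite_vertices[OF X]] obtain b where b: "\<forall>v. norm (b v) \<le> \<epsilon>" and
    sep: "\<And>x y. x \<in> realization X \<Longrightarrow> y \<in> realization X \<Longrightarrow> x \<noteq> y \<Longrightarrow> (\<And>u. u \<notin> vertices X \<Longrightarrow> x u = y u) \<Longrightarrow>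
        f x + lin (vertices X) b x \<noteq> f y + lin (vertices X) b y" by metis
  have "x u = 0" if "x \<in> realization X" "u \<notin> vertices X" for x u
    using that by (auto simp: realization_def closed_simplex_def vertices_def)
  then have "inj_on (\<lambda>x. f x + lin (vertices X) b x) (realization X)"
    using sep by (intro inj_onI) (metis (no_types, lifting))
  then show ?thesis using b by blast
qed

section \<open>Compactness and topological embeddings\<close>

lemma compact_closed_simplex:
  assumes "finite \<sigma>"
  shows "compact (closed_simplex \<sigma>)"
proof -
  have "compact (PiE UNIV (\<lambda>_::nat. {0..1::real}))"
    using compactin_PiE[of "\<lambda>_. euclidean" UNIV "\<lambda>_::nat. {0..1::real}"]
    by (simp add: euclidean_product_topology)
  moreover have "closed (closed_simplex \<sigma>)"
  proof -
    have c: "continuous_on UNIV (\<lambda>x::nat \<Rightarrow> real. x v)" for v by (rule continuous_on_product_coordinates)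
    have "closed_simplex \<sigma> = (\<Inter>v. {x. 0 \<le> x v}) \<inter> (\<Inter>v\<in>-\<sigma>. {x. x v = 0}) \<inter> {x. (\<Sum>v\<in>\<sigma>. x v) = 1}"
      by (auto simp: closed_simplex_def)
    also have "closed \<dots>"
      by (intro closed_Int closed_INT ballI closed_Collect_le closed_Collect_eq continuous_on_sum c continuous_on_const)
    finally show ?thesis .
  qed
  moreover have "closed_simplex \<sigma> \<subseteq> PiE UNIV (\<lambda>_. {0..1})"
    using closed_simplex_le_1[OF _ assms] by auto
  ultimately show ?thesis using compact_Int_closed[of "PiE UNIV (\<lambda>_. {0..1})"] by (metis Int_absorb1)
qed

text \<open>A continuous injection of a compact space into a Hausdorff space is an embedding, so
  injectivity is all that has to be arranged.\<close>

lemma complex_embedding_of_inj: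
  fixes f :: "(nat \<Rightarrow> real) \<Rightarrow> real^'n"
  assumes X: "is_complex X" and "continuous_on (realization X) f" "inj_on f (realization X)"
  shows "complex_embedding X f"
  unfolding complex_embedding_def
proof (rule continuous_imp_embedding_map)
  have "compact (realization X)" unfolding realization_def
    using X complexD(1)[OF X] by (intro compact_UN compact_closed_simplex) (auto simp: is_complex_def)
  then show "compact_space (top_of_set (realization X))"
    by (simp add: compact_space_subtopology compactin_euclidean_iff)
qed (use assms in \<open>auto simp: Hausdorff_space_euclidean\<close>)

lemma closed_simplex_nonempty:
  assumes "finite \<sigma>" "\<sigma> \<noteq> {}"
  shows "closed_simplex \<sigma> \<noteq> {}"
proof -
  obtain v where "v \<in> \<sigma>" using assms by blast
  then have "(\<lambda>u. if u = v then 1 else 0) \<in> closed_simplex \<sigma>" using assms by (auto simp: closed_simplex_def)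
  then show ?thesis by blast
qed

section \<open>The embedding theorem\<close>

text \<open>Since \<open>ln 1 = 0\<close>, the radius bound forces the image to be the origin. The
  realization is a point, and thickness holds vacuously because no two simplices are
  disjoint.\<close>

lemma embedding_of_single_vertex:
  assumes X: "is_complex X" and "card (vertices X) = 1"
  shows "complex_embedding X (\<lambda>_. 0 :: real^'n)"
    and "combinatorial_thickness_at_least X (\<lambda>_. 0 :: real^'n) 1"
proof -
  obtain v where v: "vertices X = {v}" using assms(2) card_1_singletonE by blast
  have single: "\<sigma> = {v}" if "\<sigma> \<in> X" for \<sigma> using complexD(2,3)[OF X that] v by auto
  have "x = y" if "x \<in> realization X" "y \<in> realization X" for x y
  proof
    fix u
    have "x \<in> closed_simplex {v}" "y \<in> closed_simplex {v}"
      using that single unfolding realization_def by blast+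
    then show "x u = y u" by (cases "u = v") (auto simp: closed_simplex_def)
  qed
  then have "inj_on (\<lambda>_. 0 :: real^'n) (realization X)" by (auto simp: inj_on_def)
  then show "complex_embedding X (\<lambda>_. 0 :: real^'n)"
    by (intro complex_embedding_of_inj X continuous_on_const)
  show "combinatorial_thickness_at_least X (\<lambda>_. 0 :: real^'n) 1"
    using single unfolding combinatorial_thickness_at_least_def non_adjacent_def by blast
qed

lemma embedding_in_ball_fixed_dimension:
  fixes k L :: nat
  assumes kn: "2 * k + 1 \<le> CARD('n)"
  shows "\<exists>C\<ge>0. \<forall>X. is_complex X \<longrightarrow> has_dimension X k \<longrightarrow>
     (\<forall>v\<in>vertices X. card {\<sigma>\<in>X. v \<in> \<sigma>} \<le> L) \<longrightarrow>
     (\<exists>R (I :: (nat \<Rightarrow> real) \<Rightarrow> real^'n). complex_embedding X I \<and> combinatorial_thickness_at_least X I 1 \<and>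
        I ` realization X \<subseteq> cball 0 R \<and>
        R \<le> C * real (card (vertices X)) powr (1 / (real CARD('n) - real k))
              * ln (real (card (vertices X))) ^ (2 * k + 2))"
proof -
  define n where "n = CARD('n)"
  have kn': "k < CARD('n)" using kn by simp
  \<comment> \<open>The order matters: the radius \<open>r\<close> depends on the box factor
    \<open>B\<close>, and the density constant \<open>C1\<close> depends on
    \<open>r\<close>.\<close>
  obtain B where B: "1 \<le> B" and spread: "\<forall>r\<ge>0. \<exists>C>0. \<forall>X R m. bounded_complex k L X \<longrightarrow> 1 \<le> R \<longrightarrow>
    C * real (card (vertices X)) \<le> real R ^ (CARD('n) - k) \<longrightarrow> (R * B) ^ CARD('n) < 2 ^ m \<longrightarrow>
    (\<exists>p :: nat \<Rightarrow> real^'n. well_spread X R B r (m * ((k + 1) * L)) p)"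
    using spread_positions[OF kn', of L] by (elim exE conjE)
  obtain r C2 C3 where r: "0 \<le> r" and C23: "0 \<le> C2" "0 \<le> C3" and
    pert: "\<forall>X R M J (p :: nat \<Rightarrow> real^'n).
    bounded_complex k L X \<longrightarrow> 1 \<le> R \<longrightarrow> 1 \<le> J \<longrightarrow> C2 * real M \<le> real J \<longrightarrow>
    well_spread X R B r M p \<longrightarrow>
    (\<exists>(f :: (nat \<Rightarrow> real) \<Rightarrow> real^'n) \<Lambda>. continuous_on UNIV f \<and>
       0 \<le> \<Lambda> \<and> (\<forall>\<sigma>\<in>X. lipschitz_on_simplex \<Lambda> \<sigma> f) \<and>
       (\<forall>x\<in>realization X. norm (f x) \<le> C3 * real R) \<and>
       (\<forall>\<sigma>\<in>X. \<forall>\<tau>\<in>X. \<sigma> \<inter> \<tau> = {} \<longrightarrow>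
          (\<forall>x\<in>closed_simplex \<sigma>. \<forall>y\<in>closed_simplex \<tau>. 1 / real J \<le> norm (f x - f y))))"
    using separating_perturbation[OF kn, where B = B and L = L] by (elim exE conjE)
  obtain C1 where C1: "0 < C1" and place: "\<forall>X R m. bounded_complex k L X \<longrightarrow> 1 \<le> R \<longrightarrow>
    C1 * real (card (vertices X)) \<le> real R ^ (CARD('n) - k) \<longrightarrow> (R * B) ^ CARD('n) < 2 ^ m \<longrightarrow>
    (\<exists>p :: nat \<Rightarrow> real^'n. well_spread X R B r (m * ((k + 1) * L)) p)"
    using spread[rule_format, OF r] by (elim exE conjE)
  define \<alpha> where "\<alpha> = 1 / (real n - real k)"
  have nk: "real n - real k = real (n - k)" "1 \<le> n - k" using kn by (auto simp: n_def)
  have \<alpha>: "0 < \<alpha>" "\<alpha> \<le> 1" "\<alpha> * real (n - k) = 1" using nk by (auto simp: \<alpha>_def)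
  \<comment> \<open>\<open>C5\<close>, \<open>C6\<close> and \<open>C7\<close> compare
    \<open>R\<close> with \<open>N powr \<alpha>\<close>, \<open>m\<close> with
    \<open>log 2 N\<close>, and \<open>J\<close> with \<open>m\<close>. The power of
    \<open>ln 2\<close> in \<open>C\<close> converts binary to natural logarithms.\<close>
  define C5 where "C5 = C1 powr \<alpha> + 1"
  define C6 where "C6 = real n * \<bar>log 2 (C5 * real B)\<bar> + real n + 2"
  define C7 where "C7 = C2 * (real (k + 1) * real L) + 2"
  define C where "C = (2 * C3 + 1) * C7 * C6 * C5 / ln 2 ^ (2 * k + 2)"
  have C5: "1 \<le> C5" by (simp add: C5_def)
  have C6: "0 \<le> C6" and C7: "0 \<le> C7" using C23 by (auto simp: C6_def C7_def)
  have C0: "0 \<le> C" using C5 C6 C7 C23 by (simp add: C_def)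
  show ?thesis
  proof (rule exI[of _ C], rule conjI[OF C0], intro allI impI)
    fix X
    assume X: "is_complex X" and hd: "has_dimension X k" and deg: "\<forall>v\<in>vertices X. card {\<sigma>\<in>X. v \<in> \<sigma>} \<le> L"
    define V where "V = vertices X"
    define N where "N = card V"
    have finV: "finite V" using finite_vertices[OF X] by (simp add: V_def)
    have dim: "\<forall>\<sigma>\<in>X. card \<sigma> \<le> k + 1" using hd by (simp add: has_dimension_def)
    obtain \<sigma>0 where "\<sigma>0 \<in> X" "card \<sigma>0 = k + 1" using hd by (auto simp: has_dimension_def)
    then have "N \<noteq> 0" using complexD[OF X \<open>\<sigma>0 \<in> X\<close>] finV by (auto simp: N_def V_def)
    show "\<exists>R (I :: (nat \<Rightarrow> real) \<Rightarrow> real^'n). complex_embedding X I \<and> combinatorial_thickness_at_least X I 1 \<and>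
        I ` realization X \<subseteq> cball 0 R \<and>
        R \<le> C * real (card (vertices X)) powr (1 / (real CARD('n) - real k))
              * ln (real (card (vertices X))) ^ (2 * k + 2)"
    proof (cases "N = 1")
      case True
      then have "card (vertices X) = 1" by (simp add: N_def V_def)
      then show ?thesis
        using embedding_of_single_vertex[OF X, where 'n = 'n]
        by (intro exI[of _ "0::real"] exI[of _ "\<lambda>_. 0 :: real^'n"]) auto
    next
      case False
      then have N2: "2 \<le> N" using \<open>N \<noteq> 0\<close> by simp
      \<comment> \<open>The real number whose power \<open>n - k\<close> is exactly
        \<open>C1 * N\<close>; rounding it up to \<open>R\<close> adds at most 1, absorbed by the 1
        in \<open>C5\<close>.\<close>
      define x where "x = (C1 * real N) powr \<alpha>"
      define R where "R = nat \<lceil>x\<rceil>"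
      have x0: "0 < x" using C1 N2 by (simp add: x_def)
      have R1: "1 \<le> R" using x0 unfolding R_def by linarith
      have Rx: "x \<le> real R" "real R \<le> x + 1" using x0 unfolding R_def by linarith+
      have N\<alpha>: "1 \<le> real N powr \<alpha>" using N2 \<alpha> by (intro ge_one_powr_ge_zero) auto
      have RN: "real R \<le> C5 * real N powr \<alpha>"
        using Rx(2) N\<alpha> C1 by (simp add: x_def powr_mult C5_def distrib_right)
      have RC: "C1 * real N \<le> real R ^ (n - k)"
      proof -
        have "C1 * real N = x powr (real (n - k))"
          unfolding x_def powr_powr \<alpha>(3) using C1 by simp
        also have "\<dots> = x ^ (n - k)" using x0 by (simp add: powr_realpow)
        also have "\<dots> \<le> real R ^ (n - k)" using Rx x0 by (intro power_mono) auto
        finally show ?thesis .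
      qed
      have RB1: "1 \<le> real (R * B)" using R1 B by (simp flip: of_nat_mult)
      \<comment> \<open>The \<open>+ 1\<close> after rounding down makes
        \<open>(R * B) ^ n < 2 ^ m\<close> strict.\<close>
      define m where "m = nat \<lfloor>real n * log 2 (real (R * B))\<rfloor> + 1"
      have log0: "0 \<le> log 2 (real (R * B))" using RB1 by simp
      have m: "(R * B) ^ n < 2 ^ m"
      proof -
        have "real ((R * B) ^ n) = 2 powr (real n * log 2 (real (R * B)))"
        proof -
          have "2 powr (real n * log 2 (real (R * B))) = (2 powr log 2 (real (R * B))) powr real n"
            by (simp add: powr_powr mult.commute)
          also have "2 powr log 2 (real (R * B)) = real (R * B)" using RB1 by (intro powr_log_cancel) auto
          also have "real (R * B) powr real n = real (R * B) ^ n" using RB1 by (intro powr_realpow) auto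
          finally show ?thesis by simp
        qed
        also have "\<dots> < 2 powr real m"
        proof -
          have "real n * log 2 (real (R * B)) < real m"
            unfolding m_def using log0 by (simp add: nat_add_distrib) linarith
          then show ?thesis by simp
        qed
        also have "\<dots> = real (2 ^ m)" by (simp add: powr_realpow)
        finally show ?thesis unfolding of_nat_less_iff .
      qed
      have m1: "1 \<le> real m" by (simp add: m_def)
      have logN: "1 \<le> log 2 (real N)" using N2 by simp
      have mN: "real m \<le> C6 * log 2 (real N)"
      proof -
        have "real m \<le> real n * log 2 (real (R * B)) + 1"
          unfolding m_def using log0 by (simp add: of_nat_nat)
        moreover have "log 2 (real (R * B)) \<le> log 2 (C5 * real B * real N)"
        proof -
          have "real N powr \<alpha> \<le> real N powr 1" using N2 \<alpha> by (intro powr_mono) auto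
          then have "C5 * real N powr \<alpha> \<le> C5 * real N" using C5 by (intro mult_left_mono) auto
          then have "real R \<le> C5 * real N" using RN by linarith
          then have "real R * real B \<le> C5 * real N * real B" by (intro mult_right_mono) auto
          then have "real (R * B) \<le> C5 * real B * real N" by (simp add: mult_ac)
          then show ?thesis using RB1 by (subst log_le_cancel_iff) auto
        qed
        moreover have "log 2 (C5 * real B * real N) = log 2 (C5 * real B) + log 2 (real N)"
          using C5 B N2 by (intro log_mult_pos) auto
        moreover have "log 2 (C5 * real B) \<le> \<bar>log 2 (C5 * real B)\<bar> * log 2 (real N)"
        proof -
          have "\<bar>log 2 (C5 * real B)\<bar> * 1 \<le> \<bar>log 2 (C5 * real B)\<bar> * log 2 (real N)"
            using logN by (intro mult_left_mono) auto
          then show ?thesis by linarith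
        qed
        ultimately have "log 2 (real (R * B)) \<le> (\<bar>log 2 (C5 * real B)\<bar> + 1) * log 2 (real N)"
          by (simp add: distrib_right)
        then have "real n * log 2 (real (R * B)) \<le> real n * ((\<bar>log 2 (C5 * real B)\<bar> + 1) * log 2 (real N))"
          by (intro mult_left_mono) auto
        then show ?thesis
          using \<open>real m \<le> real n * log 2 (real (R * B)) + 1\<close> logN by (simp add: C6_def algebra_simps)
      qed
      define M where "M = m * ((k + 1) * L)"
      have bX: "bounded_complex k L X" using X dim deg by (simp add: bounded_complex_def)
      have "C1 * real (card (vertices X)) \<le> real R ^ (CARD('n) - k)" "(R * B) ^ CARD('n) < 2 ^ m"
        using RC m by (simp_all add: N_def V_def n_def)
      then obtain p :: "nat \<Rightarrow> real^'n" where p: "well_spread X R B r M p"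
        using place[rule_format, OF bX R1] unfolding M_def by blast
      define J where "J = nat \<lceil>C2 * real M\<rceil> + 1"
      have J1: "1 \<le> J" and CJ: "C2 * real M \<le> real J" unfolding J_def by linarith+
      have JC: "real J \<le> C7 * real m"
      proof -
        have "0 \<le> C2 * real M" using C23 by simp
        then have "real J \<le> C2 * real M + 2" unfolding J_def by linarith
        also have "C2 * real M = C2 * (real (k + 1) * real L) * real m"
          unfolding M_def of_nat_mult by (simp only: mult_ac)
        also have "\<dots> + 2 \<le> C2 * (real (k + 1) * real L) * real m + 2 * real m"
          using m1 by linarith
        finally show ?thesis by (simp add: C7_def distrib_right)
      qed
      obtain f :: "(nat \<Rightarrow> real) \<Rightarrow> real^'n" and \<Lambda> where f: "continuous_on UNIV f"
        "\<forall>x\<in>realization X. norm (f x) \<le> C3 * real R"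
        "\<forall>\<sigma>\<in>X. \<forall>\<tau>\<in>X. \<sigma> \<inter> \<tau> = {} \<longrightarrow>
          (\<forall>x\<in>closed_simplex \<sigma>. \<forall>y\<in>closed_simplex \<tau>. 1 / real J \<le> norm (f x - f y))"
        and \<Lambda>: "0 \<le> \<Lambda>" "\<forall>\<sigma>\<in>X. lipschitz_on_simplex \<Lambda> \<sigma> f"
        using pert[rule_format, OF bX R1 J1 CJ p] by (elim exE conjE)
      \<comment> \<open>Scaling by \<open>2 * J\<close> gives separation 2. The final perturbation,
        with at most \<open>k + 1\<close> vectors of norm at most \<open>1 / (2 * (k + 1))\<close>,
        moves each of two points by at most 1/2 and leaves 1.\<close>
      define g where "g x = (2 * real J) *\<^sub>R f x" for x
      have norm_g: "norm (g x - g y) = 2 * real J * norm (f x - f y)" for x y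
        by (simp add: g_def flip: scaleR_diff_right)
      have "lipschitz_on_simplex (2 * real J * \<Lambda>) \<sigma> g" if "\<sigma> \<in> X" for \<sigma>
        using \<Lambda>(2) that unfolding lipschitz_on_simplex_def norm_g mult.assoc
        by (intro ballI allI impI mult_left_mono) auto
      then obtain b where b: "\<forall>v. norm (b v) \<le> 1 / (2 * (real k + 1))"
        and inj: "inj_on (\<lambda>x. g x + lin (vertices X) b x) (realization X)"
        using injective_perturbation[OF X dim kn, of "2 * real J * \<Lambda>" g "1 / (2 * (real k + 1))"] \<Lambda>(1) by auto
      define I where "I x = g x + lin (vertices X) b x" for x
      have small: "norm (I x - g x) \<le> 1 / 2" if "\<sigma> \<in> X" "x \<in> closed_simplex \<sigma>" for \<sigma> x
      proof -
        have "norm (lin V b x) \<le> real (k + 1) * (1 * (1 / (2 * (real k + 1))))"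
        proof (rule norm_lin_le)
          show "finite V" "\<sigma> \<subseteq> V" "card \<sigma> \<le> k + 1" using finV complexD[OF X that(1)] dim that(1) by (auto simp: V_def)
          show "x v = 0" if "v \<notin> \<sigma>" for v using that \<open>x \<in> closed_simplex \<sigma>\<close> by (simp add: closed_simplex_def)
          show "\<bar>x v\<bar> \<le> 1" for v using closed_simplex_le_1[OF that(2) complexD(1)[OF X that(1)], of v] by simp
        qed (use b in auto)
        also have "\<dots> = 1 / 2" by (simp add: add.commute)
        finally show ?thesis by (simp add: I_def V_def)
      qed
      have "continuous_on (realization X) I"
      proof -
        have c: "continuous_on (realization X) (\<lambda>x. x v)" for v
          by (rule continuous_on_subset[OF continuous_on_product_coordinates]) simp
        have "continuous_on (realization X) f" by (rule continuous_on_subset[OF f(1)]) simp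
        then show ?thesis unfolding I_def g_def lin_def by (intro continuous_intros c)
      qed
      then have emb: "complex_embedding X I"
        using inj by (intro complex_embedding_of_inj X) (simp_all add: I_def[abs_def])
      have thick: "combinatorial_thickness_at_least X I 1"
        unfolding combinatorial_thickness_at_least_def
      proof (intro ballI impI)
        fix \<sigma> \<tau> assume st: "\<sigma> \<in> X" "\<tau> \<in> X" "non_adjacent \<sigma> \<tau>"
        show "1 \<le> setdist (I ` closed_simplex \<sigma>) (I ` closed_simplex \<tau>)"
        proof (rule le_setdistI)
          show "I ` closed_simplex \<sigma> \<noteq> {}" "I ` closed_simplex \<tau> \<noteq> {}"
            using closed_simplex_nonempty complexD(1,2)[OF X] st by auto
        next
          fix u w assume "u \<in> I ` closed_simplex \<sigma>" "w \<in> I ` closed_simplex \<tau>"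
          then obtain x y where xy: "x \<in> closed_simplex \<sigma>" "u = I x" "y \<in> closed_simplex \<tau>" "w = I y" by blast
          have "1 / real J \<le> norm (f x - f y)" using f(3) st xy unfolding non_adjacent_def by blast
          then have "2 * real J * (1 / real J) \<le> 2 * real J * norm (f x - f y)" by (intro mult_left_mono) auto
          then have "2 \<le> norm (g x - g y)" using J1 by (simp add: norm_g)
          moreover have "norm (g x - g y) \<le> norm (I x - I y) + norm (I x - g x) + norm (I y - g y)"
            using norm_triangle_ineq4[of "I x - I y" "I x - g x"]
              norm_triangle_ineq[of "(I x - I y) - (I x - g x)" "I y - g y"] by simp
          ultimately show "1 \<le> dist u w"
            using small[OF st(1) xy(1)] small[OF st(2) xy(3)] by (simp add: dist_norm xy)
        qed
      qed
      define \<rho> where "\<rho> = (2 * C3 + 1) * real J * real R"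
      have ball: "I ` realization X \<subseteq> cball 0 \<rho>"
      proof (intro image_subsetI)
        fix x assume x: "x \<in> realization X"
        then obtain \<sigma> where \<sigma>: "\<sigma> \<in> X" "x \<in> closed_simplex \<sigma>" by (auto simp: realization_def)
        have "norm (f x) \<le> C3 * real R" using f(2) x by blast
        then have "2 * real J * norm (f x) \<le> 2 * real J * (C3 * real R)" by (intro mult_left_mono) auto
        then have "norm (g x) \<le> 2 * C3 * real J * real R" by (simp add: g_def mult_ac)
        moreover have "norm (I x) \<le> norm (g x) + norm (I x - g x)"
          using norm_triangle_ineq[of "g x" "I x - g x"] by simp
        moreover have "1 * 1 \<le> real J * real R" using J1 R1 by (intro mult_mono) auto
        ultimately have "norm (I x) \<le> 2 * C3 * real J * real R + real J * real R"
          using small[OF \<sigma>] by linarith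
        then show "I x \<in> cball 0 \<rho>" by (simp add: \<rho>_def distrib_right)
      qed
      have "\<rho> \<le> (2 * C3 + 1) * (C7 * (C6 * log 2 (real N))) * (C5 * real N powr \<alpha>)"
      proof -
        have "real J \<le> C7 * (C6 * log 2 (real N))" using JC mult_left_mono[OF mN C7] by linarith
        then show ?thesis unfolding \<rho>_def using RN C23 C6 C7 logN by (intro mult_mono) auto
      qed
      also have "\<dots> = (2 * C3 + 1) * C7 * C6 * C5 * real N powr \<alpha> * log 2 (real N)" by (simp add: mult_ac)
      also have "\<dots> \<le> (2 * C3 + 1) * C7 * C6 * C5 * real N powr \<alpha> * (ln (real N) ^ (2 * k + 2) / ln 2 ^ (2 * k + 2))"
      proof (rule mult_left_mono)
        \<comment> \<open>For \<open>N \<ge> 2\<close> the binary logarithm is at least 1, so it is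
          bounded by its power \<open>2 * k + 2\<close>.\<close>
        have "log 2 (real N) ^ 1 \<le> log 2 (real N) ^ (2 * k + 2)" using logN by (intro power_increasing) auto
        then show "log 2 (real N) \<le> ln (real N) ^ (2 * k + 2) / ln 2 ^ (2 * k + 2)"
          by (simp add: log_def power_divide)
        show "0 \<le> (2 * C3 + 1) * C7 * C6 * C5 * real N powr \<alpha>" using C23 C5 C6 C7 by simp
      qed
      also have "\<dots> = C * real N powr \<alpha> * ln (real N) ^ (2 * k + 2)" by (simp add: C_def)
      finally have "\<rho> \<le> C * real (card (vertices X)) powr (1 / (real CARD('n) - real k))
              * ln (real (card (vertices X))) ^ (2 * k + 2)"
        by (simp add: N_def V_def \<alpha>_def n_def)
      then show ?thesis using emb thick ball by (intro exI[of _ \<rho>] exI[of _ I]) blast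
    qed
  qed
qed

theorem theorem2p1:
  fixes L :: nat
  assumes "L \<ge> 1"
  shows "\<exists>C::real. \<forall>(k::nat) X.
           CARD('n::finite) \<ge> 2 * k + 1 \<longrightarrow>
           is_complex X \<longrightarrow> has_dimension X k \<longrightarrow>
           (\<forall>v\<in>vertices X. card {\<sigma>\<in>X. v \<in> \<sigma>} \<le> L) \<longrightarrow>
           (\<exists>(R::real) (I :: (nat \<Rightarrow> real) \<Rightarrow> real ^ 'n).
              complex_embedding X I \<and>
              combinatorial_thickness_at_least X I 1 \<and>
              I ` realization X \<subseteq> cball 0 R \<and>
              R \<le> C * real (card (vertices X)) powr (1 / (real CARD('n) - real k))
                    * ln (real (card (vertices X))) ^ (2 * k + 2))"
proof -
  define P where "P k C \<longleftrightarrow> (\<forall>X. is_complex X \<longrightarrow> has_dimension X k \<longrightarrow>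
     (\<forall>v\<in>vertices X. card {\<sigma>\<in>X. v \<in> \<sigma>} \<le> L) \<longrightarrow>
     (\<exists>R (I :: (nat \<Rightarrow> real) \<Rightarrow> real^'n). complex_embedding X I \<and> combinatorial_thickness_at_least X I 1 \<and>
        I ` realization X \<subseteq> cball 0 R \<and>
        R \<le> C * real (card (vertices X)) powr (1 / (real CARD('n) - real k))
              * ln (real (card (vertices X))) ^ (2 * k + 2)))" for k and C :: real
  \<comment> \<open>The factor multiplying the constant is non-negative, the exponent of the
    logarithm being even.\<close>
  have mono: "P k C'" if P: "P k C" and "C \<le> C'" for k C C'
    unfolding P_def
  proof (intro allI impI)
    fix X assume X: "is_complex X" "has_dimension X k" "\<forall>v\<in>vertices X. card {\<sigma>\<in>X. v \<in> \<sigma>} \<le> L"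
    let ?b = "\<lambda>C. C * real (card (vertices X)) powr (1 / (real CARD('n) - real k))
              * ln (real (card (vertices X))) ^ (2 * k + 2)"
    have "?b C \<le> ?b C'"
      using \<open>C \<le> C'\<close> by (intro mult_right_mono zero_le_even_power) auto
    moreover obtain R and I :: "(nat \<Rightarrow> real) \<Rightarrow> real^'n" where "complex_embedding X I"
      "combinatorial_thickness_at_least X I 1" "I ` realization X \<subseteq> cball 0 R" "R \<le> ?b C"
      using P[unfolded P_def, THEN spec, THEN mp, OF X(1), THEN mp, OF X(2), THEN mp, OF X(3)]
      by (elim exE conjE)
    ultimately show "\<exists>R (I :: (nat \<Rightarrow> real) \<Rightarrow> real^'n). complex_embedding X I \<and> combinatorial_thickness_at_least X I 1 \<and>
        I ` realization X \<subseteq> cball 0 R \<and> R \<le> ?b C'"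
      by (intro exI[of _ R] exI[of _ I] conjI) simp_all
  qed
  have "\<exists>C\<ge>0. P k C" if "2 * k + 1 \<le> CARD('n)" for k
    unfolding P_def by (rule embedding_in_ball_fixed_dimension[OF that])
  then have "\<forall>k. \<exists>C. 0 \<le> C \<and> (2 * k + 1 \<le> CARD('n) \<longrightarrow> P k C)" by (meson order_refl)
  then obtain Ck where Ck: "\<And>k. 0 \<le> Ck k" "\<And>k. 2 * k + 1 \<le> CARD('n) \<Longrightarrow> P k (Ck k)" by metis
  \<comment> \<open>Only \<open>k \<le> n\<close> can occur, so the sum of the non-negative
    constants of all these dimensions is a constant depending on \<open>n\<close> and
    \<open>L\<close> alone.\<close>
  have "P k (\<Sum>j\<le>CARD('n). Ck j)" if "2 * k + 1 \<le> CARD('n)" for k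
    using Ck(1) that by (intro mono[OF Ck(2)[OF that]] member_le_sum) auto
  then show ?thesis unfolding P_def by (intro exI[of _ "\<Sum>j\<le>CARD('n). Ck j"]) blast
qed

end
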